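(* Let $\Sigma$ (a $d\times d_1$ matrix function) and $b$ be Borel measurable on $\mathbb{R}^d$, $A=\Sigma\Sigma^t$. Suppose there is a nonnegative Borel function $\Lambda$ on $\mathbb{R}^d$ such that $q(x,y)\le(\Lambda(x)+\Lambda(y))|x-y|^2$ for all $x,y\in\mathbb{R}^d$, and $q(x,y)<2r(x,y)$ for all $x\neq y$. Then there exists at most one probability solution $\mu$ to $L^*\mu=0$ satisfying $$\int_{\mathbb{R}^d}\Bigl(\frac{\|\Sigma(x)\|^2}{1+|x|^2}+\frac{|b(x)|}{1+|x|}+\Lambda(x)\Bigr)\mu(dx)<\infty.$$
   Context: For a symmetric nonnegative definite matrix $A(x)=(a^{ij}(x))$ and a vector field $b(x)=(b^i(x))$ with Borel measurable entries, $Lf(x)=\mathrm{trace}(A(x)D^2f(x))+\langle b(x),\nabla f(x)\rangle$. A probability solution to $L^*\mu=0$ is a Borel probability measure $\mu$ on $\mathbb{R}^d$ such that all $a^{ij}$ and $b^i$ are $\mu$-integrable on every compact set and $\int_{\mathbb{R}^d}Lf\,d\mu=0$ for every $f\in C_0^\infty(\mathbb{R}^d)$. Here $A(x)=\Sigma(x)\Sigma(x)^t$ with $\Sigma(x)$ a $d\times d_1$ matrix, and $$q(x,y)=\langle x-y,b(x)-b(y)\rangle+\mathrm{trace}\bigl((\Sigma(x)-\Sigma(y))(\Sigma(x)-\Sigma(y))^t\bigr),$$ and for $x\ne y$, $$r(x,y)=\Bigl|\bigl(\Sigma(x)-\Sigma(y)\bigr)^t\frac{x-y}{|x-y|}\Bigr|^2.$$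 *)

theory Defs
  imports "HOL-Probability.Probability"
begin

text \<open>Points of R^d are vectors of type real^'n (d = CARD('n)); the d x d1 matrix
  Sigma(x) has type real^'m^'n (rows indexed by 'n, columns by 'm, d1 = CARD('m)).\<close>

definition partial :: "'n::finite \<Rightarrow> (real^'n \<Rightarrow> real) \<Rightarrow> real^'n \<Rightarrow> real" where
  "partial i f x = frechet_derivative f (at x) (axis i 1)"

coinductive smooth_fun :: "(real^'n::finite \<Rightarrow> real) \<Rightarrow> bool" where
  "f differentiable_on UNIV \<Longrightarrow> (\<forall>i. smooth_fun (partial i f)) \<Longrightarrow> smooth_fun f"

definition test_fun :: "(real^'n::finite \<Rightarrow> real) \<Rightarrow> bool" where
  "test_fun f \<longleftrightarrow> smooth_fun f \<and> compact (closure {x. f x \<noteq> 0})"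

definition diff_A :: "(real^'n \<Rightarrow> real^'m^'n) \<Rightarrow> real^'n \<Rightarrow> real^'n^'n" where
  "diff_A \<Sigma> x = \<Sigma> x ** transpose (\<Sigma> x)"

definition gen_L :: "(real^'n::finite \<Rightarrow> real^'m::finite^'n) \<Rightarrow> (real^'n \<Rightarrow> real^'n)
    \<Rightarrow> (real^'n \<Rightarrow> real) \<Rightarrow> real^'n \<Rightarrow> real" where
  "gen_L \<Sigma> b f x =
     (\<Sum>i\<in>UNIV. \<Sum>j\<in>UNIV. diff_A \<Sigma> x $ i $ j * partial i (partial j f) x)
     + (\<Sum>i\<in>UNIV. b x $ i * partial i f x)"

definition prob_solution :: "(real^'n::finite \<Rightarrow> real^'m::finite^'n) \<Rightarrow> (real^'n \<Rightarrow> real^'n)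
    \<Rightarrow> (real^'n) measure \<Rightarrow> bool" where
  "prob_solution \<Sigma> b \<mu> \<longleftrightarrow>
     prob_space \<mu> \<and> sets \<mu> = sets borel \<and>
     (\<forall>K. compact K \<longrightarrow>
        (\<forall>i j. set_integrable \<mu> K (\<lambda>x. diff_A \<Sigma> x $ i $ j)) \<and>
        (\<forall>i. set_integrable \<mu> K (\<lambda>x. b x $ i))) \<and>
     (\<forall>f. test_fun f \<longrightarrow> integral\<^sup>L \<mu> (gen_L \<Sigma> b f) = 0)"

definition q_fun :: "(real^'n::finite \<Rightarrow> real^'m::finite^'n) \<Rightarrow> (real^'n \<Rightarrow> real^'n)
    \<Rightarrow> real^'n \<Rightarrow> real^'n \<Rightarrow> real" where
  "q_fun \<Sigma> b x y = (x - y) \<bullet> (b x - b y)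
     + trace ((\<Sigma> x - \<Sigma> y) ** transpose (\<Sigma> x - \<Sigma> y))"

definition r_fun :: "(real^'n::finite \<Rightarrow> real^'m::finite^'n) \<Rightarrow> real^'n \<Rightarrow> real^'n \<Rightarrow> real" where
  "r_fun \<Sigma> x y = (norm (transpose (\<Sigma> x - \<Sigma> y) *v ((1 / norm (x - y)) *\<^sub>R (x - y)))) ^ 2"

end

theory Submission
  imports Defs
begin

text \<open>
  Suppose \<open>\<mu> \<noteq> \<nu>\<close> are two solutions. Let \<open>L\<^sub>2\<close> be the generator of the pair of diffusions driven
  by the same noise. Applied to \<open>ln (|x - y|\<^sup>2 + e)\<close> it gives
  \<open>(2 / G) (q - 2 r s / G)\<close> with \<open>s = |x - y|\<^sup>2\<close> and \<open>G = s + e\<close>, which is negative off the diagonal for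
  small \<open>e\<close> and never exceeds \<open>2 (\<Lambda> x + \<Lambda> y) s e / G\<^sup>2\<close>. Averaging over the scales
  \<open>e, e/2, \<dots>, e/2^(N-1)\<close> makes this error \<open>O(1/N)\<close>, since the single errors telescope, while the gain
  away from the diagonal does not depend on \<open>N\<close>. As \<open>\<mu> \<noteq> \<nu>\<close>, every coupling has some mass away from
  the diagonal, so moving along \<open>L\<^sub>2\<close> strictly lowers the transport cost from \<open>\<mu>\<close> to \<open>\<nu>\<close>, although
  stationarity keeps both marginals fixed.

  No coupling is ever constructed: the argument is carried out for dual potentials \<open>u x + v y \<ge> D x y\<close>,
  where \<open>D\<close> is a constant minus the cost, cut off at zero. Averaging potentials along a small discrete
  step of the coupled dynamics, and adding functions of one variable that certify the gain, produces
  better potentials; this would lower the dual cost without bound. The measures are mollified so that the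
  effect of the step on the integrals of the potentials is controlled by stationarity tested on a single
  smooth bump and its translates.
\<close>

section \<open>Smooth bump functions\<close>

text \<open>The coefficients are only measurable and integrable in a weighted sense, so no process
  is at hand, and c-transforms yield potentials that are bounded and measurable but not smooth:
  stationarity cannot be tested on them. If a stationary point X is replaced by X + xi with xi drawn
  from a bump density, the mean defect of a potential becomes a superposition of defects of
  translated bumps. It is bounded by the supremum of the potential, the volume of a ball containing
  its support, and one error of the bump alone. This uniformity over all potentials is what permits
  a fixed gain per step. With m columns sigma_k of \<Sigma>, a step has 2 m + 1 equally weighted
  moves: plus and minus h sigma_k, and h^2 b. To leading order the second differences add up to h^2
  trace(A D^2 f), which matches the normalization of L without a factor 1/2. Both points use the
  same k and the same sign, so their difference moves along the differences of the columns and of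
  the drifts; this is how q and r enter.\<close>

definition flat_exp :: "real poly \<Rightarrow> real \<Rightarrow> real" where
  "flat_exp p t = (if t > 0 then poly p (1 / t) * exp (- 1 / t) else 0)"

text \<open>With s = 1/t, the derivative of p(s) exp(-s) in t is s^2 (p(s) - p'(s)) exp(-s). The
  family \<open>flat_exp\<close> is thus closed under differentiation, and the iterates of
  \<open>flat_deriv\<close> at 1 describe all derivatives of exp(-1/t), extended by 0.\<close>

definition flat_deriv :: "real poly \<Rightarrow> real poly" where
  "flat_deriv p = [:0, 0, 1:] * (p - pderiv p)"

text \<open>The free exponent \<open>k\<close> carries the induction: \<open>pCons a p\<close>
  splits off a constant and multiplies the rest by y, which is absorbed into
  \<open>k\<close>.\<close>

lemma poly_exp_decay: "((\<lambda>y::real. y ^ k * poly p y / exp y) \<longlongrightarrow> 0) at_top"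
proof (induction p arbitrary: k)
  case 0
  show ?case by simp
next
  case (pCons a p)
  have "((\<lambda>y::real. a * (y ^ k / exp y) + y ^ Suc k * poly p y / exp y) \<longlongrightarrow> a * 0 + 0) at_top"
    by (intro tendsto_add tendsto_mult tendsto_const tendsto_power_div_exp_0 pCons.IH)
  moreover have "a * (y ^ k / exp y) + y ^ Suc k * poly p y / exp y = y ^ k * poly (pCons a p) y / exp y" for y
    by (simp add: distrib_left add_divide_distrib mult_ac)
  ultimately show ?case by simp
qed

lemma flat_exp_at_0: "(flat_exp p has_real_derivative 0) (at 0)"
proof -
  \<comment> \<open>With y = 1/h the right difference quotient at 0 is y p(y) exp(-y), whence the
    exponent 1.\<close>
  have "((\<lambda>y::real. y ^ 1 * poly p y / exp y) \<longlongrightarrow> 0) at_top" by (rule poly_exp_decay)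
  then have "((\<lambda>t::real. (inverse t) ^ 1 * poly p (inverse t) / exp (inverse t)) \<longlongrightarrow> 0) (at_right 0)"
    using filterlim_inverse_at_top_right by (rule filterlim_compose)
  then have R: "((\<lambda>h. (flat_exp p (0 + h) - flat_exp p 0) / h) \<longlongrightarrow> 0) (at_right 0)"
    by (rule Lim_transform_eventually)
      (auto simp: flat_exp_def eventually_at_filter exp_minus divide_simps)
  have L: "((\<lambda>h. (flat_exp p (0 + h) - flat_exp p 0) / h) \<longlongrightarrow> 0) (at_left 0)"
    by (rule Lim_transform_eventually[OF tendsto_const])
      (auto simp: flat_exp_def eventually_at_filter)
  show ?thesis
    using L R unfolding DERIV_def by (simp add: filterlim_split_at)
qed

lemma flat_exp_DERIV:
  "(flat_exp p has_real_derivative flat_exp (flat_deriv p) t) (at t)"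
proof (cases t "0::real" rule: linorder_cases)
  case less
  have "((\<lambda>_. 0::real) has_real_derivative 0) (at t)" by simp
  then have "(flat_exp p has_real_derivative 0) (at t)"
    by (rule has_field_derivative_transform_within_open[of _ _ _ "{..<0}"])
      (use less in \<open>auto simp: flat_exp_def\<close>)
  then show ?thesis using less by (simp add: flat_exp_def)
next
  case equal
  then show ?thesis using flat_exp_at_0 by (simp add: flat_exp_def)
next
  case greater
  have "((\<lambda>t. poly p (1 / t) * exp (- 1 / t)) has_real_derivative
      poly (pderiv p) (1/t) * (- 1 / t\<^sup>2) * exp (- 1 / t) + poly p (1/t) * (exp (- 1 / t) * (1 / t\<^sup>2))) (at t)"
    using greater by (auto intro!: derivative_eq_intros DERIV_chain'[where g = "poly p"] simp: power2_eq_square)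
  also have "poly (pderiv p) (1/t) * (- 1 / t\<^sup>2) * exp (- 1 / t) + poly p (1/t) * (exp (- 1 / t) * (1 / t\<^sup>2))
      = flat_exp (flat_deriv p) t"
    using greater by (simp add: flat_exp_def flat_deriv_def field_simps power2_eq_square)
  finally show ?thesis
    by (rule has_field_derivative_transform_within_open[of _ _ _ "{0<..}"])
      (use greater in \<open>auto simp: flat_exp_def\<close>)
qed

definition bump_left :: "real \<Rightarrow> nat \<Rightarrow> real \<Rightarrow> real" where
  "bump_left d n t = flat_exp ((flat_deriv ^^ n) 1) (d + t)"

definition bump_right :: "real \<Rightarrow> nat \<Rightarrow> real \<Rightarrow> real" where
  "bump_right d n t = (- 1) ^ n * flat_exp ((flat_deriv ^^ n) 1) (d - t)"

text \<open>The index is the order of differentiation: this is Leibniz' formula for the n-th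
  derivative of exp(-1/(d+t)) exp(-1/(d-t)), extended by 0 outside (-d, d). Having every derivative
  as an explicit member of one family is what makes the coinductive smoothness predicate easy to
  establish.\<close>

definition bump1 :: "real \<Rightarrow> nat \<Rightarrow> real \<Rightarrow> real" where
  "bump1 d n t = (\<Sum>k\<le>n. real (n choose k) * bump_left d k t * bump_right d (n - k) t)"

lemma bump_left_DERIV [derivative_intros]:
  "(bump_left d n has_real_derivative bump_left d (Suc n) t) (at t)"
proof -
  have "(bump_left d n has_real_derivative flat_exp (flat_deriv ((flat_deriv ^^ n) 1)) (d + t) * 1) (at t)"
    unfolding bump_left_def
    by (rule DERIV_chain2[OF flat_exp_DERIV]) (auto intro!: derivative_eq_intros)
  then show ?thesis by (simp add: bump_left_def)
qed

lemma bump_right_DERIV [derivative_intros]: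
  "(bump_right d n has_real_derivative bump_right d (Suc n) t) (at t)"
proof -
  have "((\<lambda>t. flat_exp ((flat_deriv ^^ n) 1) (d - t)) has_real_derivative
      flat_exp (flat_deriv ((flat_deriv ^^ n) 1)) (d - t) * (- 1)) (at t)"
    by (rule DERIV_chain2[OF flat_exp_DERIV]) (auto intro!: derivative_eq_intros)
  from DERIV_cmult[OF this, of "(- 1) ^ n"] show ?thesis
    by (simp add: bump_right_def[abs_def])
qed

lemma bump1_DERIV: "(bump1 d n has_real_derivative bump1 d (Suc n) t) (at t)"
proof -
  let ?a = "\<lambda>k. bump_left d k t" and ?b = "\<lambda>k. bump_right d k t"
  have "(bump1 d n has_real_derivative
     (\<Sum>k\<le>n. real (n choose k) * (?a (Suc k) * ?b (n - k) + ?a k * ?b (Suc (n - k))))) (at t)"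
    unfolding bump1_def[abs_def]
    by (auto intro!: derivative_eq_intros sum.cong DERIV_sum simp: algebra_simps)
  also have "(\<Sum>k\<le>n. real (n choose k) * (?a (Suc k) * ?b (n - k) + ?a k * ?b (Suc (n - k))))
     = (\<Sum>k\<le>n. real (n choose k) * ?a (Suc k) * ?b (n - k))
      + (\<Sum>k\<le>n. real (n choose k) * ?a k * ?b (Suc n - k))"
    by (simp add: sum.distrib[symmetric] algebra_simps Suc_diff_le)
  \<comment> \<open>The term k = 0 is split off and the rest is shifted; the shifted top term has
    coefficient \<open>n choose Suc n\<close> = 0. Pascal's rule then merges the two sums.\<close>
  also have "(\<Sum>k\<le>n. real (n choose k) * ?a k * ?b (Suc n - k))
      = ?a 0 * ?b (Suc n) + (\<Sum>k\<le>n. real (n choose Suc k) * ?a (Suc k) * ?b (n - k))"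
    using sum.atMost_Suc_shift[of "\<lambda>k. real (n choose k) * ?a k * ?b (Suc n - k)" n]
    by (simp add: binomial_eq_0)
  also have "(\<Sum>k\<le>n. real (n choose k) * ?a (Suc k) * ?b (n - k))
      + (?a 0 * ?b (Suc n) + (\<Sum>k\<le>n. real (n choose Suc k) * ?a (Suc k) * ?b (n - k)))
      = bump1 d (Suc n) t"
    unfolding bump1_def sum.atMost_Suc_shift
    by (simp add: sum.distrib[symmetric] algebra_simps)
  finally show ?thesis .
qed

lemma bump1_eq_0: "d \<le> \<bar>t\<bar> \<Longrightarrow> bump1 d n t = 0"
  unfolding bump1_def
  by (intro sum.neutral ballI) (auto simp: bump_left_def bump_right_def flat_exp_def)

lemma bump1_0: "bump1 d 0 t = flat_exp 1 (d + t) * flat_exp 1 (d - t)"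
  by (simp add: bump1_def bump_left_def bump_right_def)

lemma bump1_bounded: "\<exists>B\<ge>0. \<forall>t. \<bar>bump1 d n t\<bar> \<le> B"
proof -
  have "continuous_on {-d..d} (bump1 d n)"
    by (meson DERIV_continuous_on bump1_DERIV has_field_derivative_at_within)
  then have "bounded (bump1 d n ` {-d..d})"
    by (simp add: compact_continuous_image compact_imp_bounded)
  then obtain B where B: "\<And>t. t \<in> {-d..d} \<Longrightarrow> \<bar>bump1 d n t\<bar> \<le> B"
    unfolding bounded_iff by (metis imageI real_norm_def)
  have "\<bar>bump1 d n t\<bar> \<le> max B 0" for t
  proof (cases "t \<in> {-d..d}")
    case True then show ?thesis using B[of t] by simp
  next
    case False then show ?thesis by (subst bump1_eq_0) auto
  qed
  then show ?thesis by (intro exI[of _ "max B 0"]) auto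
qed

text \<open>\<open>\<nu>\<close> is a multi-index: the function is the mixed derivative of order
  \<open>\<nu>\<close> of a product bump supported in the cube of half-side d. A partial derivative
  in direction i only raises the entry \<open>\<nu> i\<close>.\<close>

definition bump :: "real \<Rightarrow> ('n::finite \<Rightarrow> nat) \<Rightarrow> real^'n \<Rightarrow> real" where
  "bump d \<nu> x = (\<Prod>i\<in>UNIV. bump1 d (\<nu> i) (x $ i))"

lemma bump_has_derivative:
  "(bump d \<nu> has_derivative (\<lambda>v. \<Sum>i\<in>UNIV. v $ i * bump d (\<nu>(i := Suc (\<nu> i))) x)) (at x)"
proof -
  have D: "((\<lambda>x. bump1 d (\<nu> i) (x $ i)) has_derivative
      (\<lambda>v. bump1 d (Suc (\<nu> i)) (x $ i) * (v $ i))) (at x)" for i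
    by (rule has_derivative_compose[OF _ bump1_DERIV[unfolded has_field_derivative_def]])
      (rule bounded_linear_imp_has_derivative[OF bounded_linear_vec_nth])
  have "((\<lambda>x. \<Prod>i\<in>UNIV. bump1 d (\<nu> i) (x $ i)) has_derivative
      (\<lambda>v. \<Sum>i\<in>UNIV. bump1 d (Suc (\<nu> i)) (x $ i) * v $ i * (\<Prod>j\<in>UNIV - {i}. bump1 d (\<nu> j) (x $ j)))) (at x)"
    by (rule has_derivative_prod[OF D])
  moreover have "bump1 d (Suc (\<nu> i)) (x $ i) * v $ i * (\<Prod>j\<in>UNIV - {i}. bump1 d (\<nu> j) (x $ j))
      = v $ i * bump d (\<nu>(i := Suc (\<nu> i))) x" for i v
    unfolding bump_def by (subst prod.remove[of _ i]) auto
  ultimately have "((\<lambda>x. \<Prod>i\<in>UNIV. bump1 d (\<nu> i) (x $ i)) has_derivative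
      (\<lambda>v. \<Sum>i\<in>UNIV. v $ i * bump d (\<nu>(i := Suc (\<nu> i))) x)) (at x)"
    by (simp only:)
  then show ?thesis
    by (rule has_derivative_transform_within[of _ _ _ _ 1]) (auto simp: bump_def)
qed

lemma bump_shift_has_derivative:
  "((\<lambda>x. bump d \<nu> (x - z)) has_derivative (\<lambda>v. \<Sum>i\<in>UNIV. v $ i * bump d (\<nu>(i := Suc (\<nu> i))) (x - z))) (at x)"
  by (rule has_derivative_compose[OF _ bump_has_derivative]) (auto intro!: derivative_eq_intros)

lemma partial_bump:
  "partial i (\<lambda>x. bump d \<nu> (x - z)) = (\<lambda>x. bump d (\<nu>(i := Suc (\<nu> i))) (x - z))"
proof
  fix x
  have "partial i (\<lambda>x. bump d \<nu> (x - z)) x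
      = (\<Sum>j\<in>UNIV. axis i 1 $ j * bump d (\<nu>(j := Suc (\<nu> j))) (x - z))"
    unfolding partial_def
    by (subst frechet_derivative_at[OF bump_shift_has_derivative, symmetric]) simp
  also have "\<dots> = bump d (\<nu>(i := Suc (\<nu> i))) (x - z)"
    by (simp add: axis_def if_distrib[of "\<lambda>c. c * _"] cong: if_cong)
  finally show "partial i (\<lambda>x. bump d \<nu> (x - z)) x = bump d (\<nu>(i := Suc (\<nu> i))) (x - z)" .
qed

text \<open>Coinduction over all multi-indices at once: every member of the family is
  differentiable, and the family is closed under \<open>partial\<close>.\<close>

lemma smooth_fun_bump: "smooth_fun (\<lambda>x. bump d \<nu> (x - z))"
proof (coinduction arbitrary: \<nu>)
  case smooth_fun
  have "(\<lambda>x. bump d \<nu> (x - z)) differentiable_on UNIV"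
    unfolding differentiable_on_def differentiable_def
    using bump_shift_has_derivative has_derivative_at_withinI by blast
  then show ?case by (auto simp: partial_bump)
qed

lemma bump_eq_0: "d \<le> \<bar>x $ i\<bar> \<Longrightarrow> bump d \<nu> x = 0"
  unfolding bump_def by (rule prod_zero) (auto intro!: bexI[of _ i] bump1_eq_0)

lemma bump_norm_eq_0:
  fixes x :: "real^'n::finite"
  assumes "real CARD('n) * d < norm x"
  shows "bump d \<nu> x = 0"
proof (rule ccontr)
  assume "bump d \<nu> x \<noteq> 0"
  then have "\<bar>x $ i\<bar> \<le> d" for i using bump_eq_0[of d x i \<nu>] by force
  then have "norm x \<le> (\<Sum>i::'n\<in>UNIV. d)"
    using norm_le_l1_cart[of x] sum_mono[of UNIV "\<lambda>i. \<bar>x $ i\<bar>" "\<lambda>_. d"] by auto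
  then show False using assms by simp
qed

lemma test_fun_bump: "test_fun (\<lambda>x. bump d \<nu> (x - z))"
proof -
  have "{x. bump d \<nu> (x - z) \<noteq> 0} \<subseteq> cball z (real CARD('a) * d)"
    by (auto simp: dist_norm norm_minus_commute) (meson bump_norm_eq_0 not_le)
  then have "bounded {x. bump d \<nu> (x - z) \<noteq> 0}"
    using bounded_cball bounded_subset by blast
  then show ?thesis
    unfolding test_fun_def using smooth_fun_bump by (simp add: compact_closure)
qed

lemma bump_bounded: "\<exists>B\<ge>0. \<forall>x. \<bar>bump d \<nu> x\<bar> \<le> B"
proof -
  have "\<forall>i. \<exists>B. B \<ge> 0 \<and> (\<forall>t. \<bar>bump1 d (\<nu> i) t\<bar> \<le> B)"
    using bump1_bounded by blast
  then obtain B where B: "\<And>i. B i \<ge> 0" "\<And>i t. \<bar>bump1 d (\<nu> i) t\<bar> \<le> B i"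
    by metis
  then have "\<bar>bump d \<nu> x\<bar> \<le> (\<Prod>i\<in>UNIV. B i)" for x
    unfolding bump_def abs_prod by (intro prod_mono) (auto simp: B)
  moreover have "(\<Prod>i\<in>UNIV. B i) \<ge> 0" by (simp add: B prod_nonneg)
  ultimately show ?thesis by blast
qed

lemma continuous_bump: "continuous_on A (bump d \<nu>)"
  by (rule has_derivative_continuous_on[OF has_derivative_at_withinI[OF bump_has_derivative]])

lemma bump_measurable [measurable]: "bump d \<nu> \<in> borel_measurable borel"
  by (rule borel_measurable_continuous_onI[OF continuous_bump])

lemma bump_0_nonneg: "bump d (\<lambda>_. 0) x \<ge> 0"
  unfolding bump_def by (intro prod_nonneg) (auto simp: bump1_0 flat_exp_def)

lemma bump_0_pos: "d > 0 \<Longrightarrow> bump d (\<lambda>_. 0) 0 > 0"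
  unfolding bump_def by (intro prod_pos) (auto simp: bump1_0 flat_exp_def)

lemma bump_0_even: "bump d (\<lambda>_. 0) (- x) = bump d (\<lambda>_. 0) x"
  unfolding bump_def by (intro prod.cong) (auto simp: bump1_0)

section \<open>Directional derivatives and Taylor estimates of the bump\<close>

primrec dir_bump :: "real \<Rightarrow> nat \<Rightarrow> ('n::finite \<Rightarrow> nat) \<Rightarrow> real^'n \<Rightarrow> real^'n \<Rightarrow> real" where
  "dir_bump d 0 \<nu> s y = bump d \<nu> y"
| "dir_bump d (Suc k) \<nu> s y = (\<Sum>i\<in>UNIV. s $ i * dir_bump d k (\<nu>(i := Suc (\<nu> i))) s y)"

lemma dir_bump_DERIV:
  "((\<lambda>t. dir_bump d k \<nu> s (y + t *\<^sub>R s)) has_real_derivative dir_bump d (Suc k) \<nu> s (y + t *\<^sub>R s)) (at t)"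
proof (induction k arbitrary: \<nu>)
  case 0
  have "((\<lambda>t. bump d \<nu> (y + t *\<^sub>R s)) has_derivative
     (\<lambda>h. \<Sum>i\<in>UNIV. (h *\<^sub>R s) $ i * bump d (\<nu>(i := Suc (\<nu> i))) (y + t *\<^sub>R s))) (at t)"
    by (rule has_derivative_compose[OF _ bump_has_derivative]) (auto intro!: derivative_eq_intros)
  moreover have "(\<lambda>h. \<Sum>i\<in>UNIV. (h *\<^sub>R s) $ i * bump d (\<nu>(i := Suc (\<nu> i))) (y + t *\<^sub>R s))
      = (*) (dir_bump d (Suc 0) \<nu> s (y + t *\<^sub>R s))"
    by (rule ext) (simp add: sum_distrib_left sum_distrib_right mult_ac)
  ultimately show ?case
    unfolding has_field_derivative_def by simp
next
  case (Suc k)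
  show ?case
    unfolding dir_bump.simps(2)[of d k] dir_bump.simps(2)[of d "Suc k"]
    by (intro DERIV_sum DERIV_cmult Suc.IH[unfolded dir_bump.simps(2)])
qed

text \<open>\<open>dir_bump d k \<nu> s y\<close> is the k-th derivative of the bump along the line
  y + t s. It is a homogeneous polynomial of degree k in s with bounded coefficients, so the bound
  is uniform in y.\<close>

lemma dir_bump_bounded: "\<exists>C\<ge>0. \<forall>s y. \<bar>dir_bump d k \<nu> s y\<bar> \<le> C * norm s ^ k"
proof (induction k arbitrary: \<nu>)
  case 0
  then show ?case using bump_bounded[of d \<nu>] by simp
next
  case (Suc k)
  then have "\<forall>i. \<exists>C. C \<ge> 0 \<and> (\<forall>s y. \<bar>dir_bump d k (\<nu>(i := Suc (\<nu> i))) s y\<bar> \<le> C * norm s ^ k)"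
    by blast
  then obtain C where C: "\<And>i. C i \<ge> 0"
    "\<And>i s y. \<bar>dir_bump d k (\<nu>(i := Suc (\<nu> i))) s y\<bar> \<le> C i * norm s ^ k"
    by metis
  have "\<bar>dir_bump d (Suc k) \<nu> s y\<bar> \<le> (\<Sum>i\<in>UNIV. C i) * norm s ^ Suc k" for s y
  proof -
    have "\<bar>dir_bump d (Suc k) \<nu> s y\<bar> \<le> (\<Sum>i\<in>UNIV. \<bar>s $ i\<bar> * \<bar>dir_bump d k (\<nu>(i := Suc (\<nu> i))) s y\<bar>)"
      by (simp add: abs_mult[symmetric])
    also have "\<dots> \<le> (\<Sum>i\<in>UNIV. norm s * (C i * norm s ^ k))"
      by (intro sum_mono mult_mono C component_le_norm_cart) auto
    also have "\<dots> = (\<Sum>i\<in>UNIV. C i) * norm s ^ Suc k"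
      by (simp add: sum_distrib_left sum_distrib_right mult_ac)
    finally show ?thesis .
  qed
  moreover have "(\<Sum>i\<in>UNIV. C i) \<ge> 0" by (simp add: C sum_nonneg)
  ultimately show ?case by blast
qed

text \<open>Taylor expansion at h and at -h: the first-order terms cancel and only the two
  third-order remainders survive. Uniformity in y and s is essential, since later s is a column of
  \<Sigma>(x) and y ranges over all translates x - z.\<close>

lemma bump_second_difference:
  "\<exists>C\<ge>0. \<forall>s y h. \<bar>bump d \<nu> (y + h *\<^sub>R s) + bump d \<nu> (y - h *\<^sub>R s) - 2 * bump d \<nu> y
      - h\<^sup>2 * dir_bump d 2 \<nu> s y\<bar> \<le> C * (\<bar>h\<bar> * norm s) ^ 3"
proof -
  obtain C where C: "C \<ge> 0" "\<And>s y. \<bar>dir_bump d 3 \<nu> s y\<bar> \<le> C * norm s ^ 3"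
    using dir_bump_bounded by blast
  have "\<bar>bump d \<nu> (y + h *\<^sub>R s) + bump d \<nu> (y - h *\<^sub>R s) - 2 * bump d \<nu> y
      - h\<^sup>2 * dir_bump d 2 \<nu> s y\<bar> \<le> C * (\<bar>h\<bar> * norm s) ^ 3" for s y h
  proof -
    define U where "U k t = dir_bump d k \<nu> s (y + t *\<^sub>R s)" for k t
    have T: "\<exists>t. \<bar>t\<bar> \<le> \<bar>x\<bar> \<and> U 0 x = (\<Sum>m<3. (U m 0 / fact m) * x ^ m) + (U 3 t / fact 3) * x ^ 3" for x
      by (rule Maclaurin_all_le) (auto simp: U_def dir_bump_DERIV simp del: dir_bump.simps)
    obtain t1 where t1: "U 0 h = (\<Sum>m<3. (U m 0 / fact m) * h ^ m) + (U 3 t1 / fact 3) * h ^ 3"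
      using T by blast
    obtain t2 where t2: "U 0 (- h) = (\<Sum>m<3. (U m 0 / fact m) * (- h) ^ m) + (U 3 t2 / fact 3) * (- h) ^ 3"
      using T by blast
    have e: "U 0 h + U 0 (- h) - 2 * U 0 0 - h\<^sup>2 * U 2 0 = (U 3 t1 - U 3 t2) / 6 * h ^ 3"
      using t1 t2 by (simp add: eval_nat_numeral field_simps)
    have "\<bar>(U 3 t1 - U 3 t2) / 6\<bar> \<le> C * norm s ^ 3"
      using C(2)[of s "y + t1 *\<^sub>R s"] C(2)[of s "y + t2 *\<^sub>R s"] mult_nonneg_nonneg[OF C(1), of "norm s ^ 3"]
      unfolding U_def by (auto simp: abs_le_iff)
    then have "\<bar>U 0 h + U 0 (- h) - 2 * U 0 0 - h\<^sup>2 * U 2 0\<bar> \<le> C * norm s ^ 3 * \<bar>h\<bar> ^ 3"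
      unfolding e abs_mult power_abs by (rule mult_right_mono) simp
    then show ?thesis by (simp add: U_def power_mult_distrib mult_ac)
  qed
  then show ?thesis using C(1) by blast
qed

lemma bump_first_difference:
  "\<exists>C\<ge>0. \<forall>s y h. \<bar>bump d \<nu> (y + h *\<^sub>R s) - bump d \<nu> y - h * dir_bump d 1 \<nu> s y\<bar> \<le> C * (\<bar>h\<bar> * norm s) ^ 2"
proof -
  obtain C where C: "C \<ge> 0" "\<And>s y. \<bar>dir_bump d 2 \<nu> s y\<bar> \<le> C * norm s ^ 2"
    using dir_bump_bounded by blast
  have "\<bar>bump d \<nu> (y + h *\<^sub>R s) - bump d \<nu> y - h * dir_bump d 1 \<nu> s y\<bar> \<le> C * (\<bar>h\<bar> * norm s) ^ 2" for s y h
  proof -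
    define U where "U k t = dir_bump d k \<nu> s (y + t *\<^sub>R s)" for k t
    have T: "\<exists>t. \<bar>t\<bar> \<le> \<bar>h\<bar> \<and> U 0 h = (\<Sum>m<2. (U m 0 / fact m) * h ^ m) + (U 2 t / fact 2) * h ^ 2"
      by (rule Maclaurin_all_le) (auto simp: U_def dir_bump_DERIV simp del: dir_bump.simps)
    then obtain t where t: "U 0 h = (\<Sum>m<2. (U m 0 / fact m) * h ^ m) + (U 2 t / fact 2) * h ^ 2"
      by blast
    have e: "U 0 h - U 0 0 - h * U 1 0 = U 2 t / 2 * h ^ 2"
      using t by (simp add: eval_nat_numeral field_simps)
    have "\<bar>U 2 t / 2\<bar> \<le> C * norm s ^ 2"
      using C(2)[of s "y + t *\<^sub>R s"] mult_nonneg_nonneg[OF C(1), of "norm s ^ 2"]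
      unfolding U_def by (auto simp: abs_le_iff)
    then have "\<bar>U 0 h - U 0 0 - h * U 1 0\<bar> \<le> C * norm s ^ 2 * \<bar>h\<bar> ^ 2"
      unfolding e abs_mult power_abs by (rule mult_right_mono) simp
    then show ?thesis by (simp add: U_def power_mult_distrib mult_ac)
  qed
  then show ?thesis using C(1) by blast
qed

section \<open>Finite differences of logarithmic costs\<close>

definition log_quad :: "real \<Rightarrow> 'a::real_inner \<Rightarrow> real" where
  "log_quad e z = ln ((norm z)\<^sup>2 + e)"

text \<open>The operator with constant diffusion columns \<open>w k\<close> and drift
  \<open>\<beta>\<close>, applied to \<open>log_quad e\<close> at z: with G = |z|^2 + e the gradient
  is 2 z / G and the Hessian is 2 I / G - 4 z z^t / G^2.\<close>

definition gen_log :: "real \<Rightarrow> ('m::finite \<Rightarrow> 'a::real_inner) \<Rightarrow> 'a \<Rightarrow> 'a \<Rightarrow> real" where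
  "gen_log e w \<beta> z = (2 * (\<Sum>k\<in>UNIV. (norm (w k))\<^sup>2) + 2 * (z \<bullet> \<beta>)) / ((norm z)\<^sup>2 + e)
     - 4 * (\<Sum>k\<in>UNIV. (w k \<bullet> z)\<^sup>2) / ((norm z)\<^sup>2 + e)\<^sup>2"

text \<open>One step of the discretized diffusion, kept as a sum rather than a mean over its 2 m + 1
  increments. For smooth F, subtracting (2 m + 1) F(0) leaves h^2 times the generator at 0, up to
  higher order.\<close>

definition moves :: "real \<Rightarrow> ('m::finite \<Rightarrow> 'a::real_vector) \<Rightarrow> 'a \<Rightarrow> ('a \<Rightarrow> real) \<Rightarrow> real" where
  "moves h w \<beta> F = (\<Sum>k\<in>UNIV. F (h *\<^sub>R w k) + F (- (h *\<^sub>R w k))) + F (h\<^sup>2 *\<^sub>R \<beta>)"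

text \<open>The logarithms are combined before ln t \<le> t - 1 is used, since (G + a + c)(G - a +
  c) = (G + c)^2 - a^2. Estimating them separately would lose the term -a^2 / G^2, which becomes the
  stabilizing contribution of r.\<close>

lemma ln_symmetric_increment_le:
  fixes G a c :: real
  assumes "G > 0" "G + a + c > 0" "G - a + c > 0"
  shows "ln (G + a + c) + ln (G - a + c) - 2 * ln G \<le> 2 * c / G + c\<^sup>2 / G\<^sup>2 - a\<^sup>2 / G\<^sup>2"
proof -
  have p: "(G + a + c) * (G - a + c) > 0" using assms by (intro mult_pos_pos)
  have "ln (G + a + c) + ln (G - a + c) - 2 * ln G = ln ((G + a + c) * (G - a + c) / G\<^sup>2)"
    using assms p by (simp add: ln_div ln_mult power2_eq_square)
  also have "\<dots> \<le> (G + a + c) * (G - a + c) / G\<^sup>2 - 1"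
    using assms(1) p by (intro ln_le_minus_one divide_pos_pos) auto
  also have "\<dots> = 2 * c / G + c\<^sup>2 / G\<^sup>2 - a\<^sup>2 / G\<^sup>2"
    using assms(1) by (simp add: field_simps power2_eq_square)
  finally show ?thesis .
qed

text \<open>The previous estimate is used with a = 2 h (w_k . z) and c = h^2 |w_k|^2. Only an upper
  bound is needed, so ln t \<le> t - 1 replaces Taylor expansion: the bound holds for every h and z,
  and its error is of order h^4 without a third-order term.\<close>

lemma log_quad_moves_le:
  fixes w :: "'m::finite \<Rightarrow> 'a::real_inner"
  assumes e: "e > 0"
  shows "moves h w \<beta> (\<lambda>d. log_quad e (z + d)) - (2 * CARD('m) + 1) * log_quad e z
    \<le> h\<^sup>2 * gen_log e w \<beta> z + h ^ 4 * ((\<Sum>k\<in>UNIV. (norm (w k)) ^ 4) / e\<^sup>2 + (norm \<beta>)\<^sup>2 / e)"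
proof -
  define G where "G = (norm z)\<^sup>2 + e"
  have Ge: "G \<ge> e" "G > 0" using e by (auto simp: G_def add_nonneg_pos)
  have nrm: "(norm (z + d))\<^sup>2 + e = G + 2 * (d \<bullet> z) + (norm d)\<^sup>2" for d
    by (simp add: G_def power2_norm_eq_inner algebra_simps inner_commute)
  have pos: "(norm y)\<^sup>2 + e > 0" for y :: 'a using e by (simp add: add_nonneg_pos)
  have G2: "G\<^sup>2 \<ge> e\<^sup>2" using Ge e by (simp add: power_mono)
  have "log_quad e (z + h *\<^sub>R w k) + log_quad e (z + - (h *\<^sub>R w k)) - 2 * log_quad e z
     \<le> h\<^sup>2 * (2 * (norm (w k))\<^sup>2 / G - 4 * (w k \<bullet> z)\<^sup>2 / G\<^sup>2) + h ^ 4 * (norm (w k) ^ 4 / e\<^sup>2)" for k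
  proof -
    have p1: "0 < G + 2 * h * (w k \<bullet> z) + h\<^sup>2 * (norm (w k))\<^sup>2"
      using pos[of "z + h *\<^sub>R w k"] unfolding nrm by (simp add: power_mult_distrib mult_ac)
    have p2: "0 < G - 2 * h * (w k \<bullet> z) + h\<^sup>2 * (norm (w k))\<^sup>2"
      using pos[of "z + - (h *\<^sub>R w k)"] unfolding nrm by (simp add: power_mult_distrib mult_ac)
    have "log_quad e (z + h *\<^sub>R w k) + log_quad e (z + - (h *\<^sub>R w k)) - 2 * log_quad e z
      = ln (G + 2 * h * (w k \<bullet> z) + h\<^sup>2 * (norm (w k))\<^sup>2) + ln (G - 2 * h * (w k \<bullet> z) + h\<^sup>2 * (norm (w k))\<^sup>2) - 2 * ln G"
      unfolding log_quad_def nrm by (simp add: G_def power_mult_distrib mult_ac)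
    also have "\<dots> \<le> 2 * (h\<^sup>2 * (norm (w k))\<^sup>2) / G + (h\<^sup>2 * (norm (w k))\<^sup>2)\<^sup>2 / G\<^sup>2 - (2 * h * (w k \<bullet> z))\<^sup>2 / G\<^sup>2"
      by (rule ln_symmetric_increment_le[OF Ge(2) p1 p2])
    also have "\<dots> = h\<^sup>2 * (2 * (norm (w k))\<^sup>2 / G - 4 * (w k \<bullet> z)\<^sup>2 / G\<^sup>2) + h ^ 4 * (norm (w k) ^ 4 / G\<^sup>2)"
      using Ge by (simp add: field_simps)
    also have "\<dots> \<le> h\<^sup>2 * (2 * (norm (w k))\<^sup>2 / G - 4 * (w k \<bullet> z)\<^sup>2 / G\<^sup>2) + h ^ 4 * (norm (w k) ^ 4 / e\<^sup>2)"
      using G2 Ge e by (intro add_left_mono mult_left_mono divide_left_mono) auto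
    finally show ?thesis .
  qed
  then have A: "(\<Sum>k\<in>UNIV. log_quad e (z + h *\<^sub>R w k) + log_quad e (z + - (h *\<^sub>R w k)) - 2 * log_quad e z)
     \<le> (\<Sum>k\<in>UNIV. h\<^sup>2 * (2 * (norm (w k))\<^sup>2 / G - 4 * (w k \<bullet> z)\<^sup>2 / G\<^sup>2) + h ^ 4 * (norm (w k) ^ 4 / e\<^sup>2))"
    by (rule sum_mono)
  have "log_quad e (z + h\<^sup>2 *\<^sub>R \<beta>) - log_quad e z = ln ((G + 2 * h\<^sup>2 * (\<beta> \<bullet> z) + h ^ 4 * (norm \<beta>)\<^sup>2) / G)"
    using pos[of "z + h\<^sup>2 *\<^sub>R \<beta>"] Ge unfolding log_quad_def nrm
    by (subst ln_div) (auto simp: G_def power_mult_distrib mult_ac)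
  also have "\<dots> \<le> (G + 2 * h\<^sup>2 * (\<beta> \<bullet> z) + h ^ 4 * (norm \<beta>)\<^sup>2) / G - 1"
    using pos[of "z + h\<^sup>2 *\<^sub>R \<beta>"] Ge unfolding nrm
    by (intro ln_le_minus_one divide_pos_pos) (auto simp: power_mult_distrib mult_ac)
  also have "\<dots> = h\<^sup>2 * (2 * (z \<bullet> \<beta>) / G) + h ^ 4 * ((norm \<beta>)\<^sup>2 / G)"
    using Ge by (simp add: field_simps inner_commute)
  also have "\<dots> \<le> h\<^sup>2 * (2 * (z \<bullet> \<beta>) / G) + h ^ 4 * ((norm \<beta>)\<^sup>2 / e)"
    using Ge e by (intro add_left_mono mult_left_mono divide_left_mono) auto
  finally have B: "log_quad e (z + h\<^sup>2 *\<^sub>R \<beta>) - log_quad e z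
      \<le> h\<^sup>2 * (2 * (z \<bullet> \<beta>) / G) + h ^ 4 * ((norm \<beta>)\<^sup>2 / e)" .
  have "moves h w \<beta> (\<lambda>d. log_quad e (z + d)) - (2 * CARD('m) + 1) * log_quad e z
     = (\<Sum>k\<in>UNIV. log_quad e (z + h *\<^sub>R w k) + log_quad e (z + - (h *\<^sub>R w k)) - 2 * log_quad e z)
       + (log_quad e (z + h\<^sup>2 *\<^sub>R \<beta>) - log_quad e z)"
    by (simp add: moves_def sum_subtractf algebra_simps)
  also have "\<dots> \<le> (\<Sum>k\<in>UNIV. h\<^sup>2 * (2 * (norm (w k))\<^sup>2 / G - 4 * (w k \<bullet> z)\<^sup>2 / G\<^sup>2) + h ^ 4 * (norm (w k) ^ 4 / e\<^sup>2))
     + (h\<^sup>2 * (2 * (z \<bullet> \<beta>) / G) + h ^ 4 * ((norm \<beta>)\<^sup>2 / e))"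
    by (rule add_mono[OF A B])
  also have "\<dots> = h\<^sup>2 * gen_log e w \<beta> z + h ^ 4 * ((\<Sum>k\<in>UNIV. (norm (w k)) ^ 4) / e\<^sup>2 + (norm \<beta>)\<^sup>2 / e)"
    unfolding gen_log_def G_def[symmetric]
    by (simp add: sum.distrib sum_subtractf sum_distrib_left[symmetric] sum_divide_distrib[symmetric]
        add_divide_distrib right_diff_distrib distrib_left)
  finally show ?thesis .
qed

lemma norm_div_quad_le: "e > 0 \<Longrightarrow> norm z / ((norm z)\<^sup>2 + e) \<le> 1 / e + 1"
proof (cases "norm z \<le> 1")
  case True
  assume "e > 0"
  have "norm z / ((norm z)\<^sup>2 + e) \<le> 1 / e"
    using True \<open>e > 0\<close> by (intro frac_le) auto
  then show ?thesis by simp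
next
  case False
  assume "e > 0"
  have "norm z \<le> (norm z)\<^sup>2 + e" using False \<open>e > 0\<close> self_le_power[of "norm z" 2] by simp
  then have "norm z / ((norm z)\<^sup>2 + e) \<le> 1" using \<open>e > 0\<close> by (simp add: divide_le_eq_1 add_nonneg_pos)
  moreover have "0 < 1/e" using \<open>e > 0\<close> by simp
  ultimately show ?thesis by linarith
qed

lemma gen_log_le:
  assumes e: "e > 0"
  shows "gen_log e w \<beta> z \<le> 2 * (1 / e + 1) * ((\<Sum>k\<in>UNIV. (norm (w k))\<^sup>2) + norm \<beta>)"
proof -
  define G where "G = (norm z)\<^sup>2 + e"
  have Ge: "G \<ge> e" "G > 0" using e by (auto simp: G_def add_nonneg_pos)
  define W where "W = (\<Sum>k\<in>UNIV. (norm (w k))\<^sup>2)"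
  have W: "W \<ge> 0" by (simp add: W_def sum_nonneg)
  have "gen_log e w \<beta> z \<le> (2 * W + 2 * (z \<bullet> \<beta>)) / G"
    unfolding gen_log_def G_def[symmetric] W_def by (simp add: sum_nonneg)
  also have "\<dots> = 2 * (W / G + (z \<bullet> \<beta>) / G)" by (simp add: add_divide_distrib)
  also have "W / G \<le> W * (1 / e + 1)"
  proof -
    have "W / G \<le> W / e" using Ge e W by (intro divide_left_mono) auto
    then show ?thesis using W by (simp add: distrib_left)
  qed
  also have "(z \<bullet> \<beta>) / G \<le> norm \<beta> * (1 / e + 1)"
  proof -
    have "(z \<bullet> \<beta>) / G \<le> norm z * norm \<beta> / G"
      using Ge norm_cauchy_schwarz[of z \<beta>] by (simp add: divide_right_mono)
    also have "\<dots> = norm \<beta> * (norm z / G)" by simp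
    also have "\<dots> \<le> norm \<beta> * (1 / e + 1)"
      using norm_div_quad_le[OF e, of z] unfolding G_def by (intro mult_left_mono) auto
    finally show ?thesis .
  qed
  finally show ?thesis by (simp add: W_def algebra_simps)
qed

section \<open>Lipschitz dependence of the generator on the point, with the coefficients held
  fixed\<close>

lemma inverse_quad_diff_le:
  fixes z z' :: "'a::real_normed_vector"
  assumes e: "e > 0"
  defines "C \<equiv> 2 * (1 / e + 1) * (1 / e)"
  shows "\<bar>1 / ((norm z)\<^sup>2 + e) - 1 / ((norm z')\<^sup>2 + e)\<bar> \<le> C * norm (z - z')"
proof -
  define a b G H where d: "a = norm z" "b = norm z'" "G = (norm z)\<^sup>2 + e" "H = (norm z')\<^sup>2 + e"
  have p: "G > 0" "H > 0" "G \<ge> e" "H \<ge> e" using e by (auto simp: d add_nonneg_pos)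
  have "1 / G - 1 / H = (b - a) * (a / G * (1 / H) + b / H * (1 / G))"
    using p by (simp add: field_simps) (simp add: d algebra_simps power2_eq_square)
  moreover have "a / G * (1 / H) + b / H * (1 / G) \<le> (1 / e + 1) * (1 / e) + (1 / e + 1) * (1 / e)"
    using p e norm_div_quad_le[OF e, of z] norm_div_quad_le[OF e, of z'] unfolding d(1,2)[symmetric] d(3,4)[symmetric]
    by (intro add_mono mult_mono divide_left_mono) (auto simp: d)
  moreover have "a / G * (1 / H) + b / H * (1 / G) \<ge> 0" using p by (auto simp: d)
  moreover have "\<bar>b - a\<bar> \<le> norm (z - z')"
    unfolding d by (metis abs_minus_commute norm_triangle_ineq3)
  ultimately have "\<bar>1 / G - 1 / H\<bar> \<le> norm (z - z') * ((1 / e + 1) * (1 / e) + (1 / e + 1) * (1 / e))"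
    by (simp only: abs_mult abs_of_nonneg) (rule mult_mono, auto)
  then show ?thesis unfolding d(3,4) C_def by (simp add: algebra_simps)
qed

text \<open>z / (|z|^2 + e) is half the gradient of \<open>log_quad e\<close>. The difference splits
  into (z - z') / G and (1/G - 1/H) z'. In the second part 1/G - 1/H contains the factor |z'| - |z|,
  and the remaining factor (|z| + |z'|) |z'| / (G H) is bounded.\<close>

lemma scaled_quad_diff_le:
  fixes z z' :: "'a::real_normed_vector"
  assumes e: "e > 0"
  shows "\<exists>C\<ge>0. \<forall>z z' :: 'a. norm ((1 / ((norm z)\<^sup>2 + e)) *\<^sub>R z - (1 / ((norm z')\<^sup>2 + e)) *\<^sub>R z') \<le> C * norm (z - z')"
proof -
  have "norm ((1 / ((norm z)\<^sup>2 + e)) *\<^sub>R z - (1 / ((norm z')\<^sup>2 + e)) *\<^sub>R z')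
      \<le> (1 / e + 2 / e) * norm (z - z')" for z z' :: 'a
  proof -
    define a b G H where d: "a = norm z" "b = norm z'" "G = (norm z)\<^sup>2 + e" "H = (norm z')\<^sup>2 + e"
    have p: "G > 0" "H > 0" "G \<ge> e" "H \<ge> e" using e by (auto simp: d add_nonneg_pos)
    have "(1 / G - 1 / H) * b = (b - a) * ((a * b / H) * (1 / G) + (b * b / H) * (1 / G))"
      using p by (simp add: field_simps) (simp add: d algebra_simps power2_eq_square)
    moreover have q2: "b * b / H \<le> 1" using p e by (simp add: d power2_eq_square)
    have "(a * b / H) * (1 / G) \<le> 1 / e"
    proof -
      have "a * b * e \<le> G * H"
      proof -
        have "0 \<le> (a - b)\<^sup>2" by simp
        then have "2 * (a * b) \<le> a\<^sup>2 + b\<^sup>2" by (simp add: power2_eq_square algebra_simps)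
        then have "a * b * e \<le> (a\<^sup>2 + b\<^sup>2) * e"
          using e sum_power2_ge_zero[of a b] by (intro mult_right_mono) linarith+
        also have "\<dots> \<le> G * H" using e unfolding d by (simp add: algebra_simps)
        finally show ?thesis .
      qed
      then show ?thesis using p e by (simp add: field_simps)
    qed
    moreover have "(b * b / H) * (1 / G) \<le> 1 * (1 / e)"
      using q2 p e by (intro mult_mono divide_left_mono) (auto simp: d)
    moreover have "(a * b / H) * (1 / G) \<ge> 0" "(b * b / H) * (1 / G) \<ge> 0" using p by (auto simp: d)
    moreover have "\<bar>b - a\<bar> \<le> norm (z - z')"
      unfolding d by (metis abs_minus_commute norm_triangle_ineq3)
    ultimately have "\<bar>(1 / G - 1 / H) * b\<bar> \<le> norm (z - z') * (1 / e + 1 * (1 / e))"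
      by (simp only: abs_mult[of "b - a"] abs_of_nonneg[OF add_nonneg_nonneg]) (rule mult_mono, auto)
    then have f: "norm ((1 / G - 1 / H) *\<^sub>R z') \<le> norm (z - z') * (2 / e)"
      by (simp add: d(2) abs_mult)
    have "(1 / G) *\<^sub>R z - (1 / H) *\<^sub>R z' = (1 / G) *\<^sub>R (z - z') + (1 / G - 1 / H) *\<^sub>R z'"
      by (simp add: algebra_simps)
    then have "norm ((1 / G) *\<^sub>R z - (1 / H) *\<^sub>R z') \<le> norm ((1 / G) *\<^sub>R (z - z')) + norm ((1 / G - 1 / H) *\<^sub>R z')"
      by (metis norm_triangle_ineq)
    also have "norm ((1 / G) *\<^sub>R (z - z')) \<le> (1 / e) * norm (z - z')"
      using p e by (auto intro!: mult_right_mono divide_left_mono)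
    also note f
    finally have "norm ((1 / G) *\<^sub>R z - (1 / H) *\<^sub>R z') \<le> (1 / e) * norm (z - z') + norm (z - z') * (2 / e)" by simp
    also have "\<dots> \<le> (1 / e + 2 / e) * norm (z - z')"
      using e by (simp add: algebra_simps)
    finally show ?thesis unfolding d .
  qed
  moreover have "1 / e + 2 / e \<ge> 0" using e by simp
  ultimately show ?thesis by blast
qed

text \<open>\<open>gen_log\<close> depends on z only through 1 / (|z|^2 + e) and F(z) = z / (|z|^2 +
  e), both bounded and Lipschitz. The estimate is needed because the coefficients are taken at the
  stationary points while the positions are displaced by the mollifier.\<close>

lemma gen_log_diff_le:
  assumes e: "e > 0"
  shows "\<exists>C\<ge>0. \<forall>(w :: 'm::finite \<Rightarrow> 'a::real_inner) \<beta> z z'.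
    \<bar>gen_log e w \<beta> z - gen_log e w \<beta> z'\<bar> \<le> C * norm (z - z') * ((\<Sum>k\<in>UNIV. (norm (w k))\<^sup>2) + norm \<beta>)"
proof -
  define D where "D = 2 * (1 / e + 1) * (1 / e)"
  have D: "D \<ge> 0" using e by (simp add: D_def)
  obtain C where C: "C \<ge> 0"
    "\<And>z z' :: 'a. norm ((1 / ((norm z)\<^sup>2 + e)) *\<^sub>R z - (1 / ((norm z')\<^sup>2 + e)) *\<^sub>R z') \<le> C * norm (z - z')"
    using scaled_quad_diff_le[OF e, where 'a = 'a] by blast
  define F where "F z = (1 / ((norm z)\<^sup>2 + e)) *\<^sub>R z" for z :: 'a
  have Fb: "norm (F z) \<le> 1 / e + 1" for z
    using norm_div_quad_le[OF e, of z] e by (simp add: F_def add_nonneg_pos)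
  define B where "B = 1 / e + 1"
  have B: "B \<ge> 0" using e by (simp add: B_def)
  have "\<bar>gen_log e w \<beta> z - gen_log e w \<beta> z'\<bar>
      \<le> (2 * D + 2 * C + 8 * B * C) * norm (z - z') * ((\<Sum>k\<in>UNIV. (norm (w k))\<^sup>2) + norm \<beta>)"
    for w :: "'m \<Rightarrow> 'a" and \<beta> z z'
  proof -
    define W where "W = (\<Sum>k\<in>UNIV. (norm (w k))\<^sup>2)"
    have W: "W \<ge> 0" by (simp add: W_def sum_nonneg)
    define n where "n = norm (z - z')"
    have n: "n \<ge> 0" by (simp add: n_def)
    have rep: "gen_log e w \<beta> y = 2 * W * (1 / ((norm y)\<^sup>2 + e)) + 2 * (F y \<bullet> \<beta>) - 4 * (\<Sum>k\<in>UNIV. (w k \<bullet> F y)\<^sup>2)" for y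
    proof -
      have "(\<Sum>k\<in>UNIV. (w k \<bullet> F y)\<^sup>2) = (\<Sum>k\<in>UNIV. (w k \<bullet> y)\<^sup>2) / ((norm y)\<^sup>2 + e)\<^sup>2"
        by (simp add: F_def power_divide sum_divide_distrib)
      then show ?thesis by (simp add: gen_log_def W_def F_def add_divide_distrib)
    qed
    have 1: "\<bar>2 * W * (1 / ((norm z)\<^sup>2 + e)) - 2 * W * (1 / ((norm z')\<^sup>2 + e))\<bar> \<le> 2 * W * (D * n)"
    proof -
      have "2 * W * \<bar>1 / ((norm z)\<^sup>2 + e) - 1 / ((norm z')\<^sup>2 + e)\<bar> \<le> 2 * W * (D * n)"
        unfolding D_def n_def using inverse_quad_diff_le[OF e, of z z'] W by (intro mult_left_mono) auto
      then show ?thesis using W unfolding right_diff_distrib[symmetric] abs_mult by simp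
    qed
    have FF: "norm (F z - F z') \<le> C * n" using C(2)[of z z'] by (simp add: F_def n_def)
    have 2: "\<bar>F z \<bullet> \<beta> - F z' \<bullet> \<beta>\<bar> \<le> C * n * norm \<beta>"
    proof -
      have "\<bar>(F z - F z') \<bullet> \<beta>\<bar> \<le> norm (F z - F z') * norm \<beta>" by (rule Cauchy_Schwarz_ineq2)
      also have "\<dots> \<le> C * n * norm \<beta>" using FF by (intro mult_right_mono) auto
      finally show ?thesis by (simp add: inner_diff_left)
    qed
    have "\<bar>(w k \<bullet> F z)\<^sup>2 - (w k \<bullet> F z')\<^sup>2\<bar> \<le> (norm (w k))\<^sup>2 * (2 * B * (C * n))" for k
    proof -
      have "\<bar>(w k \<bullet> F z)\<^sup>2 - (w k \<bullet> F z')\<^sup>2\<bar> = \<bar>w k \<bullet> (F z + F z')\<bar> * \<bar>w k \<bullet> (F z - F z')\<bar>"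
        by (simp add: abs_mult[symmetric] inner_add_right inner_diff_right power2_eq_square algebra_simps)
      also have "\<dots> \<le> (norm (w k) * norm (F z + F z')) * (norm (w k) * norm (F z - F z'))"
        by (intro mult_mono Cauchy_Schwarz_ineq2) auto
      also have "\<dots> \<le> (norm (w k) * (2 * B)) * (norm (w k) * (C * n))"
        using Fb[of z] Fb[of z'] norm_triangle_ineq[of "F z" "F z'"] FF B
        by (intro mult_mono) (auto simp: B_def)
      finally show ?thesis by (simp add: power2_eq_square mult_ac)
    qed
    then have "\<bar>\<Sum>k\<in>UNIV. (w k \<bullet> F z)\<^sup>2 - (w k \<bullet> F z')\<^sup>2\<bar> \<le> (\<Sum>k\<in>UNIV. (norm (w k))\<^sup>2 * (2 * B * (C * n)))"
      by (intro order_trans[OF sum_abs] sum_mono)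
    then have 3: "\<bar>(\<Sum>k\<in>UNIV. (w k \<bullet> F z)\<^sup>2) - (\<Sum>k\<in>UNIV. (w k \<bullet> F z')\<^sup>2)\<bar> \<le> W * (2 * B * (C * n))"
      by (simp add: sum_subtractf sum_distrib_right W_def)
    have "\<bar>gen_log e w \<beta> z - gen_log e w \<beta> z'\<bar> \<le> 2 * W * (D * n) + 2 * (C * n * norm \<beta>) + 4 * (W * (2 * B * (C * n)))"
      unfolding rep using 1 2 3 by linarith
    also have "\<dots> \<le> (2 * D + 2 * C + 8 * B * C) * n * (W + norm \<beta>)"
    proof -
      have "0 \<le> 2 * D * (n * norm \<beta>) + 2 * C * (n * W) + 8 * B * C * (n * norm \<beta>)"
        using C(1) D B W n by auto
      then show ?thesis by (simp add: algebra_simps)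
    qed
    finally show ?thesis by (simp add: W_def n_def)
  qed
  moreover have "2 * D + 2 * C + 8 * B * C \<ge> 0" using C D B by auto
  ultimately show ?thesis by blast
qed

text \<open>The dyadic sum is where averaging the cost over many scales pays off: the error
  \<open>s e / (s + e)\<^sup>2\<close> of one scale is an increment of the telescoping quantity \<open>s / (s + e)\<close>.\<close>

lemma dyadic_error_sum_le:
  fixes s e :: real
  assumes "s \<ge> 0" "e > 0"
  shows "(\<Sum>i<N. s * (e / 2 ^ i) / (s + e / 2 ^ i)\<^sup>2) \<le> 2"
proof -
  define u where "u i = s / (s + e / 2 ^ i)" for i :: nat
  \<comment> \<open>Halving a raises s / (s + a) by s a / (2 (s + a) (s + a/2)), hence the factor 2.
    These quotients stay in [0, 1], so the telescoped sum is at most 2.\<close>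
  have "s * (e / 2 ^ i) / (s + e / 2 ^ i)\<^sup>2 \<le> 2 * (u (Suc i) - u i)" for i
  proof -
    define a where "a = e / 2 ^ i"
    have a: "a > 0" using assms by (simp add: a_def)
    have p: "s + a > 0" "s + a / 2 > 0" using assms a by linarith+
    have "2 * (u (Suc i) - u i) = s * a / ((s + a) * (s + a / 2))"
    proof -
      have "u (Suc i) = s / (s + a / 2)" "u i = s / (s + a)" by (auto simp: u_def a_def)
      moreover have "2 * (s / (s + a / 2) - s / (s + a)) = s * a / ((s + a) * (s + a / 2))"
      proof -
        have "s * (s + a) - s * (s + a / 2) = s * a / 2" by (simp add: algebra_simps)
        then show ?thesis using p by (subst diff_frac_eq) (auto simp: mult.commute)
      qed
      ultimately show ?thesis by simp
    qed
    moreover have "s * a / (s + a)\<^sup>2 \<le> s * a / ((s + a) * (s + a / 2))"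
      using p assms a by (intro divide_left_mono mult_pos_pos) (auto simp: power2_eq_square)
    ultimately show ?thesis by (simp add: a_def)
  qed
  then have "(\<Sum>i<N. s * (e / 2 ^ i) / (s + e / 2 ^ i)\<^sup>2) \<le> (\<Sum>i<N. 2 * (u (Suc i) - u i))"
    by (intro sum_mono)
  also have "\<dots> = 2 * (u N - u 0)"
    by (simp only: sum_distrib_left[symmetric] sum_lessThan_telescope)
  also have "\<dots> \<le> 2"
  proof -
    have "u N \<le> 1" using assms by (simp add: u_def divide_le_eq_1 add_nonneg_pos)
    moreover have "u 0 \<ge> 0" using assms by (simp add: u_def)
    ultimately show ?thesis by simp
  qed
  finally show ?thesis .
qed

text \<open>With G = |z|^2 + e and R the sum of squares in \<open>qr\<close>, the value is 2 Q / G -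
  4 R / G^2. For Q \<le> 0 both terms are nonpositive. For Q > 0, \<open>qr\<close> bounds 2 R below
  by Q |z|^2 and leaves 2 Q e / G^2, where Q is replaced by its bound \<Lambda> |z|^2.\<close>

lemma gen_log_le_scale_error:
  fixes w :: "'m::finite \<Rightarrow> 'a::real_inner"
  assumes Q: "Q = z \<bullet> \<beta> + (\<Sum>k\<in>UNIV. (norm (w k))\<^sup>2)"
    and e: "e > 0" and "\<Lambda> \<ge> 0"
    and ql: "Q \<le> \<Lambda> * (norm z)\<^sup>2"
    and qr: "z \<noteq> 0 \<Longrightarrow> Q * (norm z)\<^sup>2 \<le> 2 * (\<Sum>k\<in>UNIV. (w k \<bullet> z)\<^sup>2)"
  shows "gen_log e w \<beta> z \<le> 2 * \<Lambda> * ((norm z)\<^sup>2 * e / ((norm z)\<^sup>2 + e)\<^sup>2)"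
proof -
  define s where "s = (norm z)\<^sup>2"
  define G where "G = s + e"
  define R where "R = (\<Sum>k\<in>UNIV. (w k \<bullet> z)\<^sup>2)"
  have G: "G > 0" "s \<ge> 0" "R \<ge> 0" using e by (auto simp: G_def s_def R_def add_nonneg_pos sum_nonneg)
  have E: "gen_log e w \<beta> z = 2 * Q / G - 4 * R / G\<^sup>2"
    by (simp add: gen_log_def Q R_def G_def s_def algebra_simps)
  show ?thesis
  proof (cases "Q \<le> 0")
    case True
    then have "gen_log e w \<beta> z \<le> 0" unfolding E using G
      by (simp add: divide_nonpos_pos add_nonneg_nonneg order_trans[of _ 0])
    moreover have "0 \<le> 2 * \<Lambda> * (s * e / (s + e)\<^sup>2)" using assms G by auto
    ultimately show ?thesis by (simp add: s_def)
  next
    case False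
    then have "z \<noteq> 0" using ql assms(4) by auto
    then have "Q * s \<le> 2 * R" using qr by (simp add: R_def s_def)
    then have "gen_log e w \<beta> z \<le> 2 * Q / G - 2 * (Q * s) / G\<^sup>2"
      unfolding E using G by (simp add: divide_right_mono)
    also have "\<dots> = 2 * Q * (e / G\<^sup>2)"
      using G by (simp add: field_simps power2_eq_square) (simp add: G_def algebra_simps)
    also have "\<dots> \<le> 2 * (\<Lambda> * s) * (e / G\<^sup>2)"
      using ql e G by (intro mult_right_mono) (auto simp: s_def)
    finally show ?thesis by (simp add: s_def G_def mult_ac)
  qed
qed

text \<open>Q G - 2 R = (Q |z|^2 - 2 R) + Q e: the bracket is at most -m, and the perturbation Q e
  is at most m/2 for e \<le> e0. The resulting bound does not depend on e, so averaging over smaller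
  scales preserves it.\<close>

lemma gen_log_le_neg:
  fixes w :: "'m::finite \<Rightarrow> 'a::real_inner"
  assumes Q: "Q = z \<bullet> \<beta> + (\<Sum>k\<in>UNIV. (norm (w k))\<^sup>2)"
    and e: "e > 0" "e \<le> e0" "e \<le> 1"
    and s: "d > 0" "d \<le> (norm z)\<^sup>2" "(norm z)\<^sup>2 \<le> S"
    and m: "m > 0" "Q * (norm z)\<^sup>2 - 2 * (\<Sum>k\<in>UNIV. (w k \<bullet> z)\<^sup>2) \<le> - m"
    and r: "Q \<le> r" "r * e0 \<le> m / 2"  "r \<ge> 0"
  shows "gen_log e w \<beta> z \<le> - m / (S + 1)\<^sup>2"
proof -
  define s where "s = (norm z)\<^sup>2"
  define G where "G = s + e"
  define R where "R = (\<Sum>k\<in>UNIV. (w k \<bullet> z)\<^sup>2)"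
  have G: "G > 0" "s \<ge> 0" "G \<le> S + 1" using e s by (auto simp: G_def s_def add_nonneg_pos)
  have "gen_log e w \<beta> z = 2 * Q / G - 4 * R / G\<^sup>2"
    by (simp add: gen_log_def Q R_def G_def s_def algebra_simps)
  also have "\<dots> = 2 * (Q * G - 2 * R) / G\<^sup>2"
    using G by (simp add: field_simps power2_eq_square)
  finally have E: "gen_log e w \<beta> z = 2 * (Q * G - 2 * R) / G\<^sup>2" .
  have "Q * G - 2 * R \<le> - m / 2"
  proof -
    have "Q * e \<le> r * e0" using r e by (auto intro!: order_trans[OF mult_right_mono mult_left_mono])
    then show ?thesis using m r by (simp add: G_def s_def R_def distrib_left)
  qed
  then have "gen_log e w \<beta> z \<le> 2 * (- m / 2) / G\<^sup>2"
    unfolding E using G by (intro divide_right_mono mult_left_mono) auto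
  also have "\<dots> \<le> - m / (S + 1)\<^sup>2"
    using m G by (auto intro!: divide_left_mono power_mono mult_pos_pos)
  finally show ?thesis .
qed

section \<open>Dual potentials\<close>

text \<open>The supremum is lower semicontinuous, so the index set may be uncountable, as it is for
  c-transforms.\<close>

lemma borel_measurable_SUP_continuous:
  fixes F :: "'a \<Rightarrow> 'b::topological_space \<Rightarrow> real"
  assumes ne: "S \<noteq> {}" and cont: "\<And>w. w \<in> S \<Longrightarrow> continuous_on UNIV (F w)"
    and bdd: "\<And>x. bdd_above ((\<lambda>w. F w x) ` S)"
  shows "(\<lambda>x. SUP w\<in>S. F w x) \<in> borel_measurable borel"
proof (rule borel_measurableI_greater)
  fix t :: real
  have "{x. t < (SUP w\<in>S. F w x)} = (\<Union>w\<in>S. {x. t < F w x})"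
    using less_cSUP_iff[OF ne bdd] by auto
  moreover have "open {x. t < F w x}" if "w \<in> S" for w
    using open_Collect_less[OF continuous_on_const cont[OF that]] by simp
  ultimately have "open {x. t < (SUP w\<in>S. F w x)}" by (simp add: open_UN)
  then show "{x \<in> space borel. t < (SUP w\<in>S. F w x)} \<in> sets borel" by simp
qed

text \<open>These are the potentials for the dual of maximizing the integral of \<open>D\<close> over couplings. If the dual cost of every admissible pair could be lowered by a fixed amount, even with competitors
  living on the larger probability spaces, then it would not be bounded below.
  Passing back from the larger spaces to genuine potentials is a \<open>c\<close>-transform.\<close>

definition potential :: "real \<Rightarrow> real \<Rightarrow> ('a::real_normed_vector \<Rightarrow> real) \<Rightarrow> bool" where
  "potential K P u \<longleftrightarrow> u \<in> borel_measurable borel \<and> (\<forall>x. 0 \<le> u x \<and> u x \<le> K) \<and> (\<forall>x. P \<le> norm x \<longrightarrow> u x = 0)"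

lemma potential_integrable:
  assumes "prob_space M" "potential K P u" "f \<in> borel_measurable M"
  shows "integrable M (\<lambda>\<omega>. u (f \<omega>))"
proof -
  interpret prob_space M by fact
  show ?thesis
    by (rule integrable_const_bound[of _ K])
      (use assms in \<open>auto simp: potential_def intro: measurable_compose\<close>)
qed

text \<open>\<open>u\<close> is the c-transform of \<open>v'\<close> with respect to D, and
  \<open>v\<close> is the c-transform of \<open>u\<close>. The competitors may depend on the
  additional randomness of the larger spaces, but the supremum over \<open>G2\<close> depends on the
  point x alone and lies below \<open>u'\<close> on \<open>G1\<close> by the constraint. From D the
  transforms inherit the bounds 0 and K and the vanishing outside the ball of radius P.\<close>

lemma c_transform_improvement:
  fixes D :: "'a::euclidean_space \<Rightarrow> 'a \<Rightarrow> real"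
  assumes M1: "prob_space M1" and M2: "prob_space M2"
    and x1: "x1 \<in> borel_measurable M1" and x2: "x2 \<in> borel_measurable M2"
    and G1: "AE \<omega> in M1. \<omega> \<in> G1" and G2: "AE \<omega> in M2. \<omega> \<in> G2"
    and D1: "\<And>y. continuous_on UNIV (\<lambda>x. D x y)" and D2: "\<And>x. continuous_on UNIV (D x)"
    and D: "\<And>x y. 0 \<le> D x y" "\<And>x y. D x y \<le> K"
    and Dz: "\<And>x y. P \<le> norm x \<or> P \<le> norm y \<Longrightarrow> D x y = 0"
    and iu: "integrable M1 u'" and iv: "integrable M2 v'"
    and lb: "\<And>\<omega>. \<omega> \<in> G2 \<Longrightarrow> - c \<le> v' \<omega>"
    and con: "\<And>\<omega>1 \<omega>2. \<omega>1 \<in> G1 \<Longrightarrow> \<omega>2 \<in> G2 \<Longrightarrow> D (x1 \<omega>1) (x2 \<omega>2) \<le> u' \<omega>1 + v' \<omega>2"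
  obtains u v where "potential K P u" "potential K P v" "\<And>x y. D x y \<le> u x + v y"
    "(\<integral>\<omega>. u (x1 \<omega>) \<partial>M1) + (\<integral>\<omega>. v (x2 \<omega>) \<partial>M2) \<le> integral\<^sup>L M1 u' + integral\<^sup>L M2 v'"
proof -
  interpret M1: prob_space M1 by fact
  interpret M2: prob_space M2 by fact
  have ne: "G2 \<noteq> {}"
  proof
    assume "G2 = {}"
    with G2 show False by simp
  qed
  \<comment> \<open>The value of the supremum below at points where D vanishes. Subtracting it makes
    \<open>u\<close> zero there; it is added back to \<open>v'\<close>, so the sum of the integrals
    is unaffected.\<close>
  define s where "s = (SUP \<omega>\<in>G2. - v' \<omega>)"
  define u where "u x = (SUP \<omega>\<in>G2. D x (x2 \<omega>) - v' \<omega>) - s" for x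
  define v where "v y = (SUP x. D x y - u x)" for y
  have b1: "bdd_above ((\<lambda>\<omega>. D x (x2 \<omega>) - v' \<omega>) ` G2)" for x
  proof (rule bdd_aboveI2[of _ _ "K + c"])
    fix \<omega> assume "\<omega> \<in> G2"
    then show "D x (x2 \<omega>) - v' \<omega> \<le> K + c" using lb[of \<omega>] D(2)[of x "x2 \<omega>"] by linarith
  qed
  have b0: "bdd_above ((\<lambda>\<omega>. - v' \<omega>) ` G2)"
    by (rule bdd_aboveI2[of _ _ c]) (use lb in fastforce)
  have s_le: "s \<le> (SUP \<omega>\<in>G2. D x (x2 \<omega>) - v' \<omega>)" for x
    unfolding s_def by (rule cSUP_mono[OF ne b1]) (use D(1) in force)
  have u_le: "(SUP \<omega>\<in>G2. D x (x2 \<omega>) - v' \<omega>) \<le> K + s" for x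
  proof (rule cSUP_least[OF ne])
    fix \<omega> assume "\<omega> \<in> G2"
    then have "- v' \<omega> \<le> s" unfolding s_def by (rule cSUP_upper[OF _ b0])
    then show "D x (x2 \<omega>) - v' \<omega> \<le> K + s" using D(2)[of x "x2 \<omega>"] by linarith
  qed
  have u_pot: "potential K P u"
    unfolding potential_def
  proof (intro conjI allI impI)
    have "(\<lambda>x. SUP \<omega>\<in>G2. D x (x2 \<omega>) - v' \<omega>) \<in> borel_measurable borel"
      by (rule borel_measurable_SUP_continuous[OF ne _ b1]) (intro continuous_intros D1)
    then show "u \<in> borel_measurable borel" unfolding u_def[abs_def] by simp
    show "0 \<le> u x" for x using s_le[of x] by (simp add: u_def)
    show "u x \<le> K" for x using u_le[of x] by (simp add: u_def)
    show "u x = 0" if "P \<le> norm x" for x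
      using Dz that by (simp add: u_def s_def)
  qed
  have u0: "u x \<ge> 0" for x using u_pot by (simp add: potential_def)
  have b2: "bdd_above ((\<lambda>x. D x y - u x) ` UNIV)" for y
  proof (rule bdd_aboveI2[of _ _ K])
    show "D x y - u x \<le> K" for x using D(2)[of x y] u0[of x] by linarith
  qed
  \<comment> \<open>A far point, where \<open>u\<close> is zero: inserting it into the supremum that
    defines \<open>v\<close> gives \<open>v\<close> \<ge> 0.\<close>
  obtain x0 :: 'a where "norm x0 = max P 0"
    using vector_choose_size[of "max P 0"] by (metis max.cobounded2)
  then have x0: "P \<le> norm x0" by simp
  have ux0: "u x0 = 0" using u_pot x0 by (simp add: potential_def)
  have v_ge: "D x y - u x \<le> v y" for x y
    unfolding v_def by (rule cSUP_upper[OF _ b2]) simp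
  have v_pot: "potential K P v"
    unfolding potential_def
  proof (intro conjI allI impI)
    show "v \<in> borel_measurable borel"
      unfolding v_def[abs_def]
      by (rule borel_measurable_SUP_continuous[OF _ _ b2]) (auto intro!: continuous_intros D2)
    show v0: "0 \<le> v y" for y
      using v_ge[of x0 y] ux0 D(1)[of x0 y] by simp
    show "v y \<le> K" for y
      unfolding v_def
    proof (rule cSUP_least)
      show "D x y - u x \<le> K" for x using D(2)[of x y] u0[of x] by linarith
    qed simp
    show "v y = 0" if "P \<le> norm y" for y
    proof -
      have "v y \<le> 0" unfolding v_def by (rule cSUP_least) (use Dz that u0 in auto)
      then show ?thesis using v0[of y] by simp
    qed
  qed
  have "(\<integral>\<omega>. u (x1 \<omega>) \<partial>M1) \<le> (\<integral>\<omega>. u' \<omega> - s \<partial>M1)"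
  proof (rule integral_mono_AE)
    show "integrable M1 (\<lambda>\<omega>. u (x1 \<omega>))" by (rule potential_integrable[OF M1 u_pot x1])
    show "integrable M1 (\<lambda>\<omega>. u' \<omega> - s)" using iu by simp
    show "AE \<omega> in M1. u (x1 \<omega>) \<le> u' \<omega> - s"
      using G1
    proof eventually_elim
      case (elim \<omega>)
      have "(SUP \<omega>2\<in>G2. D (x1 \<omega>) (x2 \<omega>2) - v' \<omega>2) \<le> u' \<omega>"
        by (rule cSUP_least[OF ne]) (use con[OF elim] in \<open>force simp: diff_le_eq\<close>)
      then show ?case by (simp add: u_def)
    qed
  qed
  moreover have "(\<integral>\<omega>. v (x2 \<omega>) \<partial>M2) \<le> (\<integral>\<omega>. v' \<omega> + s \<partial>M2)"
  proof (rule integral_mono_AE)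
    show "integrable M2 (\<lambda>\<omega>. v (x2 \<omega>))" by (rule potential_integrable[OF M2 v_pot x2])
    show "integrable M2 (\<lambda>\<omega>. v' \<omega> + s)" using iv by simp
    show "AE \<omega> in M2. v (x2 \<omega>) \<le> v' \<omega> + s"
      using G2
    proof eventually_elim
      case (elim \<omega>)
      show ?case unfolding v_def
      proof (rule cSUP_least)
        fix x
        have "D x (x2 \<omega>) - v' \<omega> \<le> (SUP \<omega>\<in>G2. D x (x2 \<omega>) - v' \<omega>)"
          by (rule cSUP_upper[OF elim b1])
        then show "D x (x2 \<omega>) - u x \<le> v' \<omega> + s" by (simp add: u_def)
      qed simp
    qed
  qed
  moreover have "(\<integral>\<omega>. u' \<omega> - s \<partial>M1) = integral\<^sup>L M1 u' - s" "(\<integral>\<omega>. v' \<omega> + s \<partial>M2) = integral\<^sup>L M2 v' + s"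
    using iu iv by (simp_all add: M1.prob_space M2.prob_space)
  moreover have "D x y \<le> u x + v y" for x y using v_ge[of x y] by simp
  ultimately show ?thesis using that[OF u_pot v_pot] by simp
qed

lemma dual_cost_not_uniformly_improvable:
  fixes D :: "'a::euclidean_space \<Rightarrow> 'a \<Rightarrow> real"
  assumes M1: "prob_space M1" and M2: "prob_space M2"
    and x1: "x1 \<in> borel_measurable M1" and x2: "x2 \<in> borel_measurable M2"
    and G1: "AE \<omega> in M1. \<omega> \<in> G1" and G2: "AE \<omega> in M2. \<omega> \<in> G2"
    and D1: "\<And>y. continuous_on UNIV (\<lambda>x. D x y)" and D2: "\<And>x. continuous_on UNIV (D x)"
    and D: "\<And>x y. 0 \<le> D x y" "\<And>x y. D x y \<le> K"
    and Dz: "\<And>x y. P \<le> norm x \<or> P \<le> norm y \<Longrightarrow> D x y = 0"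
    and \<gamma>: "\<gamma> > 0"
    and step: "\<And>u v. potential K P u \<Longrightarrow> potential K P v \<Longrightarrow> (\<And>x y. D x y \<le> u x + v y) \<Longrightarrow>
      \<exists>u' v' c. integrable M1 u' \<and> integrable M2 v' \<and> (\<forall>\<omega>\<in>G2. - c \<le> v' \<omega>)
        \<and> (\<forall>\<omega>1\<in>G1. \<forall>\<omega>2\<in>G2. D (x1 \<omega>1) (x2 \<omega>2) \<le> u' \<omega>1 + v' \<omega>2)
        \<and> integral\<^sup>L M1 u' + integral\<^sup>L M2 v' \<le> (\<integral>\<omega>. u (x1 \<omega>) \<partial>M1) + (\<integral>\<omega>. v (x2 \<omega>) \<partial>M2) - \<gamma>"
  shows False
proof -
  define J where "J u v = (\<integral>\<omega>. u (x1 \<omega>) \<partial>M1) + (\<integral>\<omega>. v (x2 \<omega>) \<partial>M2)" for u v :: "'a \<Rightarrow> real"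
  define ok where "ok u v \<longleftrightarrow> potential K P u \<and> potential K P v \<and> (\<forall>x y. D x y \<le> u x + v y)" for u v
  have J0: "0 \<le> J u v" if "ok u v" for u v
    using that by (auto simp: J_def ok_def potential_def intro!: add_nonneg_nonneg integral_nonneg)
  have "\<exists>u v. ok u v \<and> J u v \<le> J0 - real n * \<gamma>" if "ok u0 v0" "J u0 v0 = J0" for n u0 v0 J0
  proof (induction n)
    case 0
    then show ?case using that by auto
  next
    case (Suc n)
    then obtain u v where uv: "ok u v" "J u v \<le> J0 - real n * \<gamma>" by blast
    obtain u' v' c where s: "integrable M1 u'" "integrable M2 v'" "\<forall>\<omega>\<in>G2. - c \<le> v' \<omega>"
      "\<forall>\<omega>1\<in>G1. \<forall>\<omega>2\<in>G2. D (x1 \<omega>1) (x2 \<omega>2) \<le> u' \<omega>1 + v' \<omega>2"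
      "integral\<^sup>L M1 u' + integral\<^sup>L M2 v' \<le> J u v - \<gamma>"
      using step[of u v] uv(1) unfolding ok_def J_def by blast
    obtain u2 v2 where "potential K P u2" "potential K P v2" "\<And>x y. D x y \<le> u2 x + v2 y"
      "J u2 v2 \<le> integral\<^sup>L M1 u' + integral\<^sup>L M2 v'"
      unfolding J_def
      by (rule c_transform_improvement[OF M1 M2 x1 x2 G1 G2 D1 D2 D Dz s(1,2), where c = c]) (use s(3,4) in auto)
    then have "ok u2 v2" "J u2 v2 \<le> J0 - real (Suc n) * \<gamma>"
      using s(5) uv(2) by (auto simp: ok_def algebra_simps)
    then show ?case by blast
  qed
  moreover have "\<exists>u v. ok u v"
  proof -
    interpret M1: prob_space M1 by fact
    interpret M2: prob_space M2 by fact
    \<comment> \<open>The constants K and 0 dominate D but need not have bounded support; their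
      c-transforms provide the starting pair.\<close>
    obtain u v where "potential K P u" "potential K P v" "\<And>x y. D x y \<le> u x + v y"
      by (rule c_transform_improvement[OF M1 M2 x1 x2 G1 G2 D1 D2 D Dz, where u' = "\<lambda>_. K" and v' = "\<lambda>_. 0" and c = 0])
        (auto simp: D)
    then show ?thesis by (auto simp: ok_def)
  qed
  ultimately obtain J0 where *: "\<And>n. \<exists>u v. ok u v \<and> J u v \<le> J0 - real n * \<gamma>" by blast
  obtain n :: nat where "J0 < real n * \<gamma>"
    using reals_Archimedean3[OF \<gamma>] by blast
  with *[of n] J0 show False by fastforce
qed

section \<open>Measure-theoretic preliminaries\<close>

lemma inner_regular_measure:
  fixes M :: "'a::polish_space measure"
  assumes sb: "sets M = sets borel" and fin: "finite_measure M" and B: "B \<in> sets borel" and e: "e > 0"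
  obtains K where "compact K" "K \<subseteq> B" "measure M (B - K) < e"
proof -
  interpret finite_measure M by fact
  have "\<exists>K. compact K \<and> K \<subseteq> B \<and> measure M B - e < measure M K"
  proof (cases "measure M B - e < 0")
    case True
    then show ?thesis by (intro exI[of _ "{}"]) auto
  next
    case False
    have "ennreal (measure M B - e) < emeasure M B"
      unfolding emeasure_eq_measure using e False by (intro ennreal_lessI) auto
    also have "emeasure M B = (SUP K \<in> {K. K \<subseteq> B \<and> compact K}. emeasure M K)"
      by (rule inner_regular[OF sb _ B]) simp
    finally obtain K where K: "K \<subseteq> B" "compact K" "ennreal (measure M B - e) < emeasure M K"
      unfolding less_SUP_iff by blast
    then have "measure M B - e < measure M K"
      using False by (simp add: emeasure_eq_measure ennreal_less_iff)
    with K show ?thesis by blast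
  qed
  then obtain K where K: "compact K" "K \<subseteq> B" "measure M B - e < measure M K" by blast
  have "measure M (B - K) = measure M B - measure M K"
    using K B sb by (intro finite_measure_Diff) (auto simp: borel_compact)
  with K that show ?thesis by auto
qed

text \<open>Lusin's theorem through a countable base of the target: each preimage \<open>A n\<close>
  and its complement are exhausted by compact sets \<open>K n\<close> and \<open>K' n\<close> up to
  small measure. On the intersection C of all \<open>K n \<union> K' n\<close>, the set
  \<open>A n\<close> agrees with the complement of the closed set \<open>K' n\<close> and is
  therefore relatively open.\<close>

lemma lusin_compact:
  fixes M :: "'a::polish_space measure" and f :: "'a \<Rightarrow> 'b::second_countable_topology"
  assumes sb: "sets M = sets borel" and fin: "finite_measure M" and f: "f \<in> borel_measurable borel" and e: "e > 0"
  obtains K where "compact K" "continuous_on K f" "measure M (- K) \<le> e"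
proof -
  interpret finite_measure M by fact
  obtain B :: "'b set set" where B: "countable B" "topological_basis B"
    using ex_countable_basis by blast
  have "B \<noteq> {}"
    using topological_basisE[OF B(2) open_UNIV UNIV_I] by blast
  define b where "b = from_nat_into B"
  have b: "range b = B" using B(1) \<open>B \<noteq> {}\<close> by (simp add: b_def range_from_nat_into)
  have ob: "open (b n)" for n using topological_basis_open[OF B(2)] b by blast
  define A where "A n = f -` b n" for n
  have A: "A n \<in> sets borel" for n
    using measurable_sets[OF f, of "b n"] ob[of n] by (simp add: A_def)
  \<comment> \<open>Two sets are removed for each n, so the total loss is at most the sum of (e/2)
    (1/2)^n, which is e.\<close>
  have d: "0 < e / 4 * (1 / 2) ^ n" for n :: nat using e by simp
  have "\<forall>n. \<exists>K. compact K \<and> K \<subseteq> A n \<and> measure M (A n - K) < e / 4 * (1 / 2) ^ n"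
    using inner_regular_measure[OF sb fin A d] by metis
  then obtain K where K: "\<And>n. compact (K n)" "\<And>n. K n \<subseteq> A n"
    "\<And>n. measure M (A n - K n) < e / 4 * (1 / 2) ^ n" by metis
  have "- A n \<in> sets borel" for n using A[of n] by (simp add: borel_comp)
  then have "\<forall>n. \<exists>K. compact K \<and> K \<subseteq> - A n \<and> measure M (- A n - K) < e / 4 * (1 / 2) ^ n"
    using inner_regular_measure[OF sb fin _ d] by metis
  then obtain K' where K': "\<And>n. compact (K' n)" "\<And>n. K' n \<subseteq> - A n"
    "\<And>n. measure M (- A n - K' n) < e / 4 * (1 / 2) ^ n" by metis
  define C where "C = (\<Inter>n. K n \<union> K' n)"
  have Kb: "K n \<in> sets M" "K' n \<in> sets M" "A n \<in> sets M" "- A n \<in> sets M" for n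
    using K(1)[of n] K'(1)[of n] A[of n] sb by (auto simp: borel_compact borel_comp)
  have "compact C"
  proof -
    have "closed C"
      unfolding C_def using K(1) K'(1) by (intro closed_INT) (simp add: compact_imp_closed closed_Un)
    then have "compact ((K 0 \<union> K' 0) \<inter> C)" using K(1) K'(1) by (intro compact_Int_closed compact_Un)
    moreover have "(K 0 \<union> K' 0) \<inter> C = C" by (auto simp: C_def)
    ultimately show ?thesis by simp
  qed
  moreover have "continuous_on C f"
    unfolding continuous_on_topological
  proof (intro ballI allI impI)
    fix x U assume x: "x \<in> C" and U: "open U" "f x \<in> U"
    obtain V where "V \<in> B" "f x \<in> V" "V \<subseteq> U" using topological_basisE[OF B(2) U] by blast
    then obtain n where n: "f x \<in> b n" "b n \<subseteq> U" using b by blast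
    have "x \<notin> K' n" using n K'(2)[of n] by (auto simp: A_def)
    moreover have "f y \<in> U" if "y \<in> C" "y \<in> - K' n" for y
      using that K(2)[of n] n by (auto simp: C_def A_def)
    moreover have "open (- K' n)" using K'(1) by (simp add: compact_imp_closed open_Compl)
    ultimately show "\<exists>A. open A \<and> x \<in> A \<and> (\<forall>y\<in>C. y \<in> A \<longrightarrow> f y \<in> U)" by blast
  qed
  moreover have "measure M (- C) \<le> e"
  proof -
    define N where "N n = (A n - K n) \<union> (- A n - K' n)" for n
    have N: "N n \<in> sets M" for n using Kb by (auto simp: N_def)
    have bound: "measure M (N n) \<le> e / 2 * (1 / 2) ^ n" for n
    proof -
      have "measure M (N n) \<le> measure M (A n - K n) + measure M (- A n - K' n)"
        unfolding N_def using Kb by (intro measure_Un_le) auto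
      also have "\<dots> \<le> e / 4 * (1 / 2) ^ n + e / 4 * (1 / 2) ^ n"
        using K(3)[of n] K'(3)[of n] by linarith
      finally show ?thesis by (simp add: field_simps)
    qed
    have sm: "summable (\<lambda>n. e / 2 * (1 / 2 :: real) ^ n)"
      by (intro summable_mult summable_geometric) simp
    have smN: "summable (\<lambda>n. measure M (N n))"
      by (rule summable_comparison_test'[OF sm, of 0]) (use bound in auto)
    have "measure M (- C) \<le> measure M (\<Union>n. N n)"
      using N by (intro finite_measure_mono) (auto simp: N_def C_def)
    also have "\<dots> \<le> (\<Sum>n. measure M (N n))"
      using N smN by (intro finite_measure_subadditive_countably) auto
    also have "\<dots> \<le> (\<Sum>n. e / 2 * (1 / 2) ^ n)"
      by (rule suminf_le[OF bound smN sm])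
    also have "\<dots> = e"
      using sums_unique[OF sums_mult[OF geometric_sums[of "1 / 2 :: real"], of "e / 2"]] by simp
    finally show ?thesis .
  qed
  ultimately show ?thesis using that by blast
qed

lemma closed_measure_eqI:
  fixes \<mu> \<nu> :: "'a::topological_space measure"
  assumes "finite_measure \<mu>" "finite_measure \<nu>" "sets \<mu> = sets borel" "sets \<nu> = sets borel"
    and eq: "\<And>C. closed C \<Longrightarrow> measure \<mu> C = measure \<nu> C"
  shows "\<mu> = \<nu>"
proof (rule measure_eqI_generator_eq[where E = "{C. closed C}" and \<Omega> = UNIV and A = "\<lambda>_. UNIV"])
  interpret m: finite_measure \<mu> by fact
  interpret n: finite_measure \<nu> by fact
  show "Int_stable {C :: 'a set. closed C}" by (auto simp: Int_stable_def)
  show "sets \<mu> = sigma_sets UNIV {C. closed C}" "sets \<nu> = sigma_sets UNIV {C. closed C}"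
    using assms(3,4) by (simp_all add: borel_eq_closed)
  show "emeasure \<mu> X = emeasure \<nu> X" if "X \<in> {C. closed C}" for X
    using eq[of X] that by (simp add: m.emeasure_eq_measure n.emeasure_eq_measure)
  show "emeasure \<mu> UNIV \<noteq> \<infinity>" by simp
qed auto

text \<open>The functions max(0, 1 - n dist(x, C)) converge to the indicator of a closed set C on
  which the measures differ, so some n separates the integrals; a change of sign fixes the order.
  The Lipschitz bound later forces a definite distance between points at which f differs
  noticeably.\<close>

lemma separating_lipschitz:
  fixes \<mu> \<nu> :: "'a::metric_space measure"
  assumes fin: "finite_measure \<mu>" "finite_measure \<nu>" and sb: "sets \<mu> = sets borel" "sets \<nu> = sets borel" and ne: "\<mu> \<noteq> \<nu>"
  obtains f :: "'a \<Rightarrow> real" and L where "L \<ge> 0" "\<And>x. \<bar>f x\<bar> \<le> 1" "\<And>x y. \<bar>f x - f y\<bar> \<le> L * dist x y"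
    "f \<in> borel_measurable borel" "integral\<^sup>L \<nu> f < integral\<^sup>L \<mu> f"
proof -
  obtain C where C: "closed C" "measure \<mu> C \<noteq> measure \<nu> C"
    using closed_measure_eqI[OF fin sb] ne by blast
  then have "C \<noteq> {}" by auto
  define g where "g n x = max 0 (1 - real n * infdist x C)" for n x
  have gb: "\<bar>g n x\<bar> \<le> 1" for n x by (auto simp: g_def infdist_nonneg)
  have gl: "\<bar>g n x - g n y\<bar> \<le> real n * dist x y" for n x y
  proof -
    have "\<bar>g n x - g n y\<bar> \<le> \<bar>real n * infdist x C - real n * infdist y C\<bar>" by (auto simp: g_def)
    also have "\<dots> = real n * \<bar>infdist x C - infdist y C\<bar>" by (simp add: right_diff_distrib[symmetric] abs_mult)
    also have "\<dots> \<le> real n * dist x y" by (intro mult_left_mono infdist_triangle_abs) auto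
    finally show ?thesis .
  qed
  have gm: "g n \<in> borel_measurable borel" for n
    unfolding g_def[abs_def] by (intro borel_measurable_continuous_onI continuous_intros)
  have gi: "(\<lambda>n. g n x) \<longlonglongrightarrow> indicator C x" for x
  proof (cases "x \<in> C")
    case True
    then show ?thesis by (simp add: g_def)
  next
    case False
    then have p: "infdist x C > 0"
      using C(1) \<open>C \<noteq> {}\<close> by (simp add: infdist_pos_not_in_closed)
    obtain N :: nat where N: "1 < real N * infdist x C" using reals_Archimedean3[OF p] by blast
    have "g n x = 0" if "n \<ge> N" for n
    proof -
      have "real N * infdist x C \<le> real n * infdist x C" using that p by (intro mult_right_mono) auto
      then show ?thesis using N by (simp add: g_def)
    qed
    then show ?thesis using False by (intro tendsto_eventually) (auto simp: eventually_sequentially)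
  qed
  have lim: "(\<lambda>n. integral\<^sup>L M (g n)) \<longlonglongrightarrow> measure M C" if "finite_measure M" "sets M = sets borel" for M
  proof -
    interpret finite_measure M by fact
    have "(\<lambda>n. integral\<^sup>L M (g n)) \<longlonglongrightarrow> integral\<^sup>L M (indicator C)"
      by (rule integral_dominated_convergence[where w = "\<lambda>_. 1"])
        (use gi gb gm C(1) that(2) in \<open>auto cong: measurable_cong_sets simp: borel_closed\<close>)
    moreover have "integral\<^sup>L M (indicator C) = measure M C"
      using C(1) that(2) by (simp add: sets_eq_imp_space_eq)
    ultimately show ?thesis by simp
  qed
  have "\<exists>n. integral\<^sup>L \<mu> (g n) \<noteq> integral\<^sup>L \<nu> (g n)"
  proof (rule ccontr)
    assume "\<not> ?thesis"
    then have "(\<lambda>n. integral\<^sup>L \<mu> (g n)) = (\<lambda>n. integral\<^sup>L \<nu> (g n))" by auto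
    with lim[OF fin(1) sb(1)] lim[OF fin(2) sb(2)] C(2) show False
      using LIMSEQ_unique by metis
  qed
  then obtain n where n: "integral\<^sup>L \<mu> (g n) \<noteq> integral\<^sup>L \<nu> (g n)" by blast
  show ?thesis
  proof (cases "integral\<^sup>L \<nu> (g n) < integral\<^sup>L \<mu> (g n)")
    case True
    then show ?thesis using that[of "real n" "g n"] gb gl gm by auto
  next
    case False
    with n have "integral\<^sup>L \<nu> (\<lambda>x. - g n x) < integral\<^sup>L \<mu> (\<lambda>x. - g n x)" by simp
    moreover have "\<bar>- g n x - - g n y\<bar> \<le> real n * dist x y" for x y using gl[of n x y] by simp
    ultimately show ?thesis using that[of "real n" "\<lambda>x. - g n x"] gb gm by simp
  qed
qed

lemma tail_integral_tendsto_0: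
  fixes f g :: "'a \<Rightarrow> real"
  assumes f: "integrable M f" and g: "g \<in> borel_measurable M"
  shows "((\<lambda>r. \<integral>x. f x * indicator {x. g x > r} x \<partial>M) \<longlongrightarrow> 0) at_top"
proof -
  have "((\<lambda>r. \<integral>x. f x * indicator {x. g x > r} x \<partial>M) \<longlongrightarrow> (\<integral>x. 0 \<partial>M)) at_top"
  proof (rule integral_dominated_convergence_at_top[where w = "\<lambda>x. \<bar>f x\<bar>"])
    show "AE x in M. ((\<lambda>r. f x * indicator {x. g x > r} x) \<longlongrightarrow> 0) at_top"
    proof (rule AE_I2)
      fix x
      have "\<forall>\<^sub>F r in at_top. f x * indicator {x. g x > r} x = 0"
        using eventually_ge_at_top[of "g x"] by eventually_elim (auto simp: indicator_def)
      then show "((\<lambda>r. f x * indicator {x. g x > r} x) \<longlongrightarrow> 0) at_top" by (rule tendsto_eventually)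
    qed
    show "\<forall>\<^sub>F r in at_top. AE x in M. norm (f x * indicator {x. g x > r} x) \<le> \<bar>f x\<bar>"
      by (auto simp: indicator_def)
    show "(\<lambda>x. f x * indicator {x. g x > r} x) \<in> borel_measurable M" for r
    proof -
      have "(\<lambda>x. f x * indicator {x \<in> space M. g x > r} x) \<in> borel_measurable M"
        using f g by (intro borel_measurable_times borel_measurable_indicator) (auto simp: borel_measurable_iff_greater)
      then show ?thesis by (rule measurable_cong[THEN iffD1, rotated]) (auto simp: indicator_def)
    qed
  qed (use f in auto)
  then show ?thesis by simp
qed

section \<open>Stationarity tested on translated bumps\<close>

definition coef_size :: "(real^'n::finite \<Rightarrow> real^'m::finite^'n) \<Rightarrow> (real^'n \<Rightarrow> real^'n) \<Rightarrow> real^'n \<Rightarrow> real" where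
  "coef_size \<Sigma> b x = (\<Sum>k\<in>UNIV. (norm (column k (\<Sigma> x)))\<^sup>2) + norm (b x)"

lemma sum_norm_column: "(\<Sum>k\<in>UNIV. (norm (column k W))\<^sup>2) = (norm W)\<^sup>2" for W :: "real^'m::finite^'n::finite"
proof -
  have "(norm W)\<^sup>2 = (\<Sum>i\<in>UNIV. \<Sum>k\<in>UNIV. (W $ i $ k)\<^sup>2)"
    by (simp add: norm_vec_def L2_set_def sum_nonneg)
  also have "\<dots> = (\<Sum>k\<in>UNIV. \<Sum>i\<in>UNIV. (W $ i $ k)\<^sup>2)" by (rule sum.swap)
  finally show ?thesis by (simp add: column_def norm_vec_def L2_set_def sum_nonneg)
qed

lemma continuous_column: "continuous_on A (column k)"
  unfolding column_def by (intro continuous_intros)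

lemma column_measurable:
  "f \<in> borel_measurable M \<Longrightarrow> (\<lambda>x. column k (f x)) \<in> borel_measurable M"
  by (rule measurable_compose[OF _ borel_measurable_continuous_onI[OF continuous_column]])

lemma vec_nth_measurable:
  "f \<in> borel_measurable M \<Longrightarrow> (\<lambda>x. f x $ i :: real) \<in> borel_measurable M"
  by (rule measurable_compose[OF _ borel_measurable_continuous_onI]) (auto intro: continuous_intros)

lemma coef_size_measurable:
  assumes "\<Sigma> \<in> borel_measurable borel" "b \<in> borel_measurable borel"
  shows "coef_size \<Sigma> b \<in> borel_measurable borel"
  unfolding coef_size_def[abs_def] using assms column_measurable[OF assms(1)] by measurable

lemma coef_size_nonneg: "coef_size \<Sigma> b x \<ge> 0"
  by (auto simp: coef_size_def intro!: add_nonneg_nonneg sum_nonneg)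

lemma dir_bump_norm_eq_0:
  fixes y :: "real^'n::finite"
  shows "real CARD('n) * d < norm y \<Longrightarrow> dir_bump d k \<nu> s y = 0"
  by (induction k arbitrary: \<nu>) (auto simp: bump_norm_eq_0)

lemma dir_bump_measurable:
  assumes "f \<in> borel_measurable M" "g \<in> borel_measurable M"
  shows "(\<lambda>x. dir_bump d k \<nu> (f x) (g x)) \<in> borel_measurable M"
proof (induction k arbitrary: \<nu>)
  case 0
  show ?case using measurable_compose[OF assms(2) bump_measurable] by simp
next
  case (Suc k)
  show ?case unfolding dir_bump.simps
    by (intro borel_measurable_sum borel_measurable_times Suc.IH vec_nth_measurable assms)
qed

text \<open>Since A is the sum of sigma_k sigma_k^t over the columns of \<Sigma>, the second-order
  part of L is the sum of the second derivatives along the columns. In this form L can be compared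
  with differences along the moves.\<close>

lemma gen_L_bump:
  fixes \<Sigma> :: "real^'n::finite \<Rightarrow> real^'m::finite^'n"
  shows "gen_L \<Sigma> b (\<lambda>x. bump d \<nu> (x - z)) x
    = (\<Sum>k\<in>UNIV. dir_bump d 2 \<nu> (column k (\<Sigma> x)) (x - z)) + dir_bump d 1 \<nu> (b x) (x - z)"
proof -
  define S where "S k i = \<Sigma> x $ i $ k" for k i
  define R where "R i j = bump d ((\<nu>(i := Suc (\<nu> i)))(j := Suc ((\<nu>(i := Suc (\<nu> i))) j))) (x - z)" for i j
  have A: "diff_A \<Sigma> x $ i $ j = (\<Sum>k\<in>UNIV. S k i * S k j)" for i j
    by (simp add: diff_A_def matrix_matrix_mult_def transpose_def S_def)
  have "(\<Sum>i\<in>UNIV. \<Sum>j\<in>UNIV. diff_A \<Sigma> x $ i $ j * partial i (partial j (\<lambda>x. bump d \<nu> (x - z))) x)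
      = (\<Sum>i\<in>UNIV. \<Sum>j\<in>UNIV. (\<Sum>k\<in>UNIV. S k i * S k j) * R j i)"
    by (simp add: A partial_bump R_def)
  also have "\<dots> = (\<Sum>j\<in>UNIV. \<Sum>i\<in>UNIV. (\<Sum>k\<in>UNIV. S k i * S k j) * R j i)" by (rule sum.swap)
  also have "\<dots> = (\<Sum>j\<in>UNIV. \<Sum>k\<in>UNIV. \<Sum>i\<in>UNIV. S k i * S k j * R j i)"
    by (simp add: sum_distrib_right) (subst sum.swap, rule refl)
  also have "\<dots> = (\<Sum>k\<in>UNIV. \<Sum>j\<in>UNIV. \<Sum>i\<in>UNIV. S k i * S k j * R j i)" by (rule sum.swap)
  also have "\<dots> = (\<Sum>k\<in>UNIV. dir_bump d 2 \<nu> (column k (\<Sigma> x)) (x - z))"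
    by (simp add: numeral_2_eq_2 R_def S_def column_def sum_distrib_left mult_ac)
  finally show ?thesis
    by (simp add: gen_L_def partial_bump)
qed

text \<open>For x in S, the increment over one step from x of the bump centred at z. To leading
  order it is h^2 times L applied to that bump.\<close>

definition kernel_defect :: "(real^'n::finite \<Rightarrow> real^'m::finite^'n) \<Rightarrow> (real^'n \<Rightarrow> real^'n) \<Rightarrow>
    real \<Rightarrow> (real^'n) set \<Rightarrow> real \<Rightarrow> real^'n \<Rightarrow> real^'n \<Rightarrow> real" where
  "kernel_defect \<Sigma> b d S h z x = indicator S x *
    (moves h (\<lambda>k. column k (\<Sigma> x)) (b x) (\<lambda>v. bump d (\<lambda>_. 0) (x + v - z))
      - (2 * CARD('m) + 1) * bump d (\<lambda>_. 0) (x - z))"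

definition potential_defect :: "(real^'n::finite \<Rightarrow> real^'m::finite^'n) \<Rightarrow> (real^'n \<Rightarrow> real^'n) \<Rightarrow>
    (real^'n) set \<Rightarrow> real \<Rightarrow> (real^'n \<Rightarrow> real) \<Rightarrow> real^'n \<Rightarrow> real^'n \<Rightarrow> real" where
  "potential_defect \<Sigma> b S h u x \<xi> = indicator S x *
    (moves h (\<lambda>k. column k (\<Sigma> x)) (b x) (\<lambda>v. u (x + \<xi> + v)) - real (2 * CARD('m) + 1) * u (x + \<xi>))"

text \<open>Where the coefficients are bounded by M, the defect is h^2 L f_z + O(h^3) for the bump
  f_z centred at z, uniformly in z. As L f_z has integral zero, its integral over S is minus that
  over the complement, which is controlled by a tail over Q > M. Hence the order of the quantifiers:
  M is taken large before h is taken small.\<close>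

lemma kernel_moves_small:
  fixes \<Sigma> :: "real^'n::finite \<Rightarrow> real^'m::finite^'n"
  assumes sol: "prob_solution \<Sigma> b \<mu>" and m: "\<Sigma> \<in> borel_measurable borel" "b \<in> borel_measurable borel"
    and int: "integrable \<mu> (\<lambda>x. coef_size \<Sigma> b x * indicator (cball 0 P') x)"
    and P: "P + real CARD('n) * d \<le> P'" and e: "e > 0"
  shows "\<forall>\<^sub>F M in at_top. \<forall>\<^sub>F h in at_right 0. \<forall>z. norm z \<le> P \<longrightarrow>
    \<bar>\<integral>x. kernel_defect \<Sigma> b d {x. norm x \<le> P' \<and> coef_size \<Sigma> b x \<le> M} h z x \<partial>\<mu>\<bar> \<le> e * h\<^sup>2"
proof -
  interpret prob_space \<mu> using sol by (simp add: prob_solution_def)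
  have sb [measurable_cong]: "sets \<mu> = sets borel" using sol by (simp add: prob_solution_def)
  have sp: "space \<mu> = UNIV" using sets_eq_imp_space_eq[OF sb] by simp
  define \<nu> :: "'n \<Rightarrow> nat" where "\<nu> = (\<lambda>_. 0)"
  define Q where "Q = coef_size \<Sigma> b"
  define g where "g z = gen_L \<Sigma> b (\<lambda>x. bump d \<nu> (x - z))" for z
  have g: "g z x = (\<Sum>k\<in>UNIV. dir_bump d 2 \<nu> (column k (\<Sigma> x)) (x - z)) + dir_bump d 1 \<nu> (b x) (x - z)" for z x
    unfolding g_def by (rule gen_L_bump)
  note [measurable] = m column_measurable[OF m(1)]
  have [measurable]: "Q \<in> borel_measurable borel" unfolding Q_def by (rule coef_size_measurable[OF m])
  have Q0: "Q x \<ge> 0" for x by (simp add: Q_def coef_size_nonneg)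
  have gm [measurable]: "g z \<in> borel_measurable borel" for z
    unfolding g[abs_def] by (intro borel_measurable_add borel_measurable_sum dir_bump_measurable) measurable
  obtain C2 where C2: "C2 \<ge> 0" "\<And>s y. \<bar>dir_bump d 2 \<nu> s y\<bar> \<le> C2 * norm s ^ 2"
    using dir_bump_bounded by blast
  obtain C1 where C1: "C1 \<ge> 0" "\<And>s y. \<bar>dir_bump d 1 \<nu> s y\<bar> \<le> C1 * norm s"
    using dir_bump_bounded[of d 1 \<nu>] by auto
  define C where "C = C1 + C2"
  have C: "C \<ge> 0" using C1 C2 by (simp add: C_def)
  have gQ: "\<bar>g z x\<bar> \<le> C * Q x" for z x
  proof -
    have "\<bar>g z x\<bar> \<le> (\<Sum>k\<in>UNIV. \<bar>dir_bump d 2 \<nu> (column k (\<Sigma> x)) (x - z)\<bar>) + \<bar>dir_bump d 1 \<nu> (b x) (x - z)\<bar>"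
      unfolding g by (intro order_trans[OF abs_triangle_ineq] add_right_mono sum_abs)
    also have "\<dots> \<le> (\<Sum>k\<in>UNIV. C2 * norm (column k (\<Sigma> x)) ^ 2) + C1 * norm (b x)"
      by (intro add_mono sum_mono C1 C2)
    also have "\<dots> \<le> C * Q x"
    proof -
      have "0 \<le> C1 * (\<Sum>k\<in>UNIV. (norm (column k (\<Sigma> x)))\<^sup>2) + C2 * norm (b x)"
        using C1 C2 by (auto intro!: add_nonneg_nonneg mult_nonneg_nonneg sum_nonneg)
      then show ?thesis
        by (simp add: C_def Q_def coef_size_def sum_distrib_left[symmetric] algebra_simps)
    qed
    finally show ?thesis .
  qed
  \<comment> \<open>Bumps centred in the ball of radius P live in the ball of radius P', where
    \<open>int\<close> controls the coefficients.\<close>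
  have far: "g z x = 0" if "norm z \<le> P" "\<not> norm x \<le> P'" for z x
  proof -
    have "real CARD('n) * d < norm (x - z)"
      using that P norm_triangle_sub[of x z] by linarith
    then show ?thesis unfolding g by (simp add: dir_bump_norm_eq_0 del: dir_bump.simps)
  qed
  define B where "B x = C * (Q x * indicator (cball 0 P') x)" for x
  have iB: "integrable \<mu> B" using int unfolding B_def Q_def by simp
  have gB: "\<bar>g z x\<bar> \<le> B x" if "norm z \<le> P" for z x
    using gQ[of z x] far[OF that, of x] by (cases "norm x \<le> P'") (auto simp: B_def)
  have ig: "integrable \<mu> (g z)" if "norm z \<le> P" for z
  proof (rule Bochner_Integration.integrable_bound[OF iB])
    show "AE x in \<mu>. norm (g z x) \<le> norm (B x)"
      using order_trans[OF gB[OF that] abs_ge_self] by simp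
  qed measurable
  have g0: "integral\<^sup>L \<mu> (g z) = 0" for z
  proof -
    have "\<forall>f. test_fun f \<longrightarrow> integral\<^sup>L \<mu> (gen_L \<Sigma> b f) = 0"
      using sol by (simp add: prob_solution_def)
    then show ?thesis using test_fun_bump[of d \<nu> z] by (simp add: g_def)
  qed
  obtain C3 where C3: "C3 \<ge> 0" "\<And>s y h. \<bar>bump d \<nu> (y + h *\<^sub>R s) + bump d \<nu> (y - h *\<^sub>R s) - 2 * bump d \<nu> y
      - h\<^sup>2 * dir_bump d 2 \<nu> s y\<bar> \<le> C3 * (\<bar>h\<bar> * norm s) ^ 3"
    using bump_second_difference by blast
  obtain C4 where C4: "C4 \<ge> 0" "\<And>s y h. \<bar>bump d \<nu> (y + h *\<^sub>R s) - bump d \<nu> y - h * dir_bump d 1 \<nu> s y\<bar> \<le> C4 * (\<bar>h\<bar> * norm s) ^ 2"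
    using bump_first_difference by blast
  define F where "F h z x = moves h (\<lambda>k. column k (\<Sigma> x)) (b x) (\<lambda>v. bump d \<nu> (x + v - z))
        - (2 * CARD('m) + 1) * bump d \<nu> (x - z)" for h z x
  have [measurable]: "F h z \<in> borel_measurable borel" for h z
    unfolding F_def[abs_def] moves_def by measurable
  have FM: "\<bar>F h z x - h\<^sup>2 * g z x\<bar> \<le> h ^ 3 * (CARD('m) * C3 * (M + 1) ^ 3 + C4 * M\<^sup>2)"
    if h: "0 < h" "h \<le> 1" and Q: "Q x \<le> M" for h z x M
  proof -
    have M: "M \<ge> 0" using Q Q0[of x] by linarith
    \<comment> \<open>It is the square of the norm that is bounded by M; M + 1 replaces the square
      root.\<close>
    have "norm (column k (\<Sigma> x)) \<le> M + 1" for k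
    proof -
      have "(norm (column k (\<Sigma> x)))\<^sup>2 \<le> (\<Sum>k\<in>UNIV. (norm (column k (\<Sigma> x)))\<^sup>2)"
        by (rule member_le_sum) auto
      also have "\<dots> \<le> M" using Q norm_ge_zero[of "b x"] unfolding Q_def coef_size_def by linarith
      also have "\<dots> \<le> (M + 1)\<^sup>2" using M by (simp add: power2_eq_square algebra_simps)
      finally show ?thesis by (rule power2_le_imp_le) (use M in simp)
    qed
    then have "(\<bar>h\<bar> * norm (column k (\<Sigma> x))) ^ 3 \<le> h ^ 3 * (M + 1) ^ 3" for k
      unfolding power_mult_distrib using h by (intro mult_mono power_mono) auto
    then have k: "\<bar>bump d \<nu> ((x - z) + h *\<^sub>R column k (\<Sigma> x)) + bump d \<nu> ((x - z) - h *\<^sub>R column k (\<Sigma> x)) - 2 * bump d \<nu> (x - z)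
      - h\<^sup>2 * dir_bump d 2 \<nu> (column k (\<Sigma> x)) (x - z)\<bar> \<le> C3 * (h ^ 3 * (M + 1) ^ 3)" for k
      using C3(1) by (intro order_trans[OF C3(2)] mult_left_mono) auto
    \<comment> \<open>The drift increment has length of order h^2, so its second-order remainder is
      of order h^4, which is below h^3 for h \<le> 1.\<close>
    have "norm (b x) \<le> M" using Q sum_nonneg[of UNIV "\<lambda>k. (norm (column k (\<Sigma> x)))\<^sup>2"]
      by (simp add: Q_def coef_size_def)
    then have "(\<bar>h\<^sup>2\<bar> * norm (b x)) ^ 2 \<le> h ^ 3 * M\<^sup>2"
      unfolding power_mult_distrib using h power_decreasing[of 3 4 h]
      by (intro mult_mono power_mono) (auto simp: power_mult[symmetric])
    then have bb: "\<bar>bump d \<nu> ((x - z) + h\<^sup>2 *\<^sub>R b x) - bump d \<nu> (x - z) - h\<^sup>2 * dir_bump d 1 \<nu> (b x) (x - z)\<bar> \<le> C4 * (h ^ 3 * M\<^sup>2)"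
      using C4(1) by (intro order_trans[OF C4(2)] mult_left_mono) auto
    have "F h z x - h\<^sup>2 * g z x = (\<Sum>k\<in>UNIV. bump d \<nu> ((x - z) + h *\<^sub>R column k (\<Sigma> x)) + bump d \<nu> ((x - z) - h *\<^sub>R column k (\<Sigma> x)) - 2 * bump d \<nu> (x - z)
      - h\<^sup>2 * dir_bump d 2 \<nu> (column k (\<Sigma> x)) (x - z)) + (bump d \<nu> ((x - z) + h\<^sup>2 *\<^sub>R b x) - bump d \<nu> (x - z) - h\<^sup>2 * dir_bump d 1 \<nu> (b x) (x - z))"
      unfolding F_def moves_def g
      by (simp add: sum.distrib sum_subtractf sum_distrib_left algebra_simps del: dir_bump.simps)
    also have "\<bar>\<dots>\<bar> \<le> (\<Sum>k::'m\<in>UNIV. C3 * (h ^ 3 * (M + 1) ^ 3)) + C4 * (h ^ 3 * M\<^sup>2)"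
      by (intro order_trans[OF abs_triangle_ineq] add_mono order_trans[OF sum_abs] sum_mono k bb)
    also have "\<dots> = h ^ 3 * (CARD('m) * C3 * (M + 1) ^ 3 + C4 * M\<^sup>2)" by (simp add: algebra_simps)
    finally show ?thesis .
  qed
  have "((\<lambda>M. \<integral>x. B x * indicator {x. Q x > M} x \<partial>\<mu>) \<longlongrightarrow> 0) at_top"
    by (rule tail_integral_tendsto_0[OF iB]) measurable
  then have "\<forall>\<^sub>F M in at_top. (\<integral>x. B x * indicator {x. Q x > M} x \<partial>\<mu>) < e / 2"
    using e by (intro order_tendstoD(2)) auto
  then show ?thesis
  proof eventually_elim
    case (elim M)
    define c where "c = CARD('m) * C3 * (M + 1) ^ 3 + C4 * M\<^sup>2"
    define S where "S = {x. norm x \<le> P' \<and> Q x \<le> M}"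
    have [measurable]: "S \<in> sets borel" unfolding S_def by measurable
    have "((\<lambda>h. h * \<bar>c\<bar>) \<longlongrightarrow> 0 * \<bar>c\<bar>) (at_right 0)" by (intro tendsto_intros)
    then have "\<forall>\<^sub>F h in at_right 0. h * \<bar>c\<bar> < e / 2" using e by (intro order_tendstoD(2)) auto
    moreover have "\<forall>\<^sub>F h in at_right 0. (h::real) \<le> 1"
      unfolding eventually_at_right_field by (intro exI[of _ 1]) auto
    ultimately have "\<forall>\<^sub>F h in at_right 0. \<forall>z. norm z \<le> P \<longrightarrow> \<bar>\<integral>x. indicator S x * F h z x \<partial>\<mu>\<bar> \<le> e * h\<^sup>2"
      using eventually_at_right_less[of 0]
    proof eventually_elim
      case (elim h)
      show ?case
      proof (intro allI impI)
        fix z :: "real^'n" assume z: "norm z \<le> P"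
        define r where "r x = indicator S x * (F h z x - h\<^sup>2 * g z x)" for x
        have rb: "\<bar>r x\<bar> \<le> h ^ 3 * \<bar>c\<bar>" for x
        proof -
          have "h ^ 3 * c \<le> h ^ 3 * \<bar>c\<bar>" using elim by (intro mult_left_mono) auto
          moreover have "0 \<le> h ^ 3 * \<bar>c\<bar>" using elim by auto
          moreover have "\<bar>F h z x - h\<^sup>2 * g z x\<bar> \<le> h ^ 3 * c" if "x \<in> S"
            using FM[of h x M z] elim that unfolding S_def c_def[symmetric] by simp
          ultimately show ?thesis
            unfolding r_def by (cases "x \<in> S") (auto simp del: abs_mult)
        qed
        have rm [measurable]: "r \<in> borel_measurable borel" unfolding r_def[abs_def] by measurable
        have ir: "integrable \<mu> r"
          by (rule integrable_const_bound[of _ "h ^ 3 * \<bar>c\<bar>"]) (use rb in auto)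
        have iS: "integrable \<mu> (\<lambda>x. indicator S x * g z x)"
          by (rule Bochner_Integration.integrable_bound[OF ig[OF z]]) (auto simp: indicator_def)
        have it: "integrable \<mu> (\<lambda>x. B x * indicator {x. Q x > M} x)"
        proof (rule Bochner_Integration.integrable_bound[OF iB])
          have [measurable]: "B \<in> borel_measurable \<mu>" using iB by (rule borel_measurable_integrable)
          show "(\<lambda>x. B x * indicator {x. Q x > M} x) \<in> borel_measurable \<mu>" by measurable
        qed (auto simp: indicator_def)
        have "(\<integral>x. indicator S x * F h z x \<partial>\<mu>) = (\<integral>x. r x + h\<^sup>2 * (indicator S x * g z x) \<partial>\<mu>)"
          by (rule Bochner_Integration.integral_cong) (auto simp: r_def algebra_simps)
        also have "\<dots> = integral\<^sup>L \<mu> r + h\<^sup>2 * (\<integral>x. indicator S x * g z x \<partial>\<mu>)"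
          using ir iS by simp
        finally have eq: "(\<integral>x. indicator S x * F h z x \<partial>\<mu>) = integral\<^sup>L \<mu> r + h\<^sup>2 * (\<integral>x. indicator S x * g z x \<partial>\<mu>)" .
        have "\<bar>integral\<^sup>L \<mu> r\<bar> \<le> (\<integral>x. \<bar>r x\<bar> \<partial>\<mu>)" by (rule integral_abs_bound)
        also have "\<dots> \<le> (\<integral>x. h ^ 3 * \<bar>c\<bar> \<partial>\<mu>)"
          using ir rb by (intro integral_mono) auto
        also have "\<dots> = h\<^sup>2 * (h * \<bar>c\<bar>)" by (simp add: prob_space power2_eq_square power3_eq_cube)
        also have "\<dots> \<le> h\<^sup>2 * (e / 2)" using elim by (intro mult_left_mono) auto
        finally have 1: "\<bar>integral\<^sup>L \<mu> r\<bar> \<le> h\<^sup>2 * (e / 2)" .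
        \<comment> \<open>Stationarity enters here: subtracting \<open>g z\<close>, whose integral
          is zero, turns the integral over S into one over its complement.\<close>
        have "(\<integral>x. indicator S x * g z x \<partial>\<mu>) = (\<integral>x. indicator S x * g z x - g z x \<partial>\<mu>)"
          using iS ig[OF z] g0[of z] by simp
        also have "\<bar>\<dots>\<bar> \<le> (\<integral>x. \<bar>indicator S x * g z x - g z x\<bar> \<partial>\<mu>)" by (rule integral_abs_bound)
        also have "\<dots> \<le> (\<integral>x. B x * indicator {x. Q x > M} x \<partial>\<mu>)"
        proof (rule integral_mono[OF _ it])
          show "integrable \<mu> (\<lambda>x. \<bar>indicator S x * g z x - g z x\<bar>)" using iS ig[OF z] by simp
          show "\<bar>indicator S x * g z x - g z x\<bar> \<le> B x * indicator {x. Q x > M} x" for x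
            using gB[OF z, of x] far[OF z, of x] Q0[of x] C by (auto simp: S_def indicator_def B_def not_le)
        qed
        also have "\<dots> \<le> e / 2" using \<open>(\<integral>x. B x * indicator {x. Q x > M} x \<partial>\<mu>) < e / 2\<close> by simp
        finally have "h\<^sup>2 * \<bar>\<integral>x. indicator S x * g z x \<partial>\<mu>\<bar> \<le> h\<^sup>2 * (e / 2)"
          by (intro mult_left_mono) auto
        with 1 show "\<bar>\<integral>x. indicator S x * F h z x \<partial>\<mu>\<bar> \<le> e * h\<^sup>2"
          unfolding eq by (intro order_trans[OF abs_triangle_ineq]) (simp add: abs_mult algebra_simps)
      qed
    qed
    then show ?case unfolding kernel_defect_def S_def F_def Q_def \<nu>_def .
  qed
qed

section \<open>Mollification by the bump density\<close>

lemma integral_lborel_shift: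
  fixes f :: "'a::euclidean_space \<Rightarrow> real"
  assumes "f \<in> borel_measurable borel"
  shows "(\<integral>x. f (c + x) \<partial>lborel) = (\<integral>x. f x \<partial>lborel)"
proof -
  have "(\<integral>x. f x \<partial>lborel) = (\<integral>x. f x \<partial>distr lborel borel ((+) c))"
    by (simp add: lborel_distr_plus)
  also have "\<dots> = (\<integral>x. f (c + x) \<partial>lborel)"
    using assms by (subst integral_distr) auto
  finally show ?thesis by simp
qed

definition bump_mass :: "real \<Rightarrow> 'n::finite itself \<Rightarrow> real" where
  "bump_mass d _ = (\<integral>x. bump d (\<lambda>_. 0) x \<partial>(lborel :: (real^'n) measure))"

definition bump_law :: "real \<Rightarrow> (real^'n::finite) measure" where
  "bump_law d = density lborel (\<lambda>x. ennreal (bump d (\<lambda>_. 0) x / bump_mass d TYPE('n)))"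

lemma bump_integrable: "integrable lborel (bump d \<nu> :: real^'n::finite \<Rightarrow> real)"
proof -
  obtain B where B: "\<And>x :: real^'n. \<bar>bump d \<nu> x\<bar> \<le> B" using bump_bounded by blast
  have i: "integrable lborel (\<lambda>x::real^'n. B * indicator (cball 0 (real CARD('n) * d)) x)"
    by (intro integrable_mult_right integrable_real_indicator) (use emeasure_bounded_finite[OF bounded_cball] in auto)
  show ?thesis
    by (rule Bochner_Integration.integrable_bound[OF i])
      (use B bump_norm_eq_0[of d _ \<nu>] in \<open>auto simp: indicator_def not_le intro: order_trans[OF _ abs_ge_self]\<close>)
qed

lemma bump_mass_pos:
  assumes "d > 0"
  shows "bump_mass d TYPE('n::finite) > 0"
proof -
  let ?r = "bump d (\<lambda>_. 0) :: real^'n \<Rightarrow> real"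
  have "bump_mass d TYPE('n) \<noteq> 0"
  proof
    assume "bump_mass d TYPE('n) = 0"
    then have ae: "AE x in lborel. ?r x = 0"
      using integral_nonneg_eq_0_iff_AE[OF bump_integrable[where 'n = 'n, of d "\<lambda>_. 0"]]
      by (simp add: bump_mass_def bump_0_nonneg)
    have "open {x. ?r x > 0}" by (intro open_Collect_less continuous_intros continuous_bump)
    moreover have "AE x in lborel. x \<notin> {x. ?r x > 0}" using ae by eventually_elim simp
    ultimately have "emeasure lborel {x. ?r x > 0} = 0"
      by (subst AE_iff_measurable[symmetric, where P = "\<lambda>x. x \<notin> {x. ?r x > 0}"]) auto
    moreover have "0 \<in> {x. ?r x > 0}" using bump_0_pos[OF assms] by simp
    ultimately show False
    proof -
      have "{x. ?r x > 0} \<in> null_sets lborel"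
        using \<open>emeasure lborel {x. ?r x > 0} = 0\<close> \<open>open {x. ?r x > 0}\<close> by (auto intro!: null_setsI)
      then have "negligible {x. ?r x > 0}"
        unfolding negligible_iff_null_sets by (rule null_sets_completionI)
      with open_not_negligible[OF \<open>open {x. ?r x > 0}\<close>] \<open>0 \<in> {x. ?r x > 0}\<close> show False by blast
    qed
  qed
  moreover have "bump_mass d TYPE('n) \<ge> 0"
    unfolding bump_mass_def by (rule integral_nonneg_AE) (simp add: bump_0_nonneg)
  ultimately show ?thesis by simp
qed

lemma bump_law_prob:
  assumes "d > 0"
  shows "prob_space (bump_law d :: (real^'n::finite) measure)"
proof
  have "integrable lborel (\<lambda>x::real^'n. bump d (\<lambda>_. 0) x / bump_mass d TYPE('n))"
    by (intro Bochner_Integration.integrable_divide bump_integrable)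
  then have "(\<integral>\<^sup>+ x. ennreal (bump d (\<lambda>_. 0) x / bump_mass d TYPE('n)) \<partial>(lborel :: (real^'n) measure))
      = ennreal (\<integral>x. bump d (\<lambda>_. 0) x / bump_mass d TYPE('n) \<partial>(lborel :: (real^'n) measure))"
    using bump_mass_pos[OF assms, where 'n = 'n] by (intro nn_integral_eq_integral) (auto simp: bump_0_nonneg)
  also have "\<dots> = 1"
    using bump_mass_pos[OF assms, where 'n = 'n] by (simp add: bump_mass_def)
  finally show "emeasure (bump_law d) (space (bump_law d :: (real^'n) measure)) = 1"
    by (simp add: bump_law_def emeasure_density)
qed

lemma sets_bump_law [measurable_cong, simp]: "sets (bump_law d) = sets borel"
  by (simp add: bump_law_def)

lemma bump_law_AE: "AE x in (bump_law d :: (real^'n::finite) measure). norm x \<le> real CARD('n) * d"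
  unfolding bump_law_def
proof (subst AE_density)
  show "AE x in (lborel :: (real^'n) measure). 0 < ennreal (bump d (\<lambda>_. 0) x / bump_mass d TYPE('n)) \<longrightarrow> norm x \<le> real CARD('n) * d"
    using bump_norm_eq_0[where 'n = 'n and d = d and \<nu> = "\<lambda>_. 0"]
    by (intro AE_I2) (metis divide_eq_0_iff ennreal_0 less_irrefl not_le)
qed measurable

text \<open>The mean over the mollifier is a convolution, and evenness of the bump gives the
  argument y - z. In this form an increment in y falls on the bump and never on u.\<close>

lemma bump_law_integral:
  fixes u :: "real^'n::finite \<Rightarrow> real"
  assumes d: "d > 0" and u: "u \<in> borel_measurable borel"
  shows "(\<integral>\<xi>. u (y + \<xi>) \<partial>bump_law d) = (\<integral>z. u z * bump d (\<lambda>_. 0) (y - z) \<partial>lborel) / bump_mass d TYPE('n)"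
proof -
  note [measurable] = u
  have "(\<integral>\<xi>. u (y + \<xi>) \<partial>bump_law d) = (\<integral>\<xi>. (bump d (\<lambda>_. 0) \<xi> / bump_mass d TYPE('n)) *\<^sub>R u (y + \<xi>) \<partial>lborel)"
    unfolding bump_law_def using bump_mass_pos[OF d, where 'n = 'n]
    by (intro integral_density) (auto simp: bump_0_nonneg)
  also have "\<dots> = (\<integral>\<xi>. u (y + \<xi>) * bump d (\<lambda>_. 0) (y - (y + \<xi>)) / bump_mass d TYPE('n) \<partial>lborel)"
    by (intro Bochner_Integration.integral_cong) (auto simp: bump_0_even)
  also have "\<dots> = (\<integral>z. u z * bump d (\<lambda>_. 0) (y - z) / bump_mass d TYPE('n) \<partial>lborel)"
    by (rule integral_lborel_shift[of "\<lambda>z. u z * bump d (\<lambda>_. 0) (y - z) / bump_mass d TYPE('n)"]) measurable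
  finally show ?thesis by simp
qed

lemma abs_moves_le:
  fixes f :: "'a::real_vector \<Rightarrow> real" and w :: "'m::finite \<Rightarrow> 'a" and B :: real
  assumes "\<And>v. \<bar>f v\<bar> \<le> B"
  shows "\<bar>moves h w \<beta> f\<bar> \<le> (2 * CARD('m) + 1) * B"
proof -
  have "\<bar>f (h *\<^sub>R w k) + f (- (h *\<^sub>R w k))\<bar> \<le> B + B" for k
    using assms[of "h *\<^sub>R w k"] assms[of "- (h *\<^sub>R w k)"] by linarith
  then have "\<bar>\<Sum>k\<in>UNIV. f (h *\<^sub>R w k) + f (- (h *\<^sub>R w k))\<bar> \<le> (\<Sum>k::'m\<in>UNIV. B + B)"
    by (intro order_trans[OF sum_abs] sum_mono)
  then have "\<bar>moves h w \<beta> f\<bar> \<le> (\<Sum>k::'m\<in>UNIV. B + B) + B"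
    unfolding moves_def using assms[of "h\<^sup>2 *\<^sub>R \<beta>"] by linarith
  then show ?thesis by (simp add: algebra_simps)
qed

lemma moves_integral:
  fixes f :: "'a::real_vector \<Rightarrow> 'b \<Rightarrow> real"
  assumes "\<And>v. integrable M (f v)"
  shows "integrable M (\<lambda>\<omega>. moves h w \<beta> (\<lambda>v. f v \<omega>))"
    and "(\<integral>\<omega>. moves h w \<beta> (\<lambda>v. f v \<omega>) \<partial>M) = moves h w \<beta> (\<lambda>v. \<integral>\<omega>. f v \<omega> \<partial>M)"
  unfolding moves_def using assms by simp_all

lemma moves_diff_integral:
  fixes f :: "'a::real_vector \<Rightarrow> 'b \<Rightarrow> real"
  assumes f: "\<And>v. integrable M (f v)" and g: "integrable M g"
  shows "(\<integral>\<omega>. c * (moves h w \<beta> (\<lambda>v. f v \<omega>) - n * g \<omega>) \<partial>M)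
    = c * (moves h w \<beta> (\<lambda>v. \<integral>\<omega>. f v \<omega> \<partial>M) - n * (\<integral>\<omega>. g \<omega> \<partial>M))"
proof -
  have "integrable M (\<lambda>\<omega>. n * g \<omega>)" using g by simp
  then have "(\<integral>\<omega>. moves h w \<beta> (\<lambda>v. f v \<omega>) - n * g \<omega> \<partial>M)
      = moves h w \<beta> (\<lambda>v. \<integral>\<omega>. f v \<omega> \<partial>M) - n * (\<integral>\<omega>. g \<omega> \<partial>M)"
    by (subst Bochner_Integration.integral_diff[OF moves_integral(1)[OF f]])
      (auto simp: moves_integral(2)[OF f])
  then show ?thesis by simp
qed

lemma moves_cmult:
  fixes c :: real
  shows "moves h w \<beta> (\<lambda>v. f v * c) = moves h w \<beta> f * c"
  by (simp add: moves_def sum_distrib_right distrib_right)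

text \<open>Averaging over \<xi> and exchanging integrals writes the total defect as the integral
  over z of u(z) times the integrated \<open>kernel_defect\<close> at z, divided by the mass of the
  bump. As 0 \<le> u \<le> K and u vanishes outside the ball of radius P, the bound is the same for
  all potentials.\<close>

lemma potential_moves_small:
  fixes \<Sigma> :: "real^'n::finite \<Rightarrow> real^'m::finite^'n" and u :: "real^'n \<Rightarrow> real"
  assumes pr: "prob_space \<mu>" and sb [measurable_cong]: "sets \<mu> = sets borel"
    and m: "\<Sigma> \<in> borel_measurable borel" "b \<in> borel_measurable borel"
    and d: "d > 0" and u: "potential K P u" and S [measurable]: "S \<in> sets borel"
    and small: "\<And>z. norm z \<le> P \<Longrightarrow> \<bar>\<integral>x. kernel_defect \<Sigma> b d S h z x \<partial>\<mu>\<bar> \<le> e"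
  shows "integrable (\<mu> \<Otimes>\<^sub>M bump_law d) (\<lambda>(x, \<xi>). potential_defect \<Sigma> b S h u x \<xi>)"
    and "(\<integral>(x, \<xi>). potential_defect \<Sigma> b S h u x \<xi> \<partial>(\<mu> \<Otimes>\<^sub>M bump_law d)) \<le> K * measure lborel (cball 0 P :: (real^'n) set) * e / bump_mass d TYPE('n)"
proof -
  interpret mu: prob_space \<mu> by (rule pr)
  interpret ka: prob_space "bump_law d :: (real^'n) measure" by (rule bump_law_prob[OF d])
  interpret pair_prob_space \<mu> "bump_law d :: (real^'n) measure" ..
  interpret ml: pair_sigma_finite \<mu> "lborel :: (real^'n) measure" ..
  note [measurable] = m column_measurable[OF m(1)]
  have [measurable]: "u \<in> borel_measurable borel" using u by (simp add: potential_def)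
  have ub: "0 \<le> u x" "u x \<le> K" "P \<le> norm x \<Longrightarrow> u x = 0" for x using u by (auto simp: potential_def)
  have ub': "\<bar>u x\<bar> \<le> K" for x using ub[of x] by simp
  have K: "K \<ge> 0" using ub[of 0] by linarith
  define n1 where "n1 = real (2 * CARD('m) + 1)"
  define w where "w x k = column k (\<Sigma> x)" for x k
  have [measurable]: "(\<lambda>x. w x k) \<in> borel_measurable borel" for k unfolding w_def by measurable
  have weq: "w x = (\<lambda>k. column k (\<Sigma> x))" for x by (simp add: w_def fun_eq_iff)
  define H where "H x \<xi> = indicator S x * (moves h (w x) (b x) (\<lambda>v. u (x + \<xi> + v)) - n1 * u (x + \<xi>))" for x \<xi>
  define \<rho> :: "real^'n \<Rightarrow> real" where "\<rho> = bump d (\<lambda>_. 0)"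
  have [measurable]: "\<rho> \<in> borel_measurable borel" unfolding \<rho>_def by measurable
  define F where "F x z = indicator S x * (moves h (w x) (b x) (\<lambda>v. \<rho> (x + v - z)) - n1 * \<rho> (x - z))" for x z
  define c0 where "c0 = bump_mass d TYPE('n)"
  have c0: "c0 > 0" unfolding c0_def by (rule bump_mass_pos[OF d])
  obtain B where B: "\<And>x. \<bar>\<rho> x\<bar> \<le> B" unfolding \<rho>_def using bump_bounded by blast
  have Hb: "\<bar>H x \<xi>\<bar> \<le> 2 * n1 * K" for x \<xi>
  proof -
    have "\<bar>moves h (w x) (b x) (\<lambda>v. u (x + \<xi> + v))\<bar> \<le> n1 * K"
      unfolding n1_def by (rule abs_moves_le[OF ub'])
    moreover have "\<bar>n1 * u (x + \<xi>)\<bar> \<le> n1 * K"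
      using ub'[of "x + \<xi>"] by (simp add: abs_mult n1_def mult_left_mono)
    moreover have "0 \<le> n1 * K" using K by (simp add: n1_def)
    ultimately show ?thesis unfolding H_def mult.assoc by (cases "x \<in> S") (simp_all del: abs_mult)
  qed
  have [measurable]: "(\<lambda>(x, \<xi>). H x \<xi>) \<in> borel_measurable (\<mu> \<Otimes>\<^sub>M bump_law d)"
    unfolding H_def moves_def by measurable
  have iH: "integrable (\<mu> \<Otimes>\<^sub>M bump_law d) (\<lambda>(x, \<xi>). H x \<xi>)"
    by (rule integrable_const_bound[of _ "2 * n1 * K"]) (use Hb in auto)
  then show "integrable (\<mu> \<Otimes>\<^sub>M bump_law d) (\<lambda>(x, \<xi>). potential_defect \<Sigma> b S h u x \<xi>)"
    by (simp add: potential_defect_def H_def weq n1_def)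
  have iu: "integrable (bump_law d) (\<lambda>\<xi>. u (y + \<xi>))" for y
    by (rule ka.integrable_const_bound[of _ K]) (use ub' in auto)
  have iul: "integrable lborel (\<lambda>z. u z * g z)" if "g \<in> borel_measurable borel" "\<And>z. \<bar>g z\<bar> \<le> C" for g :: "real^'n \<Rightarrow> real" and C
  proof (rule Bochner_Integration.integrable_bound)
    show "integrable lborel (\<lambda>z::real^'n. K * C * indicator (cball 0 P) z)"
      using emeasure_bounded_finite[OF bounded_cball] by (intro integrable_mult_right integrable_real_indicator) auto
    have "\<bar>u z * g z\<bar> \<le> \<bar>K * C * indicator (cball 0 P) z\<bar>" for z
    proof (cases "norm z \<le> P")
      case True
      have "\<bar>u z * g z\<bar> \<le> K * C" unfolding abs_mult using ub' that(2) K by (intro mult_mono) auto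
      then show ?thesis using True by simp
    qed (use ub(3)[of z] in simp)
    then show "AE z in lborel. norm (u z * g z) \<le> norm (K * C * indicator (cball 0 P) z)" by simp
  qed (use that in measurable)
  have inner: "(\<integral>\<xi>. H x \<xi> \<partial>bump_law d) = (\<integral>z. u z * F x z \<partial>lborel) / c0" for x
  proof -
    have U: "(\<integral>\<xi>. u (y + \<xi>) \<partial>bump_law d) = (\<integral>z. u z * \<rho> (y - z) \<partial>lborel) * (1 / c0)" for y
      unfolding \<rho>_def c0_def by (subst bump_law_integral[OF d]) auto
    have i\<rho>: "integrable lborel (\<lambda>z. u z * \<rho> (y - z))" for y
      by (rule iul) (use B in auto)
    have "(\<integral>\<xi>. H x \<xi> \<partial>bump_law d) = indicator S x * (moves h (w x) (b x) (\<lambda>v. \<integral>\<xi>. u (x + v + \<xi>) \<partial>bump_law d)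
        - n1 * (\<integral>\<xi>. u (x + \<xi>) \<partial>bump_law d))"
    proof -
      have "(\<lambda>\<xi>. H x \<xi>) = (\<lambda>\<xi>. indicator S x * (moves h (w x) (b x) (\<lambda>v. u (x + v + \<xi>)) - n1 * u (x + \<xi>)))"
        by (simp add: H_def add_ac)
      then show ?thesis
        using moves_diff_integral[of "bump_law d" "\<lambda>v \<xi>. u (x + v + \<xi>)" "\<lambda>\<xi>. u (x + \<xi>)", OF iu iu] by simp
    qed
    also have "\<dots> = indicator S x * (moves h (w x) (b x) (\<lambda>v. \<integral>z. u z * \<rho> (x + v - z) \<partial>lborel)
        - n1 * (\<integral>z. u z * \<rho> (x - z) \<partial>lborel)) / c0"
      unfolding U moves_cmult by (simp add: diff_divide_distrib right_diff_distrib)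
    also have "\<dots> = (\<integral>z. indicator S x * (moves h (w x) (b x) (\<lambda>v. u z * \<rho> (x + v - z)) - n1 * (u z * \<rho> (x - z))) \<partial>lborel) / c0"
      by (subst moves_diff_integral[of lborel "\<lambda>v z. u z * \<rho> (x + v - z)" "\<lambda>z. u z * \<rho> (x - z)", OF i\<rho> i\<rho>]) simp
    also have "\<dots> = (\<integral>z. u z * F x z \<partial>lborel) / c0"
    proof -
      have "moves h (w x) (b x) (\<lambda>v. u z * \<rho> (x + v - z)) = u z * moves h (w x) (b x) (\<lambda>v. \<rho> (x + v - z))" for z
        using moves_cmult[of h "w x" "b x" "\<lambda>v. \<rho> (x + v - z)" "u z"] by (simp only: mult.commute)
      then show ?thesis unfolding F_def by (simp add: algebra_simps)
    qed
    finally show ?thesis .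
  qed
  have Fb: "\<bar>F x z\<bar> \<le> 2 * n1 * B" for x z
  proof -
    have B0: "B \<ge> 0" using B[of 0] by linarith
    have "\<bar>moves h (w x) (b x) (\<lambda>v. \<rho> (x + v - z))\<bar> \<le> n1 * B"
      unfolding n1_def by (rule abs_moves_le[OF B])
    moreover have "\<bar>n1 * \<rho> (x - z)\<bar> \<le> n1 * B"
      using B[of "x - z"] by (simp add: abs_mult n1_def mult_left_mono)
    moreover have "0 \<le> n1 * B" using B0 by (simp add: n1_def)
    ultimately show ?thesis unfolding F_def mult.assoc by (cases "x \<in> S") (simp_all del: abs_mult)
  qed
  have Fm [measurable]: "(\<lambda>(x, z). F x z) \<in> borel_measurable (\<mu> \<Otimes>\<^sub>M lborel)"
    unfolding F_def moves_def by measurable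
  have "(\<integral>(x, \<xi>). H x \<xi> \<partial>(\<mu> \<Otimes>\<^sub>M bump_law d)) = (\<integral>x. (\<integral>\<xi>. H x \<xi> \<partial>bump_law d) \<partial>\<mu>)"
    using integral_fst'[OF iH] by simp
  also have "\<dots> = (\<integral>x. (\<integral>z. u z * F x z \<partial>lborel) \<partial>\<mu>) / c0" unfolding inner by simp
  also have "(\<integral>x. (\<integral>z. u z * F x z \<partial>lborel) \<partial>\<mu>) = (\<integral>z. (\<integral>x. u z * F x z \<partial>\<mu>) \<partial>lborel)"
  proof (rule ml.Fubini_integral[symmetric])
    have "integrable (\<mu> \<Otimes>\<^sub>M lborel) (\<lambda>\<omega>. K * (2 * n1 * B) * indicator (UNIV \<times> (cball 0 P :: (real^'n) set)) \<omega>)"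
    proof (intro integrable_mult_right integrable_real_indicator)
      have "emeasure (\<mu> \<Otimes>\<^sub>M lborel) (space \<mu> \<times> (cball 0 P :: (real^'n) set)) = emeasure \<mu> (space \<mu>) * emeasure lborel (cball 0 P :: (real^'n) set)"
        by (rule lborel.emeasure_pair_measure_Times) auto
      then show "emeasure (\<mu> \<Otimes>\<^sub>M lborel) (UNIV \<times> cball 0 P :: ((real^'n) \<times> (real^'n)) set) < \<infinity>"
        using emeasure_bounded_finite[OF bounded_cball] mu.emeasure_space_1 sets_eq_imp_space_eq[OF sb] by auto
    qed measurable
    then show "integrable (\<mu> \<Otimes>\<^sub>M lborel) (\<lambda>(x, z). u z * F x z)"
    proof (rule Bochner_Integration.integrable_bound)
      have "\<bar>u z * F x z\<bar> \<le> \<bar>K * (2 * n1 * B) * indicator (UNIV \<times> cball 0 P) (x, z)\<bar>" for x z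
      proof (cases "norm z \<le> P")
        case True
        have "\<bar>u z * F x z\<bar> \<le> K * (2 * n1 * B)" unfolding abs_mult[of "u z"] using ub' Fb K by (intro mult_mono) auto
        then show ?thesis using True by simp
      qed (use ub(3)[of z] in simp)
      then show "AE \<omega> in \<mu> \<Otimes>\<^sub>M lborel. norm (case \<omega> of (x, z) \<Rightarrow> u z * F x z) \<le> norm (K * (2 * n1 * B) * indicator (UNIV \<times> cball 0 P) \<omega>)"
        by (auto simp del: abs_mult)
    qed measurable
  qed
  also have "(\<integral>z. (\<integral>x. u z * F x z \<partial>\<mu>) \<partial>lborel) \<le> (\<integral>z. K * e * indicator (cball 0 P :: (real^'n) set) z \<partial>lborel)"
  proof (rule integral_mono)
    have Ib: "\<bar>\<integral>x. F x z \<partial>\<mu>\<bar> \<le> e" if "norm z \<le> P" for z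
      using small[OF that] by (simp add: kernel_defect_def F_def weq n1_def \<rho>_def)
    have Ib': "\<bar>\<integral>x. F x z \<partial>\<mu>\<bar> \<le> 2 * n1 * B" for z
      by (rule order_trans[OF integral_abs_bound])
        (use Fb in \<open>auto intro!: mu.integral_le_const mu.integrable_const_bound[of _ "2 * n1 * B"]\<close>)
    have [measurable]: "(\<lambda>z. \<integral>x. F x z \<partial>\<mu>) \<in> borel_measurable borel"
      using mu.borel_measurable_lebesgue_integral[of "\<lambda>z x. F x z" lborel] Fm by measurable
    show "integrable lborel (\<lambda>z. \<integral>x. u z * F x z \<partial>\<mu>)"
      using iul[of "\<lambda>z. \<integral>x. F x z \<partial>\<mu>" "2 * n1 * B"] Ib' by simp
    show "integrable lborel (\<lambda>z. K * e * indicator (cball 0 P :: (real^'n) set) z)"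
      using emeasure_bounded_finite[OF bounded_cball] by (intro integrable_mult_right integrable_real_indicator) auto
    show "(\<integral>x. u z * F x z \<partial>\<mu>) \<le> K * e * indicator (cball 0 P) z" for z
    proof (cases "norm z \<le> P")
      case True
      have "u z * (\<integral>x. F x z \<partial>\<mu>) \<le> \<bar>u z\<bar> * \<bar>\<integral>x. F x z \<partial>\<mu>\<bar>" by (metis abs_ge_self abs_mult)
      also have "\<dots> \<le> K * e" using ub' Ib[OF True] K by (intro mult_mono) auto
      finally show ?thesis using True by simp
    qed (use ub(3)[of z] in simp)
  qed
  also have "(\<integral>z. K * e * indicator (cball 0 P :: (real^'n) set) z \<partial>lborel) = K * measure lborel (cball 0 P :: (real^'n) set) * e"
    by simp
  finally show "(\<integral>(x, \<xi>). potential_defect \<Sigma> b S h u x \<xi> \<partial>(\<mu> \<Otimes>\<^sub>M bump_law d)) \<le> K * measure lborel (cball 0 P :: (real^'n) set) * e / bump_mass d TYPE('n)"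
    using c0 by (simp add: potential_defect_def H_def weq n1_def c0_def divide_right_mono)
qed

section \<open>Coupled moves\<close>

text \<open>With columns and drift set to zero outside S, a step leaves such a point in place, so
  its potential has no defect. The price appears in the coupled cost, when one point of a pair moves
  and the other does not.\<close>

definition freeze :: "'a set \<Rightarrow> ('a \<Rightarrow> 'b::real_vector) \<Rightarrow> 'a \<Rightarrow> 'b" where
  "freeze S f x = (if x \<in> S then f x else 0)"

lemma moves_zero:
  fixes f :: "'a::real_vector \<Rightarrow> real"
  shows "moves h (\<lambda>k::'m::finite. 0) 0 f = (2 * CARD('m) + 1) * f 0"
  by (simp add: moves_def algebra_simps)

lemma moves_freeze:
  fixes \<sigma> :: "'a::real_vector \<Rightarrow> 'm::finite \<Rightarrow> 'a" and f :: "'a \<Rightarrow> real"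
  shows "moves h (\<lambda>k. freeze S (\<lambda>x. \<sigma> x k) x) (freeze S b x) f
    = (2 * CARD('m) + 1) * f 0 + indicator S x * (moves h (\<sigma> x) (b x) f - (2 * CARD('m) + 1) * f 0)"
  by (cases "x \<in> S") (simp_all add: freeze_def moves_zero)

lemma moves_mono: "(\<And>v. f v \<le> g v) \<Longrightarrow> moves h w \<beta> f \<le> moves h w \<beta> g"
  unfolding moves_def by (intro add_mono sum_mono)

lemma moves_add: "moves h w \<beta> (\<lambda>v. f v + g v) = moves h w \<beta> f + moves h w \<beta> g"
  by (simp add: moves_def sum.distrib algebra_simps)

lemma moves_const:
  fixes w :: "'m::finite \<Rightarrow> 'a::real_vector" and c :: real
  shows "moves h w \<beta> (\<lambda>_. c) = (2 * CARD('m) + 1) * c"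
  by (simp add: moves_def algebra_simps)

lemma moves_sum: "moves h w \<beta> (\<lambda>v. \<Sum>i\<in>I. f i v) = (\<Sum>i\<in>I. moves h w \<beta> (f i))"
proof -
  have "moves h w \<beta> (\<lambda>_. 0) = 0" by (simp add: moves_def)
  then show ?thesis by (induction I rule: infinite_finite_induct) (simp_all add: moves_add)
qed

lemma moves_pair:
  "moves h (\<lambda>k. (w k, w' k)) (\<beta>, \<beta>') f
    = (\<Sum>k\<in>UNIV. f (h *\<^sub>R w k, h *\<^sub>R w' k) + f (- (h *\<^sub>R w k), - (h *\<^sub>R w' k))) + f (h\<^sup>2 *\<^sub>R \<beta>, h\<^sup>2 *\<^sub>R \<beta>')"
  by (simp add: moves_def)

text \<open>X and Y are the stationary points, which determine the coefficients; x and y are their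
  mollified positions. The improved potentials are the step sums of u and v plus A and B, divided by
  2 m + 1. As both coordinates use the same increment index, summing D \<le> u + v over the step and
  applying \<open>incr\<close> reproduces the constraint. Stationarity bounds the change of each
  mean, and \<open>neg\<close> makes the total change a fixed negative amount.\<close>

lemma no_uniform_gain:
  fixes \<Sigma> :: "real^'n::finite \<Rightarrow> real^'m::finite^'n" and D :: "real^'n \<Rightarrow> real^'n \<Rightarrow> real"
  defines "\<sigma> x k \<equiv> column k (\<Sigma> x)"
  defines "n1 \<equiv> real (2 * CARD('m) + 1)"
  assumes mu: "prob_space \<mu>" "sets \<mu> = sets borel" and nu: "prob_space \<nu>" "sets \<nu> = sets borel"
    and meas: "\<Sigma> \<in> borel_measurable borel" "b \<in> borel_measurable borel"
    and D1: "\<And>y. continuous_on UNIV (\<lambda>x. D x y)" and D2: "\<And>x. continuous_on UNIV (D x)"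
    and D: "\<And>x y. 0 \<le> D x y" "\<And>x y. D x y \<le> K"
    and Dz: "\<And>x y. P \<le> norm x \<or> P \<le> norm y \<Longrightarrow> D x y = 0"
    and d: "d > 0" "real CARD('n) * d \<le> \<delta>" and S: "S \<in> sets borel"
    and small: "\<And>M z. M \<in> {\<mu>, \<nu>} \<Longrightarrow> norm z \<le> P \<Longrightarrow> \<bar>\<integral>x. kernel_defect \<Sigma> b d S h z x \<partial>M\<bar> \<le> e"
    and A: "integrable \<mu> A" and B: "integrable \<nu> B" "\<And>x. - c \<le> B x"
    and incr: "\<And>X x Y y. norm (x - X) \<le> \<delta> \<Longrightarrow> norm (y - Y) \<le> \<delta> \<Longrightarrow>
      n1 * D x y - (A X + B Y)
      \<le> moves h (\<lambda>k. (freeze S (\<lambda>x. \<sigma> x k) X, freeze S (\<lambda>x. \<sigma> x k) Y)) (freeze S b X, freeze S b Y)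
          (\<lambda>v. D (x + fst v) (y + snd v))"
    and neg: "2 * (K * measure lborel (cball 0 P :: (real^'n) set) * e / bump_mass d TYPE('n))
      + integral\<^sup>L \<mu> A + integral\<^sup>L \<nu> B < 0"
  shows False
proof -
  interpret mu: prob_space \<mu> by (rule mu)
  interpret nu: prob_space \<nu> by (rule nu)
  interpret ka: prob_space "bump_law d :: (real^'n) measure" by (rule bump_law_prob[OF d(1)])
  interpret muka: pair_prob_space \<mu> "bump_law d :: (real^'n) measure" ..
  interpret nuka: pair_prob_space \<nu> "bump_law d :: (real^'n) measure" ..
  note [measurable_cong] = mu(2) nu(2)
  define \<kappa> :: "(real^'n) measure" where "\<kappa> = bump_law d"
  have n1: "n1 > 0" by (simp add: n1_def)
  define c1 where "c1 = K * measure lborel (cball 0 P :: (real^'n) set) * e / bump_mass d TYPE('n)"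
  \<comment> \<open>The defect bound \<open>c1\<close> is incurred once for each marginal; the
    division by \<open>n1\<close> reflects that the new potentials are means over the step.\<close>
  define \<gamma> where "\<gamma> = - (2 * c1 + integral\<^sup>L \<mu> A + integral\<^sup>L \<nu> B) / n1"
  have \<gamma>: "\<gamma> > 0" using neg n1 by (auto simp: \<gamma>_def c1_def intro!: divide_pos_pos)
  \<comment> \<open>The displacement is bounded by \<delta> only almost surely, whereas the
    constraint is needed pointwise; this is the set of full measure on which it is imposed.\<close>
  define G where "G = {\<omega> :: (real^'n) \<times> (real^'n). norm (snd \<omega>) \<le> \<delta>}"
  define x1 where "x1 \<omega> = fst \<omega> + snd \<omega>" for \<omega> :: "(real^'n) \<times> (real^'n)"
  have x1m: "x1 \<in> borel_measurable (M \<Otimes>\<^sub>M \<kappa>)" if [measurable_cong]: "sets M = sets borel" for M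
    unfolding x1_def[abs_def] \<kappa>_def by measurable
  have AEG: "AE \<omega> in M \<Otimes>\<^sub>M \<kappa>. \<omega> \<in> G" if "prob_space M" and [measurable_cong]: "sets M = sets borel" for M
  proof -
    interpret M: prob_space M by fact
    interpret pair_prob_space M "bump_law d :: (real^'n) measure" ..
    have "AE \<xi> in \<kappa>. norm \<xi> \<le> \<delta>"
      using bump_law_AE[of d, where 'n = 'n] unfolding \<kappa>_def by eventually_elim (use d(2) in linarith)
    then have "AE x in M. AE \<xi> in \<kappa>. (x, \<xi>) \<in> G" by (simp add: G_def)
    moreover have "{\<omega> \<in> space (M \<Otimes>\<^sub>M \<kappa>). \<omega> \<in> G} \<in> sets (M \<Otimes>\<^sub>M \<kappa>)"
      unfolding G_def \<kappa>_def by measurable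
    ultimately show ?thesis
      unfolding \<kappa>_def using AE_pair_measure[of "\<lambda>\<omega>. \<omega> \<in> G"] by simp
  qed
  define T where "T u M \<omega> = indicator S (fst \<omega>) *
      (moves h (\<sigma> (fst \<omega>)) (b (fst \<omega>)) (\<lambda>v. u (x1 \<omega> + v)) - n1 * u (x1 \<omega>))"
    for u :: "real^'n \<Rightarrow> real" and M :: "(real^'n) measure" and \<omega>
  define imp where "imp u A \<omega> = u (x1 \<omega>) + (T u \<mu> \<omega> + A (fst \<omega>)) / n1" for u A \<omega>
  have sg: "\<sigma> x = (\<lambda>k. column k (\<Sigma> x))" for x by (simp add: \<sigma>_def fun_eq_iff)
  have key: "integrable (M \<Otimes>\<^sub>M \<kappa>) (imp u A)
      \<and> integral\<^sup>L (M \<Otimes>\<^sub>M \<kappa>) (imp u A) \<le> (\<integral>\<omega>. u (x1 \<omega>) \<partial>(M \<Otimes>\<^sub>M \<kappa>)) + (c1 + integral\<^sup>L M A) / n1"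
    if M: "M \<in> {\<mu>, \<nu>}" and u: "potential K P u" and A: "integrable M A" for M u A
  proof -
    have pM: "prob_space M" and sM [measurable_cong]: "sets M = sets borel" using M mu nu by auto
    interpret M: prob_space M by fact
    interpret pair_prob_space M "bump_law d :: (real^'n) measure" ..
    have Teq: "T u \<mu> = (\<lambda>(x, \<xi>). potential_defect \<Sigma> b S h u x \<xi>)"
      by (auto simp: potential_defect_def T_def x1_def sg n1_def fun_eq_iff)
    have T: "integrable (M \<Otimes>\<^sub>M \<kappa>) (T u \<mu>)" "integral\<^sup>L (M \<Otimes>\<^sub>M \<kappa>) (T u \<mu>) \<le> c1"
      unfolding Teq \<kappa>_def c1_def
      using potential_moves_small[OF pM sM meas d(1) u S small[OF M]] by blast+
    have U: "integrable (M \<Otimes>\<^sub>M \<kappa>) (\<lambda>\<omega>. u (x1 \<omega>))"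
      by (rule potential_integrable[OF _ u x1m[OF sM]]) (simp add: \<kappa>_def, unfold_locales)
    have iA: "integrable (M \<Otimes>\<^sub>M \<kappa>) (\<lambda>\<omega>. A (fst \<omega>))"
    proof -
      have "integrable (distr (M \<Otimes>\<^sub>M \<kappa>) M fst) A" using A by (simp add: \<kappa>_def ka.distr_pair_fst)
      then show ?thesis by (subst (asm) integrable_distr_eq) (use A in auto)
    qed
    have "(\<integral>\<omega>. A (fst \<omega>) \<partial>(M \<Otimes>\<^sub>M \<kappa>)) = integral\<^sup>L (distr (M \<Otimes>\<^sub>M \<kappa>) M fst) A"
      using A by (subst integral_distr) auto
    also have "\<dots> = integral\<^sup>L M A" by (simp add: \<kappa>_def ka.distr_pair_fst)
    finally have "integral\<^sup>L (M \<Otimes>\<^sub>M \<kappa>) (imp u A)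
        = (\<integral>\<omega>. u (x1 \<omega>) \<partial>(M \<Otimes>\<^sub>M \<kappa>)) + (integral\<^sup>L (M \<Otimes>\<^sub>M \<kappa>) (T u \<mu>) + integral\<^sup>L M A) / n1"
      unfolding imp_def[abs_def] using T U iA by simp
    moreover have "integrable (M \<Otimes>\<^sub>M \<kappa>) (imp u A)"
      unfolding imp_def[abs_def] using T U iA by simp
    ultimately show ?thesis
      using T(2) n1 by (auto intro!: divide_right_mono)
  qed
  have scale: "n1 * (r + s / n1) = n1 * r + s" for r s using n1 by (simp add: distrib_left)
  have rep: "n1 * imp u A \<omega> = moves h (\<lambda>k. freeze S (\<lambda>x. \<sigma> x k) (fst \<omega>)) (freeze S b (fst \<omega>)) (\<lambda>v. u (x1 \<omega> + v)) + A (fst \<omega>)"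
    for u A \<omega>
    using n1 moves_freeze[of h S \<sigma> "fst \<omega>" b "\<lambda>v. u (x1 \<omega> + v)", folded n1_def]
    unfolding imp_def T_def scale by simp
  show False
  proof (rule dual_cost_not_uniformly_improvable[where ?M1.0 = "\<mu> \<Otimes>\<^sub>M \<kappa>" and ?M2.0 = "\<nu> \<Otimes>\<^sub>M \<kappa>"
        and ?x1.0 = x1 and ?x2.0 = x1 and ?G1.0 = G and ?G2.0 = G, OF _ _ _ _ _ _ D1 D2 D Dz \<gamma>])
    show "prob_space (\<mu> \<Otimes>\<^sub>M \<kappa>)" "prob_space (\<nu> \<Otimes>\<^sub>M \<kappa>)"
      unfolding \<kappa>_def by unfold_locales
    show "x1 \<in> borel_measurable (\<mu> \<Otimes>\<^sub>M \<kappa>)" "x1 \<in> borel_measurable (\<nu> \<Otimes>\<^sub>M \<kappa>)" using x1m mu nu by auto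
    show "AE \<omega> in \<mu> \<Otimes>\<^sub>M \<kappa>. \<omega> \<in> G" "AE \<omega> in \<nu> \<Otimes>\<^sub>M \<kappa>. \<omega> \<in> G" using AEG mu nu by auto
  next
    fix u v assume u: "potential K P u" and v: "potential K P v" and uv: "\<And>x y. D x y \<le> u x + v y"
    have v0: "0 \<le> v y" for y using v by (simp add: potential_def)
    \<comment> \<open>This keeps the suprema in the c-transform finite.\<close>
    have lb: "- (c / n1) \<le> imp v B \<omega>" for \<omega>
    proof -
      have "0 \<le> moves h (\<lambda>k. freeze S (\<lambda>x. \<sigma> x k) (fst \<omega>)) (freeze S b (fst \<omega>)) (\<lambda>y. v (x1 \<omega> + y))"
        unfolding moves_def using v0 by (intro add_nonneg_nonneg sum_nonneg) auto
      then have "- c \<le> n1 * imp v B \<omega>" unfolding rep using B(2)[of "fst \<omega>"] by linarith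
      then show ?thesis using n1 by (simp add: field_simps)
    qed
    have con: "D (x1 \<omega>1) (x1 \<omega>2) \<le> imp u A \<omega>1 + imp v B \<omega>2" if "\<omega>1 \<in> G" "\<omega>2 \<in> G" for \<omega>1 \<omega>2
    proof -
      let ?X = "fst \<omega>1" and ?Y = "fst \<omega>2"
      have "n1 * D (x1 \<omega>1) (x1 \<omega>2) - (A ?X + B ?Y)
        \<le> moves h (\<lambda>k. (freeze S (\<lambda>x. \<sigma> x k) ?X, freeze S (\<lambda>x. \<sigma> x k) ?Y)) (freeze S b ?X, freeze S b ?Y)
          (\<lambda>v. D (x1 \<omega>1 + fst v) (x1 \<omega>2 + snd v))"
        by (rule incr) (use that in \<open>auto simp: G_def x1_def\<close>)
      also have "\<dots> \<le> moves h (\<lambda>k. (freeze S (\<lambda>x. \<sigma> x k) ?X, freeze S (\<lambda>x. \<sigma> x k) ?Y)) (freeze S b ?X, freeze S b ?Y)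
          (\<lambda>w. u (x1 \<omega>1 + fst w) + v (x1 \<omega>2 + snd w))"
        by (rule moves_mono[OF uv])
      also have "\<dots> = moves h (\<lambda>k. freeze S (\<lambda>x. \<sigma> x k) ?X) (freeze S b ?X) (\<lambda>w. u (x1 \<omega>1 + w))
          + moves h (\<lambda>k. freeze S (\<lambda>x. \<sigma> x k) ?Y) (freeze S b ?Y) (\<lambda>w. v (x1 \<omega>2 + w))"
        unfolding moves_pair by (simp add: moves_def sum.distrib)
      finally have "n1 * D (x1 \<omega>1) (x1 \<omega>2) \<le> n1 * imp u A \<omega>1 + n1 * imp v B \<omega>2"
        unfolding rep by linarith
      then show ?thesis using n1 by (simp add: distrib_left[symmetric])
    qed
    have "integral\<^sup>L (\<mu> \<Otimes>\<^sub>M \<kappa>) (imp u A) + integral\<^sup>L (\<nu> \<Otimes>\<^sub>M \<kappa>) (imp v B)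
      \<le> (\<integral>\<omega>. u (x1 \<omega>) \<partial>(\<mu> \<Otimes>\<^sub>M \<kappa>)) + (c1 + integral\<^sup>L \<mu> A) / n1 + ((\<integral>\<omega>. v (x1 \<omega>) \<partial>(\<nu> \<Otimes>\<^sub>M \<kappa>)) + (c1 + integral\<^sup>L \<nu> B) / n1)"
      using key[of \<mu> u A] key[of \<nu> v B] u v A B by (intro add_mono) auto
    also have "\<dots> = (\<integral>\<omega>. u (x1 \<omega>) \<partial>(\<mu> \<Otimes>\<^sub>M \<kappa>)) + (\<integral>\<omega>. v (x1 \<omega>) \<partial>(\<nu> \<Otimes>\<^sub>M \<kappa>)) - \<gamma>"
      by (simp add: \<gamma>_def add_divide_distrib diff_divide_distrib)
    finally show "\<exists>u' v' c. integrable (\<mu> \<Otimes>\<^sub>M \<kappa>) u' \<and> integrable (\<nu> \<Otimes>\<^sub>M \<kappa>) v' \<and> (\<forall>\<omega>\<in>G. - c \<le> v' \<omega>)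
        \<and> (\<forall>\<omega>1\<in>G. \<forall>\<omega>2\<in>G. D (x1 \<omega>1) (x1 \<omega>2) \<le> u' \<omega>1 + v' \<omega>2)
        \<and> integral\<^sup>L (\<mu> \<Otimes>\<^sub>M \<kappa>) u' + integral\<^sup>L (\<nu> \<Otimes>\<^sub>M \<kappa>) v'
          \<le> (\<integral>\<omega>. u (x1 \<omega>) \<partial>(\<mu> \<Otimes>\<^sub>M \<kappa>)) + (\<integral>\<omega>. v (x1 \<omega>) \<partial>(\<nu> \<Otimes>\<^sub>M \<kappa>)) - \<gamma>"
      using key[of \<mu> u A] key[of \<nu> v B] u v A B lb con
      by (intro exI[of _ "imp u A"] exI[of _ "imp v B"] exI[of _ "c / n1"]) auto
  qed
qed

section \<open>The multi-scale cost\<close>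

definition coef_norm :: "('m::finite \<Rightarrow> 'a::real_normed_vector) \<Rightarrow> 'a \<Rightarrow> real" where
  "coef_norm w \<beta> = (\<Sum>k\<in>UNIV. (norm (w k))\<^sup>2) + norm \<beta>"

text \<open>The coefficient of h^4 in \<open>log_quad_moves_le\<close>.\<close>

definition fourth_order :: "real \<Rightarrow> ('m::finite \<Rightarrow> 'a::real_normed_vector) \<Rightarrow> 'a \<Rightarrow> real" where
  "fourth_order e w \<beta> = (\<Sum>k\<in>UNIV. (norm (w k)) ^ 4) / e\<^sup>2 + (norm \<beta>)\<^sup>2 / e"

text \<open>Because of the two confining terms, the minimum of \<open>cost\<close> and a number \<open>K\<close> equals \<open>K\<close> outside a
  compact set. No cutoff function is needed, hence there are no cross terms in the generator.\<close>

definition cost :: "real \<Rightarrow> nat \<Rightarrow> real \<Rightarrow> 'a::real_inner \<Rightarrow> 'a \<Rightarrow> real" where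
  "cost e N R x y = (\<Sum>i<N. log_quad (e / 2 ^ i) (x - y) - ln (e / 2 ^ i)) / N
     + (log_quad (R\<^sup>2) x - ln (R\<^sup>2)) + (log_quad (R\<^sup>2) y - ln (R\<^sup>2))"

text \<open>The generator of the pair driven by common noise, applied to \<open>cost\<close>. The
  terms in x - y see only differences of the coefficients, because both points share the
  noise.\<close>

definition gen_cost :: "real \<Rightarrow> nat \<Rightarrow> real \<Rightarrow> ('m::finite \<Rightarrow> 'a::real_inner) \<Rightarrow> ('m \<Rightarrow> 'a) \<Rightarrow> 'a \<Rightarrow> 'a \<Rightarrow> 'a \<Rightarrow> 'a \<Rightarrow> real" where
  "gen_cost e N R w w' \<beta> \<beta>' x y = (\<Sum>i<N. gen_log (e / 2 ^ i) (\<lambda>k. w k - w' k) (\<beta> - \<beta>') (x - y)) / N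
     + gen_log (R\<^sup>2) w \<beta> x + gen_log (R\<^sup>2) w' \<beta>' y"

definition fourth_order_cost :: "real \<Rightarrow> nat \<Rightarrow> real \<Rightarrow> ('m::finite \<Rightarrow> 'a::real_inner) \<Rightarrow> ('m \<Rightarrow> 'a) \<Rightarrow> 'a \<Rightarrow> 'a \<Rightarrow> real" where
  "fourth_order_cost e N R w w' \<beta> \<beta>' = (\<Sum>i<N. fourth_order (e / 2 ^ i) (\<lambda>k. w k - w' k) (\<beta> - \<beta>')) / N
     + fourth_order (R\<^sup>2) w \<beta> + fourth_order (R\<^sup>2) w' \<beta>'"

lemma coef_norm_nonneg: "0 \<le> coef_norm w \<beta>"
  by (auto simp: coef_norm_def intro!: add_nonneg_nonneg sum_nonneg)

lemma coef_norm_diff_le: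
  "coef_norm (\<lambda>k. w k - w' k) (\<beta> - \<beta>') \<le> 2 * (coef_norm w \<beta> + coef_norm w' \<beta>')"
proof -
  have "(norm (w k - w' k))\<^sup>2 \<le> 2 * (norm (w k))\<^sup>2 + 2 * (norm (w' k))\<^sup>2" for k
  proof -
    have "(norm (w k - w' k))\<^sup>2 \<le> (norm (w k) + norm (w' k))\<^sup>2"
      by (intro power_mono norm_triangle_ineq4) auto
    also have "\<dots> \<le> 2 * (norm (w k))\<^sup>2 + 2 * (norm (w' k))\<^sup>2"
      using zero_le_power2[of "norm (w k) - norm (w' k)"] by (simp add: power2_eq_square algebra_simps)
    finally show ?thesis .
  qed
  then have "(\<Sum>k\<in>UNIV. (norm (w k - w' k))\<^sup>2) \<le> (\<Sum>k\<in>UNIV. 2 * (norm (w k))\<^sup>2 + 2 * (norm (w' k))\<^sup>2)"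
    by (intro sum_mono)
  also have "\<dots> = 2 * (\<Sum>k\<in>UNIV. (norm (w k))\<^sup>2) + 2 * (\<Sum>k\<in>UNIV. (norm (w' k))\<^sup>2)"
    by (simp add: sum.distrib sum_distrib_left)
  finally have "(\<Sum>k\<in>UNIV. (norm (w k - w' k))\<^sup>2) \<le> 2 * (\<Sum>k\<in>UNIV. (norm (w k))\<^sup>2) + 2 * (\<Sum>k\<in>UNIV. (norm (w' k))\<^sup>2)" .
  moreover have "norm (\<beta> - \<beta>') \<le> 2 * norm \<beta> + 2 * norm \<beta>'"
    using norm_triangle_ineq4[of \<beta> \<beta>'] norm_ge_zero[of \<beta>] norm_ge_zero[of \<beta>'] by linarith
  ultimately show ?thesis unfolding coef_norm_def distrib_left by (rule add_mono[THEN order_trans]) simp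
qed

lemma fourth_order_le:
  assumes "e > 0"
  shows "fourth_order e w \<beta> \<le> (coef_norm w \<beta>)\<^sup>2 * (1 / e\<^sup>2 + 1 / e)"
proof -
  define W where "W = (\<Sum>k\<in>UNIV. (norm (w k))\<^sup>2)"
  have "(\<Sum>k\<in>UNIV. (norm (w k)) ^ 4) \<le> (\<Sum>k\<in>UNIV. (norm (w k))\<^sup>2 * W)"
  proof (rule sum_mono)
    fix k
    have "(norm (w k))\<^sup>2 \<le> W" unfolding W_def by (rule member_le_sum) auto
    then have "(norm (w k))\<^sup>2 * (norm (w k))\<^sup>2 \<le> (norm (w k))\<^sup>2 * W" by (intro mult_left_mono) auto
    then show "(norm (w k)) ^ 4 \<le> (norm (w k))\<^sup>2 * W" by (simp add: power_add[symmetric])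
  qed
  also have "\<dots> = W\<^sup>2" by (simp add: W_def sum_distrib_right[symmetric] power2_eq_square)
  also have "\<dots> \<le> (coef_norm w \<beta>)\<^sup>2"
    by (intro power_mono) (auto simp: W_def coef_norm_def sum_nonneg)
  finally have 1: "(\<Sum>k\<in>UNIV. (norm (w k)) ^ 4) \<le> (coef_norm w \<beta>)\<^sup>2" .
  have 2: "(norm \<beta>)\<^sup>2 \<le> (coef_norm w \<beta>)\<^sup>2"
    by (intro power_mono) (auto simp: coef_norm_def sum_nonneg)
  have "fourth_order e w \<beta> \<le> (coef_norm w \<beta>)\<^sup>2 / e\<^sup>2 + (coef_norm w \<beta>)\<^sup>2 / e"
    unfolding fourth_order_def using 1 2 assms by (intro add_mono divide_right_mono) auto
  then show ?thesis by (simp add: distrib_left)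
qed

lemma cost_moves_le:
  fixes w w' :: "'m::finite \<Rightarrow> 'a::real_inner"
  assumes e: "e > 0" and R: "R > 0"
  shows "moves h (\<lambda>k. (w k, w' k)) (\<beta>, \<beta>') (\<lambda>v. cost e N R (x + fst v) (y + snd v)) - (2 * CARD('m) + 1) * cost e N R x y
    \<le> h\<^sup>2 * gen_cost e N R w w' \<beta> \<beta>' x y + h ^ 4 * fourth_order_cost e N R w w' \<beta> \<beta>'"
proof -
  define n1 where "n1 = real (2 * CARD('m) + 1)"
  define L where "L i = moves h (\<lambda>k. w k - w' k) (\<beta> - \<beta>') (\<lambda>v. log_quad (e / 2 ^ i) (x - y + v))" for i
  have rep: "moves h (\<lambda>k. (w k, w' k)) (\<beta>, \<beta>') (\<lambda>v. log_quad (e / 2 ^ i) (x + fst v - (y + snd v))) = L i" for i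
    by (simp add: L_def moves_def algebra_simps)
  have rep1: "moves h (\<lambda>k. (w k, w' k)) (\<beta>, \<beta>') (\<lambda>v. log_quad a (x + fst v)) = moves h w \<beta> (\<lambda>v. log_quad a (x + v))" for a
    by (simp add: moves_def)
  have rep2: "moves h (\<lambda>k. (w k, w' k)) (\<beta>, \<beta>') (\<lambda>v. log_quad a (y + snd v)) = moves h w' \<beta>' (\<lambda>v. log_quad a (y + v))" for a
    by (simp add: moves_def)
  have csub: "moves h (\<lambda>k. (w k, w' k)) (\<beta>, \<beta>') (\<lambda>v. f v - c) = moves h (\<lambda>k. (w k, w' k)) (\<beta>, \<beta>') f - n1 * c" for f and c :: real
    using moves_add[of h "\<lambda>k. (w k, w' k)" "(\<beta>, \<beta>')" f "\<lambda>_. - c"] moves_const[of h "\<lambda>k. (w k, w' k)" "(\<beta>, \<beta>')" "- c"]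
    by (simp add: n1_def algebra_simps)
  have cdiv: "moves h (\<lambda>k. (w k, w' k)) (\<beta>, \<beta>') (\<lambda>v. f v / c) = moves h (\<lambda>k. (w k, w' k)) (\<beta>, \<beta>') f / c" for f and c :: real
    using moves_cmult[of h "\<lambda>k. (w k, w' k)" "(\<beta>, \<beta>')" f "1 / c"] by simp
  have "moves h (\<lambda>k. (w k, w' k)) (\<beta>, \<beta>') (\<lambda>v. cost e N R (x + fst v) (y + snd v))
      = (\<Sum>i<N. L i - n1 * ln (e / 2 ^ i)) / N + (moves h w \<beta> (\<lambda>v. log_quad (R\<^sup>2) (x + v)) - n1 * ln (R\<^sup>2))
        + (moves h w' \<beta>' (\<lambda>v. log_quad (R\<^sup>2) (y + v)) - n1 * ln (R\<^sup>2))"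
    unfolding cost_def by (simp add: moves_add cdiv moves_sum csub rep rep1 rep2)
  then have "moves h (\<lambda>k. (w k, w' k)) (\<beta>, \<beta>') (\<lambda>v. cost e N R (x + fst v) (y + snd v)) - n1 * cost e N R x y
      = (\<Sum>i<N. L i - n1 * log_quad (e / 2 ^ i) (x - y)) / N
        + (moves h w \<beta> (\<lambda>v. log_quad (R\<^sup>2) (x + v)) - n1 * log_quad (R\<^sup>2) x)
        + (moves h w' \<beta>' (\<lambda>v. log_quad (R\<^sup>2) (y + v)) - n1 * log_quad (R\<^sup>2) y)"
    by (simp add: cost_def sum_subtractf sum_distrib_left[symmetric] diff_divide_distrib algebra_simps)
  also have "\<dots> \<le> (\<Sum>i<N. h\<^sup>2 * gen_log (e / 2 ^ i) (\<lambda>k. w k - w' k) (\<beta> - \<beta>') (x - y)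
          + h ^ 4 * fourth_order (e / 2 ^ i) (\<lambda>k. w k - w' k) (\<beta> - \<beta>')) / N
        + (h\<^sup>2 * gen_log (R\<^sup>2) w \<beta> x + h ^ 4 * fourth_order (R\<^sup>2) w \<beta>)
        + (h\<^sup>2 * gen_log (R\<^sup>2) w' \<beta>' y + h ^ 4 * fourth_order (R\<^sup>2) w' \<beta>')"
    unfolding L_def n1_def fourth_order_def using e R
    by (intro add_mono divide_right_mono sum_mono log_quad_moves_le) auto
  also have "\<dots> = h\<^sup>2 * gen_cost e N R w w' \<beta> \<beta>' x y + h ^ 4 * fourth_order_cost e N R w w' \<beta> \<beta>'"
    by (simp add: gen_cost_def fourth_order_cost_def sum.distrib sum_distrib_left[symmetric] add_divide_distrib algebra_simps)
  finally show ?thesis by (simp add: n1_def)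
qed

lemma cost_nonneg:
  assumes "e > 0" "R > 0"
  shows "0 \<le> cost e N R x y"
proof -
  have "0 \<le> log_quad a z - ln a" if "a > 0" for a and z :: 'a
    using that by (auto simp: log_quad_def intro!: ln_mono)
  then show ?thesis unfolding cost_def using assms
    by (intro add_nonneg_nonneg divide_nonneg_nonneg sum_nonneg) auto
qed

lemma cost_ge_confining:
  assumes e: "e > 0" and R: "R > 0"
  shows "ln (1 + (norm x)\<^sup>2 / R\<^sup>2) \<le> cost e N R x y" "ln (1 + (norm y)\<^sup>2 / R\<^sup>2) \<le> cost e N R x y"
proof -
  have n: "0 \<le> log_quad a z - ln a" if "a > 0" for a and z :: 'a
    using that by (auto simp: log_quad_def intro!: ln_mono)
  have E: "ln (1 + (norm z)\<^sup>2 / R\<^sup>2) = log_quad (R\<^sup>2) z - ln (R\<^sup>2)" for z :: 'a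
  proof -
    have "1 + (norm z)\<^sup>2 / R\<^sup>2 = ((norm z)\<^sup>2 + R\<^sup>2) / R\<^sup>2" using R by (simp add: field_simps)
    then show ?thesis using R by (simp add: log_quad_def ln_div add_nonneg_pos)
  qed
  have "0 \<le> (\<Sum>i<N. log_quad (e / 2 ^ i) (x - y) - ln (e / 2 ^ i)) / N"
    using e by (intro divide_nonneg_nonneg sum_nonneg n) auto
  then show "ln (1 + (norm x)\<^sup>2 / R\<^sup>2) \<le> cost e N R x y" "ln (1 + (norm y)\<^sup>2 / R\<^sup>2) \<le> cost e N R x y"
    unfolding E cost_def using R n[of "R\<^sup>2" x] n[of "R\<^sup>2" y] by auto
qed

lemma continuous_cost:
  assumes e: "e > 0" and R: "R > 0"
  shows "continuous_on A (\<lambda>z. cost e N R (fst z) (snd z))"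
proof -
  have "(norm z)\<^sup>2 + a \<noteq> 0" if "a > 0" for a and z :: 'a using that
    by (metis add_nonneg_pos less_irrefl zero_le_power2)
  then show ?thesis unfolding cost_def log_quad_def divide_inverse using e R by (intro continuous_intros) auto
qed

definition profit :: "real \<Rightarrow> real \<Rightarrow> nat \<Rightarrow> real \<Rightarrow> 'a::real_inner \<Rightarrow> 'a \<Rightarrow> real" where
  "profit K e N R x y = max 0 (K - cost e N R x y)"

lemma coef_norm_freeze_le:
  assumes "\<And>x. x \<in> S \<Longrightarrow> coef_norm (\<sigma> x) (b x) \<le> M" "0 \<le> M"
  shows "coef_norm (\<lambda>k. freeze S (\<lambda>x. \<sigma> x k) x) (freeze S b x) \<le> M"
  using assms by (cases "x \<in> S") (simp_all add: freeze_def coef_norm_def)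

lemma coupled_increment:
  fixes \<sigma> :: "'a::real_inner \<Rightarrow> 'm::finite \<Rightarrow> 'a" and b :: "'a \<Rightarrow> 'a" and N :: nat
  assumes e: "e > 0" and R: "R > 0" and N: "N > 0" and M: "M \<ge> 0" and C: "C \<ge> 0" and \<eta>: "\<eta> \<ge> 0"
    and Q: "\<And>x. Q x = coef_norm (\<sigma> x) (b x)"
    and S: "S = {x. norm x \<le> P' \<and> Q x \<le> M}"
    and P: "\<And>x y :: 'a. cost e N R x y < K \<Longrightarrow> norm x \<le> P \<and> norm y \<le> P" "P + \<delta> \<le> P'"
    and unif: "\<And>a (w :: 'm \<Rightarrow> 'a) \<beta> z z'. a \<in> insert (R\<^sup>2) ((\<lambda>i. e / 2 ^ i) ` {..<N}) \<Longrightarrow> norm (z - z') \<le> 2 * \<delta> \<Longrightarrow>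
      gen_log a w \<beta> z \<le> gen_log a w \<beta> z' + \<eta> * coef_norm w \<beta>"
    and Cg: "\<And>a (w :: 'm \<Rightarrow> 'a) \<beta> z. a \<in> insert (R\<^sup>2) ((\<lambda>i. e / 2 ^ i) ` {..<N}) \<Longrightarrow> gen_log a w \<beta> z \<le> C * coef_norm w \<beta>"
    and four: "\<And>(w :: 'm \<Rightarrow> 'a) w' \<beta> \<beta>'. coef_norm w \<beta> \<le> M \<Longrightarrow> coef_norm w' \<beta>' \<le> M \<Longrightarrow> h\<^sup>2 * fourth_order_cost e N R w w' \<beta> \<beta>' \<le> \<eta>"
    and gain: "\<And>X Y. (\<Sum>i<N. gen_log (e / 2 ^ i) (\<lambda>k. \<sigma> X k - \<sigma> Y k) (b X - b Y) (X - Y)) / N \<le> L X + L Y - good X Y"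
    and L: "\<And>X. L X \<ge> 0" and W: "\<And>X. gen_log (R\<^sup>2) (\<sigma> X) (b X) X \<le> W X" "\<And>X. W X \<ge> 0"
    and good: "\<And>X Y. good X Y \<noteq> 0 \<Longrightarrow> X \<in> S \<and> Y \<in> S"
      "\<And>X Y x y. good X Y \<noteq> 0 \<Longrightarrow> norm (x - X) \<le> \<delta> \<Longrightarrow> norm (y - Y) \<le> \<delta> \<Longrightarrow> cost e N R x y < K"
    and A: "\<And>X. A X = L X + W X + 4 * \<eta> * (Q X * indicator (cball 0 P') X)
      + 2 * C * ((Q X * indicator (cball 0 P') X) * indicator {X. Q X > M} X) + \<eta>"
    and x: "norm (x - X) \<le> \<delta>" and y: "norm (y - Y) \<le> \<delta>"
  shows "real (2 * CARD('m) + 1) * profit K e N R x y - h\<^sup>2 * (A X + A Y - good X Y)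
    \<le> moves h (\<lambda>k. (freeze S (\<lambda>x. \<sigma> x k) X, freeze S (\<lambda>x. \<sigma> x k) Y)) (freeze S b X, freeze S b Y)
          (\<lambda>v. profit K e N R (x + fst v) (y + snd v))"
proof -
  define n1 where "n1 = real (2 * CARD('m) + 1)"
  define w w' where "w k = freeze S (\<lambda>x. \<sigma> x k) X" and "w' k = freeze S (\<lambda>x. \<sigma> x k) Y" for k
  define \<beta> \<beta>' where "\<beta> = freeze S b X" and "\<beta>' = freeze S b Y"
  have Q0: "Q z \<ge> 0" for z by (simp add: Q coef_norm_nonneg)
  have A0: "L z \<le> A z" "W z \<le> A z" "0 \<le> A z" for z
    using L[of z] W(2)[of z] Q0[of z] \<eta> C by (auto simp: A indicator_def)
  show ?thesis
  proof (cases "cost e N R x y < K")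
    case False
    then have "profit K e N R x y = 0" by (simp add: profit_def)
    moreover have "good X Y = 0" using good(2)[OF _ x y] False by blast
    moreover have "0 \<le> moves h (\<lambda>k. (w k, w' k)) (\<beta>, \<beta>') (\<lambda>v. profit K e N R (x + fst v) (y + snd v))"
      unfolding moves_def profit_def by (intro add_nonneg_nonneg sum_nonneg) auto
    moreover have "0 \<le> h\<^sup>2 * (A X + A Y)" using A0(3)[of X] A0(3)[of Y] by simp
    ultimately show ?thesis by (simp add: w_def w'_def \<beta>_def \<beta>'_def)
  next
    case True
    have nx: "norm x \<le> P" "norm y \<le> P" using P(1)[OF True] by simp_all
    then have nX: "norm X \<le> P'" "norm Y \<le> P'"
      using x y P(2) norm_triangle_sub[of X x] norm_triangle_sub[of Y y] by (auto simp: norm_minus_commute)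
    have cw: "coef_norm w \<beta> \<le> M" "coef_norm w' \<beta>' \<le> M"
      unfolding w_def w'_def \<beta>_def \<beta>'_def
      by (rule coef_norm_freeze_le; use S Q M in auto)+
    have shift: "norm (x - y - (X - Y)) \<le> 2 * \<delta>" "norm (x - X) \<le> 2 * \<delta>" "norm (y - Y) \<le> 2 * \<delta>"
    proof -
      have "norm (x - y - (X - Y)) \<le> norm (x - X) + norm (y - Y)"
        using norm_triangle_ineq4[of "x - X" "y - Y"] by (simp add: algebra_simps)
      then show "norm (x - y - (X - Y)) \<le> 2 * \<delta>" using x y by linarith
      show "norm (x - X) \<le> 2 * \<delta>" "norm (y - Y) \<le> 2 * \<delta>"
        using x y norm_ge_zero[of "x - X"] norm_ge_zero[of "y - Y"] by linarith+
    qed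
    let ?\<Delta> = "\<lambda>k. \<sigma> X k - \<sigma> Y k"
    have gc: "gen_cost e N R w w' \<beta> \<beta>' x y \<le> A X + A Y - 2 * \<eta> - good X Y"
    proof (cases "X \<in> S \<and> Y \<in> S")
      case True
      then have eq: "w = \<sigma> X" "w' = \<sigma> Y" "\<beta> = b X" "\<beta>' = b Y"
        by (auto simp: w_def w'_def \<beta>_def \<beta>'_def freeze_def)
      \<comment> \<open>The displacement costs 2 \<eta> Q per point in the multi-scale part, by
        \<open>coef_norm_diff_le\<close>, and another \<eta> Q per point in the confining part; the
        term 4 \<eta> Q of \<open>A\<close> covers this.\<close>
      define E where "E = \<eta> * (2 * (Q X + Q Y))"
      have "(\<Sum>i<N. gen_log (e / 2 ^ i) ?\<Delta> (b X - b Y) (x - y))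
          \<le> (\<Sum>i<N. gen_log (e / 2 ^ i) ?\<Delta> (b X - b Y) (X - Y) + E)"
      proof (rule sum_mono)
        fix i assume "i \<in> {..<N}"
        then have "gen_log (e / 2 ^ i) ?\<Delta> (b X - b Y) (x - y)
          \<le> gen_log (e / 2 ^ i) ?\<Delta> (b X - b Y) (X - Y) + \<eta> * coef_norm ?\<Delta> (b X - b Y)"
          by (intro unif shift) auto
        moreover have "\<eta> * coef_norm ?\<Delta> (b X - b Y) \<le> E"
          unfolding E_def Q using \<eta> by (intro mult_left_mono coef_norm_diff_le)
        ultimately show "gen_log (e / 2 ^ i) ?\<Delta> (b X - b Y) (x - y)
          \<le> gen_log (e / 2 ^ i) ?\<Delta> (b X - b Y) (X - Y) + E" by linarith
      qed
      then have "(\<Sum>i<N. gen_log (e / 2 ^ i) ?\<Delta> (b X - b Y) (x - y)) / N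
          \<le> (\<Sum>i<N. gen_log (e / 2 ^ i) ?\<Delta> (b X - b Y) (X - Y) + E) / N"
        by (intro divide_right_mono) auto
      also have "\<dots> = (\<Sum>i<N. gen_log (e / 2 ^ i) ?\<Delta> (b X - b Y) (X - Y)) / N + E"
        using N by (simp add: sum.distrib add_divide_distrib)
      also have "\<dots> \<le> L X + L Y - good X Y + E" using gain[of X Y] by simp
      finally have 1: "(\<Sum>i<N. gen_log (e / 2 ^ i) ?\<Delta> (b X - b Y) (x - y)) / N \<le> L X + L Y - good X Y + E" .
      have 2: "gen_log (R\<^sup>2) (\<sigma> X) (b X) x \<le> W X + \<eta> * Q X"
        using unif[of "R\<^sup>2" x X "\<sigma> X" "b X"] shift W(1)[of X] by (simp add: Q)
      have 3: "gen_log (R\<^sup>2) (\<sigma> Y) (b Y) y \<le> W Y + \<eta> * Q Y"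
        using unif[of "R\<^sup>2" y Y "\<sigma> Y" "b Y"] shift W(1)[of Y] by (simp add: Q)
      have 4: "L z + W z + 3 * (\<eta> * Q z) \<le> A z - \<eta>" if "norm z \<le> P'" for z
        using that mult_nonneg_nonneg[OF \<eta> Q0[of z]] mult_nonneg_nonneg[OF C Q0[of z]] by (auto simp: A indicator_def)
      have "gen_cost e N R w w' \<beta> \<beta>' x y \<le> (L X + W X + 3 * (\<eta> * Q X)) + (L Y + W Y + 3 * (\<eta> * Q Y)) - good X Y"
        using 1 2 3 by (simp add: gen_cost_def eq E_def algebra_simps)
      then show ?thesis using 4[OF nX(1)] 4[OF nX(2)] by linarith
    next
      case False
      then have g0: "good X Y = 0" using good(1) by blast
      \<comment> \<open>At most one of the two points moves, so the coefficients total at most M,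
        and M lies below Q at a frozen point of the ball of radius P'. The term of \<open>A\<close>
        at that point pays C M for the multi-scale part and C M for the confining part.\<close>
      have frz: "coef_norm w \<beta> + coef_norm w' \<beta>' \<le> M"
      proof (cases "X \<in> S")
        case True
        then have "coef_norm w' \<beta>' = 0" using False by (simp add: w'_def \<beta>'_def freeze_def coef_norm_def)
        then show ?thesis using cw by simp
      next
        case False
        then have "coef_norm w \<beta> = 0" by (simp add: w_def \<beta>_def freeze_def coef_norm_def)
        then show ?thesis using cw by simp
      qed
      have one: "(\<Sum>i<N. gen_log (e / 2 ^ i) (\<lambda>k. w k - w' k) (\<beta> - \<beta>') (x - y)) / N \<le> C * (coef_norm w \<beta> + coef_norm w' \<beta>')"
      proof -
        have d: "coef_norm (\<lambda>k. w k - w' k) (\<beta> - \<beta>') = coef_norm w \<beta> + coef_norm w' \<beta>'"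
          using False by (cases "X \<in> S") (auto simp: w_def w'_def \<beta>_def \<beta>'_def freeze_def coef_norm_def)
        have "(\<Sum>i<N. gen_log (e / 2 ^ i) (\<lambda>k. w k - w' k) (\<beta> - \<beta>') (x - y)) \<le> (\<Sum>i<N. C * (coef_norm w \<beta> + coef_norm w' \<beta>'))"
          unfolding d[symmetric] by (intro sum_mono Cg) auto
        then have "(\<Sum>i<N. gen_log (e / 2 ^ i) (\<lambda>k. w k - w' k) (\<beta> - \<beta>') (x - y)) / N
          \<le> (\<Sum>i<N. C * (coef_norm w \<beta> + coef_norm w' \<beta>')) / N"
          by (intro divide_right_mono) auto
        then show ?thesis using N by simp
      qed
      have two: "gen_log (R\<^sup>2) w \<beta> x + gen_log (R\<^sup>2) w' \<beta>' y \<le> C * (coef_norm w \<beta> + coef_norm w' \<beta>')"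
        using Cg[of "R\<^sup>2" w \<beta> x] Cg[of "R\<^sup>2" w' \<beta>' y] by (simp add: distrib_left)
      have gl: "gen_cost e N R w w' \<beta> \<beta>' x y \<le> 2 * C * (coef_norm w \<beta> + coef_norm w' \<beta>')"
        unfolding gen_cost_def using one two by linarith
      have "2 * C * (coef_norm w \<beta> + coef_norm w' \<beta>') \<le> 2 * C * M"
        using frz C by (intro mult_left_mono) auto
      moreover have "2 * C * M \<le> A z - \<eta>" if "z \<notin> S" "norm z \<le> P'" for z
      proof -
        have "Q z > M" using that by (simp add: S)
        then have "2 * C * M \<le> 2 * C * Q z" using C by (intro mult_left_mono) auto
        also have "\<dots> \<le> A z - \<eta>"
          using \<open>Q z > M\<close> that L[of z] W(2)[of z] mult_nonneg_nonneg[OF \<eta> Q0[of z]] by (simp add: A)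
        finally show ?thesis .
      qed
      moreover have "\<eta> \<le> A z" for z
        using L[of z] W(2)[of z] Q0[of z] \<eta> C by (auto simp: A indicator_def)
      ultimately show ?thesis using gl g0 nX False by (smt (verit))
    qed
    have fo: "h\<^sup>2 * fourth_order_cost e N R w w' \<beta> \<beta>' \<le> \<eta>" by (rule four[OF cw])
    have "n1 * profit K e N R x y - h\<^sup>2 * (A X + A Y - good X Y)
        \<le> n1 * (K - cost e N R x y) - (h\<^sup>2 * gen_cost e N R w w' \<beta> \<beta>' x y + h ^ 4 * fourth_order_cost e N R w w' \<beta> \<beta>')"
    proof -
      have "h\<^sup>2 * (gen_cost e N R w w' \<beta> \<beta>' x y + h\<^sup>2 * fourth_order_cost e N R w w' \<beta> \<beta>') \<le> h\<^sup>2 * (A X + A Y - good X Y)"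
        using gc fo \<eta> by (intro mult_left_mono) auto
      moreover have "h\<^sup>2 * (gen_cost e N R w w' \<beta> \<beta>' x y + h\<^sup>2 * fourth_order_cost e N R w w' \<beta> \<beta>')
          = h\<^sup>2 * gen_cost e N R w w' \<beta> \<beta>' x y + h ^ 4 * fourth_order_cost e N R w w' \<beta> \<beta>'"
        by (simp add: distrib_left mult.assoc[symmetric] power_add[symmetric])
      moreover have "profit K e N R x y = K - cost e N R x y" using True by (simp add: profit_def)
      ultimately show ?thesis by simp
    qed
    also have "\<dots> \<le> n1 * K - moves h (\<lambda>k. (w k, w' k)) (\<beta>, \<beta>') (\<lambda>v. cost e N R (x + fst v) (y + snd v))"
      using cost_moves_le[OF e R, of h w w' \<beta> \<beta>' N x y] by (simp add: n1_def algebra_simps)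
    also have "\<dots> = moves h (\<lambda>k. (w k, w' k)) (\<beta>, \<beta>') (\<lambda>v. K - cost e N R (x + fst v) (y + snd v))"
      by (simp add: moves_def n1_def sum_subtractf sum.distrib algebra_simps)
    also have "\<dots> \<le> moves h (\<lambda>k. (w k, w' k)) (\<beta>, \<beta>') (\<lambda>v. profit K e N R (x + fst v) (y + snd v))"
      by (rule moves_mono) (simp add: profit_def)
    finally show ?thesis by (simp add: n1_def w_def w'_def \<beta>_def \<beta>'_def)
  qed
qed

text \<open>\<open>neg\<close> is the inequality q < 2 r multiplied by |x - y|^2. It says that a
  certain function is negative on the compact set of pairs at distance at least d; by continuity it
  is bounded away from zero. This turns a pointwise strict inequality into one gain m for all small
  scales.\<close>

lemma uniform_gain_on_compacts:
  fixes \<sigma> :: "'a::euclidean_space \<Rightarrow> 'm::finite \<Rightarrow> 'a" and b :: "'a \<Rightarrow> 'a"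
  assumes K: "compact K1" "compact K2"
    and cont: "\<And>k. continuous_on K1 (\<lambda>x. \<sigma> x k)" "\<And>k. continuous_on K2 (\<lambda>x. \<sigma> x k)"
      "continuous_on K1 b" "continuous_on K2 b"
    and d: "d > 0"
    and neg: "\<And>x y. x \<noteq> y \<Longrightarrow> ((x - y) \<bullet> (b x - b y) + (\<Sum>k\<in>UNIV. (norm (\<sigma> x k - \<sigma> y k))\<^sup>2)) * (norm (x - y))\<^sup>2
        < 2 * (\<Sum>k\<in>UNIV. ((\<sigma> x k - \<sigma> y k) \<bullet> (x - y))\<^sup>2)"
  obtains m e0 where "m > 0" "e0 > 0"
    "\<And>e x y. 0 < e \<Longrightarrow> e \<le> e0 \<Longrightarrow> x \<in> K1 \<Longrightarrow> y \<in> K2 \<Longrightarrow> d \<le> norm (x - y) \<Longrightarrow>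
      gen_log e (\<lambda>k. \<sigma> x k - \<sigma> y k) (b x - b y) (x - y) \<le> - m"
proof -
  define G where "G = (K1 \<times> K2) \<inter> {z. d \<le> norm (fst z - snd z)}"
  have "closed {z :: 'a \<times> 'a. d \<le> norm (fst z - snd z)}"
    by (intro closed_Collect_le continuous_intros)
  then have G: "compact G" unfolding G_def by (intro compact_Int_closed compact_Times K)
  have GK: "fst ` G \<subseteq> K1" "snd ` G \<subseteq> K2" by (auto simp: G_def)
  have cs: "continuous_on G (\<lambda>z. \<sigma> (fst z) k)" "continuous_on G (\<lambda>z. \<sigma> (snd z) k)"
    "continuous_on G (\<lambda>z. b (fst z))" "continuous_on G (\<lambda>z. b (snd z))" for k
    by (rule continuous_on_compose2[OF cont(1) _ GK(1)] continuous_on_compose2[OF cont(2) _ GK(2)]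
        continuous_on_compose2[OF cont(3) _ GK(1)] continuous_on_compose2[OF cont(4) _ GK(2)];
        intro continuous_intros)+
  define q where "q z = (fst z - snd z) \<bullet> (b (fst z) - b (snd z)) + (\<Sum>k\<in>UNIV. (norm (\<sigma> (fst z) k - \<sigma> (snd z) k))\<^sup>2)" for z
  define \<psi> where "\<psi> z = q z * (norm (fst z - snd z))\<^sup>2 - 2 * (\<Sum>k\<in>UNIV. ((\<sigma> (fst z) k - \<sigma> (snd z) k) \<bullet> (fst z - snd z))\<^sup>2)" for z
  have cq: "continuous_on G q" unfolding q_def by (intro continuous_intros cs)
  have c\<psi>: "continuous_on G \<psi>" unfolding \<psi>_def by (intro continuous_intros cs cq)
  have \<psi>neg: "\<psi> z < 0" if "z \<in> G" for z
  proof -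
    have "fst z \<noteq> snd z" using that d by (auto simp: G_def)
    from neg[OF this] show ?thesis by (simp add: \<psi>_def q_def)
  qed
  obtain m0 where m0: "m0 > 0" "\<And>z. z \<in> G \<Longrightarrow> \<psi> z \<le> - m0"
  proof (cases "G = {}")
    case True
    then show ?thesis using that[of 1] by auto
  next
    case False
    then obtain z0 where "z0 \<in> G" "\<And>z. z \<in> G \<Longrightarrow> \<psi> z \<le> \<psi> z0"
      using continuous_attains_sup[OF G _ c\<psi>] by blast
    then show ?thesis using that[of "- \<psi> z0"] \<psi>neg by auto
  qed
  have bound: "\<exists>B\<ge>0. \<forall>z\<in>G. f z \<le> B" if "continuous_on G f" for f :: "'a \<times> 'a \<Rightarrow> real"
  proof -
    have "bounded (f ` G)" using G that by (intro compact_imp_bounded compact_continuous_image)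
    then obtain B where B: "\<And>z. z \<in> G \<Longrightarrow> \<bar>f z\<bar> \<le> B" unfolding bounded_iff by auto
    show ?thesis by (rule exI[of _ "max B 0"]) (use B in \<open>auto intro: order_trans[OF abs_ge_self] max.coboundedI1\<close>)
  qed
  obtain r where r: "r \<ge> 0" "\<And>z. z \<in> G \<Longrightarrow> q z \<le> r" using bound[OF cq] by blast
  have "continuous_on G (\<lambda>z. (norm (fst z - snd z))\<^sup>2)" by (intro continuous_intros)
  then obtain s where s: "s \<ge> 0" "\<And>z. z \<in> G \<Longrightarrow> (norm (fst z - snd z))\<^sup>2 \<le> s" using bound by blast
  \<comment> \<open>Chosen so that the perturbation q e caused by the regularization is at most half
    of m0; r + 1 keeps the denominator positive.\<close>
  define e0 where "e0 = min 1 (m0 / (2 * (r + 1)))"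
  have e0: "e0 > 0" "e0 \<le> 1" using m0 r by (auto simp: e0_def)
  have re: "r * e0 \<le> m0 / 2"
  proof -
    have "r * e0 \<le> (r + 1) * (m0 / (2 * (r + 1)))" using r m0 e0 by (intro mult_mono) (auto simp: e0_def)
    also have "\<dots> = m0 / 2" using r by (simp add: field_simps)
    finally show ?thesis .
  qed
  have "gen_log e (\<lambda>k. \<sigma> x k - \<sigma> y k) (b x - b y) (x - y) \<le> - m0 / (s + 1)\<^sup>2"
    if "0 < e" "e \<le> e0" "x \<in> K1" "y \<in> K2" "d \<le> norm (x - y)" for e x y
  proof (rule gen_log_le_neg[where ?e0.0 = e0 and d = "d\<^sup>2" and r = r])
    have z: "(x, y) \<in> G" using that by (simp add: G_def)
    show "0 < e" "e \<le> e0" by fact+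
    show "e \<le> 1" using that e0 by simp
    show "0 < d\<^sup>2" "d\<^sup>2 \<le> (norm (x - y))\<^sup>2" using d that by (auto intro: power_mono)
    show "(norm (x - y))\<^sup>2 \<le> s" using s(2)[OF z] by simp
    show "0 < m0" by (rule m0)
    show "q (x, y) * (norm (x - y))\<^sup>2 - 2 * (\<Sum>k\<in>UNIV. ((\<sigma> x k - \<sigma> y k) \<bullet> (x - y))\<^sup>2) \<le> - m0"
      using m0(2)[OF z] by (simp add: \<psi>_def)
    show "q (x, y) \<le> r" by (rule r(2)[OF z])
    show "r * e0 \<le> m0 / 2" by (rule re)
    show "0 \<le> r" by (rule r)
    show "q (x, y) = (x - y) \<bullet> (b x - b y) + (\<Sum>k\<in>UNIV. (norm (\<sigma> x k - \<sigma> y k))\<^sup>2)" by (simp add: q_def)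
  qed
  then show ?thesis using that[of "m0 / (s + 1)\<^sup>2" e0] m0(1) s(1) e0 by auto
qed

text \<open>The factor 4 is 2 from \<open>gen_log_le_scale_error\<close> times 2 from the dyadic
  sum. The mean is of order 1/N although a single scale may err by a fixed multiple of
  \<Lambda>.\<close>

lemma averaged_gain:
  fixes w :: "'m::finite \<Rightarrow> 'a::real_inner"
  assumes e: "e > 0" and \<Lambda>: "\<Lambda> \<ge> 0"
    and ql: "z \<bullet> \<beta> + (\<Sum>k\<in>UNIV. (norm (w k))\<^sup>2) \<le> \<Lambda> * (norm z)\<^sup>2"
    and qr: "z \<noteq> 0 \<Longrightarrow> (z \<bullet> \<beta> + (\<Sum>k\<in>UNIV. (norm (w k))\<^sup>2)) * (norm z)\<^sup>2 < 2 * (\<Sum>k\<in>UNIV. (w k \<bullet> z)\<^sup>2)"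
  shows "(\<Sum>i<N. gen_log (e / 2 ^ i) w \<beta> z) / real N \<le> 4 * \<Lambda> / real N"
proof -
  have "(\<Sum>i<N. gen_log (e / 2 ^ i) w \<beta> z)
      \<le> (\<Sum>i<N. 2 * \<Lambda> * ((norm z)\<^sup>2 * (e / 2 ^ i) / ((norm z)\<^sup>2 + e / 2 ^ i)\<^sup>2))"
    using e \<Lambda> ql qr by (intro sum_mono gen_log_le_scale_error[OF refl]) (auto simp: less_imp_le)
  also have "\<dots> = 2 * \<Lambda> * (\<Sum>i<N. (norm z)\<^sup>2 * (e / 2 ^ i) / ((norm z)\<^sup>2 + e / 2 ^ i)\<^sup>2)"
    by (simp only: sum_distrib_left)
  also have "\<dots> \<le> 2 * \<Lambda> * 2"
    using e \<Lambda> by (intro mult_left_mono dyadic_error_sum_le) auto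
  finally show ?thesis by (intro divide_right_mono) auto
qed

section \<open>Uniqueness\<close>

lemma column_diff: "column k (A - B) = column k A - column k B"
  by (simp add: column_def vec_eq_iff)

lemma q_fun_columns:
  fixes \<Sigma> :: "real^'n::finite \<Rightarrow> real^'m::finite^'n"
  shows "q_fun \<Sigma> b x y = (x - y) \<bullet> (b x - b y) + (\<Sum>k\<in>UNIV. (norm (column k (\<Sigma> x) - column k (\<Sigma> y)))\<^sup>2)"
proof -
  have "trace (W ** transpose W) = (norm W)\<^sup>2" for W :: "real^'m::finite^'n::finite"
    by (simp add: trace_def matrix_matrix_mult_def transpose_def norm_vec_def L2_set_def sum_nonneg power2_eq_square)
  then show ?thesis
    by (simp add: q_fun_def sum_norm_column[symmetric] column_diff)
qed

lemma r_fun_columns: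
  fixes \<Sigma> :: "real^'n::finite \<Rightarrow> real^'m::finite^'n"
  assumes "x \<noteq> y"
  shows "r_fun \<Sigma> x y * (norm (x - y))\<^sup>2 = (\<Sum>k\<in>UNIV. ((column k (\<Sigma> x) - column k (\<Sigma> y)) \<bullet> (x - y))\<^sup>2)"
proof -
  define c where "c = 1 / norm (x - y)"
  have comp: "(transpose W *v (c *\<^sub>R z)) $ k = c * (column k W \<bullet> z)" for W :: "real^'m::finite^'n::finite" and z k
    by (simp only: matrix_vector_mult_def transpose_def inner_vec_def column_def)
      (simp add: sum_distrib_left mult_ac)
  have "(norm v)\<^sup>2 = (\<Sum>k\<in>UNIV. (v $ k)\<^sup>2)" for v :: "real^'m"
    by (simp add: norm_vec_def L2_set_def sum_nonneg)
  then have "(norm (transpose W *v (c *\<^sub>R z)))\<^sup>2 = c\<^sup>2 * (\<Sum>k\<in>UNIV. (column k W \<bullet> z)\<^sup>2)" for W :: "real^'m::finite^'n::finite" and z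
    by (simp only: comp power_mult_distrib sum_distrib_left)
  moreover have "c\<^sup>2 * (norm (x - y))\<^sup>2 = 1" using assms by (simp add: c_def power_divide)
  ultimately show ?thesis
    unfolding r_fun_def c_def[symmetric] by (simp add: column_diff mult.commute mult.left_commute)
qed

text \<open>A majorant that is independent of R, obtained from n / (1 + n^2) \<le> 2 / (1 + n); it
  is four times the weight in the growth hypothesis on \<Sigma> and b.\<close>

lemma confining_weight_le:
  fixes s t :: "'a::real_normed_vector \<Rightarrow> real" and x :: 'a
  assumes R: "1 \<le> R" and nonneg: "\<And>x. s x \<ge> 0" "\<And>x. t x \<ge> 0"
  shows "\<bar>(2 * s x + 2 * norm x * t x) / (R\<^sup>2 + (norm x)\<^sup>2)\<bar>
    \<le> 4 * (s x / (1 + (norm x)\<^sup>2) + t x / (1 + norm x))"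
proof -
  define n where "n = norm x"
  have n: "n \<ge> 0" by (simp add: n_def)
  have R2: "1 \<le> R\<^sup>2" using R by simp
  have p: "0 < 1 + n\<^sup>2" "0 < R\<^sup>2 + n\<^sup>2" using R2 zero_le_power2[of n] by linarith+
  have "\<bar>(2 * s x + 2 * n * t x) / (R\<^sup>2 + n\<^sup>2)\<bar> = (2 * s x + 2 * n * t x) / (R\<^sup>2 + n\<^sup>2)"
    using nonneg[of x] n p by simp
  also have "\<dots> \<le> (2 * s x + 2 * n * t x) / (1 + n\<^sup>2)"
    using nonneg[of x] n p R2 by (intro divide_left_mono mult_pos_pos) auto
  also have "\<dots> = 2 * (s x / (1 + n\<^sup>2)) + 2 * t x * (n / (1 + n\<^sup>2))"
    by (simp add: add_divide_distrib)
  also have "\<dots> \<le> 4 * (s x / (1 + n\<^sup>2)) + 2 * t x * (2 / (1 + n))"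
  proof (intro add_mono mult_left_mono)
    have "n * (1 + n) \<le> 2 * (1 + n\<^sup>2)"
      using n zero_le_power2[of "n - 1"] zero_le_power2[of n] by (simp add: power2_eq_square algebra_simps)
    then show "n / (1 + n\<^sup>2) \<le> 2 / (1 + n)" using n p by (simp add: divide_le_eq field_simps)
    show "2 * (s x / (1 + n\<^sup>2)) \<le> 4 * (s x / (1 + n\<^sup>2))"
      using divide_nonneg_pos[OF nonneg(1)[of x] p(1)] by linarith
  qed (use nonneg[of x] in auto)
  also have "\<dots> = 4 * (s x / (1 + n\<^sup>2) + t x / (1 + n))" by simp
  finally show ?thesis unfolding n_def .
qed

text \<open>The integrand dominates the generator of the confining term at radius R. By dominated
  convergence under the growth hypothesis, confinement at a large radius costs arbitrarily
  little.\<close>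

lemma confining_drift_tendsto_0:
  fixes s t :: "'a::real_normed_vector \<Rightarrow> real"
  assumes int: "integrable M (\<lambda>x. s x / (1 + (norm x)\<^sup>2) + t x / (1 + norm x))"
    and nonneg: "\<And>x. s x \<ge> 0" "\<And>x. t x \<ge> 0"
    and meas: "s \<in> borel_measurable M" "t \<in> borel_measurable M" "norm \<in> borel_measurable M"
  shows "((\<lambda>R. \<integral>x. (2 * s x + 2 * norm x * t x) / (R\<^sup>2 + (norm x)\<^sup>2) \<partial>M) \<longlongrightarrow> 0) at_top"
proof -
  have "((\<lambda>R. \<integral>x. (2 * s x + 2 * norm x * t x) / (R\<^sup>2 + (norm x)\<^sup>2) \<partial>M) \<longlongrightarrow> (\<integral>x. 0 \<partial>M)) at_top"
  proof (rule integral_dominated_convergence_at_top[where w = "\<lambda>x. 4 * (s x / (1 + (norm x)\<^sup>2) + t x / (1 + norm x))"])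
    show "AE x in M. ((\<lambda>R. (2 * s x + 2 * norm x * t x) / (R\<^sup>2 + (norm x)\<^sup>2)) \<longlongrightarrow> 0) at_top"
    proof (rule AE_I2)
      fix x :: 'a
      have "filterlim (\<lambda>R::real. R\<^sup>2 + (norm x)\<^sup>2) at_infinity at_top"
        by (rule filterlim_at_top_imp_at_infinity) real_asymp
      then show "((\<lambda>R. (2 * s x + 2 * norm x * t x) / (R\<^sup>2 + (norm x)\<^sup>2)) \<longlongrightarrow> 0) at_top"
        by (rule tendsto_divide_0[OF tendsto_const])
    qed
    show "\<forall>\<^sub>F R in at_top. AE x in M. norm ((2 * s x + 2 * norm x * t x) / (R\<^sup>2 + (norm x)\<^sup>2))
        \<le> 4 * (s x / (1 + (norm x)\<^sup>2) + t x / (1 + norm x))"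
      using eventually_ge_at_top[of "1::real"]
      by eventually_elim (intro AE_I2, unfold real_norm_def, rule confining_weight_le[OF _ nonneg])
    show "integrable M (\<lambda>x. 4 * (s x / (1 + (norm x)\<^sup>2) + t x / (1 + norm x)))"
      by (intro integrable_mult_right int)
    show "(\<lambda>x. (2 * s x + 2 * norm x * t x) / (R\<^sup>2 + (norm x)\<^sup>2)) \<in> borel_measurable M" for R
      using meas by measurable
  qed simp
  then show ?thesis by simp
qed

lemma gen_log_uniform:
  assumes "e > 0" "\<eta> > 0"
  shows "\<forall>\<^sub>F \<delta> in at_right 0. \<forall>(w :: 'm::finite \<Rightarrow> 'a::real_inner) \<beta> z z'. norm (z - z') \<le> 2 * \<delta> \<longrightarrow>
    gen_log e w \<beta> z \<le> gen_log e w \<beta> z' + \<eta> * coef_norm w \<beta>"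
proof -
  obtain C where C: "C \<ge> 0" "\<And>(w :: 'm \<Rightarrow> 'a) \<beta> z z'.
    \<bar>gen_log e w \<beta> z - gen_log e w \<beta> z'\<bar> \<le> C * norm (z - z') * coef_norm w \<beta>"
    using gen_log_diff_le[OF assms(1), where 'm = 'm and 'a = 'a] unfolding coef_norm_def by blast
  have "((\<lambda>\<delta>. C * (2 * \<delta>)) \<longlongrightarrow> C * (2 * 0)) (at_right 0)" by (intro tendsto_intros)
  then have "\<forall>\<^sub>F \<delta> in at_right 0. C * (2 * \<delta>) < \<eta>" using assms(2) by (intro order_tendstoD(2)) auto
  then show ?thesis
  proof eventually_elim
    case (elim \<delta>)
    show ?case
    proof (intro allI impI)
      fix w :: "'m \<Rightarrow> 'a" and \<beta> z z' :: 'a assume "norm (z - z') \<le> 2 * \<delta>"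
      then have "C * norm (z - z') \<le> C * (2 * \<delta>)" using C(1) by (intro mult_left_mono)
      then have "C * norm (z - z') * coef_norm w \<beta> \<le> \<eta> * coef_norm w \<beta>"
        using elim coef_norm_nonneg[of w \<beta>] by (intro mult_right_mono) auto
      then show "gen_log e w \<beta> z \<le> gen_log e w \<beta> z' + \<eta> * coef_norm w \<beta>"
        using C(2)[of w \<beta> z z'] by linarith
    qed
  qed
qed

lemma fourth_order_cost_small:
  assumes e: "e > 0" and R: "R > 0" and N: "N > 0" and \<eta>: "\<eta> > 0" and M: "M \<ge> 0"
  shows "\<forall>\<^sub>F h in at_right 0. \<forall>(w :: 'm::finite \<Rightarrow> 'a::real_inner) w' \<beta> \<beta>'. coef_norm w \<beta> \<le> M \<longrightarrow> coef_norm w' \<beta>' \<le> M \<longrightarrow>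
    h\<^sup>2 * fourth_order_cost e N R w w' \<beta> \<beta>' \<le> \<eta>"
proof -
  define c where "c a = 1 / a\<^sup>2 + 1 / a" for a :: real
  define B where "B = (\<Sum>i<N. (4 * M)\<^sup>2 * c (e / 2 ^ i)) / N + M\<^sup>2 * c (R\<^sup>2) + M\<^sup>2 * c (R\<^sup>2)"
  have c: "c a \<ge> 0" if "a > 0" for a using that by (simp add: c_def)
  have fo: "fourth_order a w \<beta> \<le> T\<^sup>2 * c a" if "a > 0" "coef_norm w \<beta> \<le> T" for a T and w :: "'m \<Rightarrow> 'a" and \<beta>
  proof -
    have "fourth_order a w \<beta> \<le> (coef_norm w \<beta>)\<^sup>2 * c a"
      unfolding c_def by (rule fourth_order_le[OF that(1)])
    also have "\<dots> \<le> T\<^sup>2 * c a"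
      using that coef_norm_nonneg[of w \<beta>] c by (intro mult_right_mono power_mono) auto
    finally show ?thesis .
  qed
  have B: "fourth_order_cost e N R w w' \<beta> \<beta>' \<le> B" if "coef_norm w \<beta> \<le> M" "coef_norm w' \<beta>' \<le> M"
    for w w' :: "'m \<Rightarrow> 'a" and \<beta> \<beta>'
  proof -
    have "coef_norm (\<lambda>k. w k - w' k) (\<beta> - \<beta>') \<le> 4 * M"
    proof (rule order_trans[OF coef_norm_diff_le])
      have "2 * (coef_norm w \<beta> + coef_norm w' \<beta>') \<le> 2 * (M + M)"
        using that by (intro mult_left_mono add_mono) auto
      then show "2 * (coef_norm w \<beta> + coef_norm w' \<beta>') \<le> 4 * M" by simp
    qed
    then show ?thesis
      unfolding fourth_order_cost_def B_def using e R that
      by (intro add_mono divide_right_mono sum_mono fo) auto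
  qed
  have "((\<lambda>h. h\<^sup>2 * B) \<longlongrightarrow> 0\<^sup>2 * B) (at_right 0)" by (intro tendsto_intros)
  then have "\<forall>\<^sub>F h in at_right 0. h\<^sup>2 * B < \<eta>" using \<eta> by (intro order_tendstoD(2)) auto
  then show ?thesis
  proof eventually_elim
    case (elim h)
    then show ?case using B by (meson less_imp_le mult_left_mono order_trans zero_le_power2)
  qed
qed

text \<open>Each parameter is fixed after those on which its bound depends: the gap g, the compact
  sets, the distance d0, the gain m and the largest scale e; the number N of scales; the confining
  radius R; the cutoff K and the radius P; then \<eta>, \<delta> and the mollifier; the truncation
  M; finally h. Up to the factor h^2 the certified gain is \<epsilon> = m g / 8, and all errors
  together are at most 5 \<epsilon> / 8.\<close>

lemma prob_solutions_eq:
  fixes \<Sigma> :: "real^'n::finite \<Rightarrow> real^'m::finite^'n" and b :: "real^'n \<Rightarrow> real^'n" and \<Lambda> :: "real^'n \<Rightarrow> real"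
  assumes meas: "\<Sigma> \<in> borel_measurable borel" "b \<in> borel_measurable borel" "\<Lambda> \<in> borel_measurable borel"
    and \<Lambda>: "\<And>x. \<Lambda> x \<ge> 0"
    and q\<Lambda>: "\<And>x y. q_fun \<Sigma> b x y \<le> (\<Lambda> x + \<Lambda> y) * (norm (x - y))\<^sup>2"
    and qr: "\<And>x y. x \<noteq> y \<Longrightarrow> q_fun \<Sigma> b x y < 2 * r_fun \<Sigma> x y"
    and sol: "prob_solution \<Sigma> b \<mu>" "prob_solution \<Sigma> b \<nu>"
    and int: "\<And>M. M \<in> {\<mu>, \<nu>} \<Longrightarrow> integrable M (\<lambda>x. (norm (\<Sigma> x))\<^sup>2 / (1 + (norm x)\<^sup>2) + norm (b x) / (1 + norm x) + \<Lambda> x)"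
  shows "\<mu> = \<nu>"
proof (rule ccontr)
  assume ne: "\<mu> \<noteq> \<nu>"
  note [measurable] = meas
  have pr: "prob_space \<mu>" "prob_space \<nu>" and sb: "sets \<mu> = sets borel" "sets \<nu> = sets borel"
    using sol by (auto simp: prob_solution_def)
  note [measurable_cong] = sb
  interpret mu: prob_space \<mu> by (rule pr)
  interpret nu: prob_space \<nu> by (rule pr)
  have solM: "prob_solution \<Sigma> b M" "prob_space M" "sets M = sets borel" if "M \<in> {\<mu>, \<nu>}" for M
    using that sol pr sb by auto
  define \<sigma> where "\<sigma> x k = column k (\<Sigma> x)" for x k
  define Q where "Q x = coef_norm (\<sigma> x) (b x)" for x
  have Qc: "Q = coef_size \<Sigma> b"
    by (auto simp: fun_eq_iff Q_def coef_norm_def coef_size_def \<sigma>_def)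
  have QS: "Q x = (norm (\<Sigma> x))\<^sup>2 + norm (b x)" for x
    by (simp add: Q_def coef_norm_def \<sigma>_def sum_norm_column)
  have Q0: "Q x \<ge> 0" for x by (simp add: QS)
  have [measurable]: "Q \<in> borel_measurable borel" unfolding Qc by (rule coef_size_measurable[OF meas(1,2)])
  have cb [measurable]: "cball (0 :: real^'n) r \<in> sets borel" for r by simp
  define s where "s x = (norm (\<Sigma> x))\<^sup>2" for x
  define t where "t x = norm (b x)" for x
  have [measurable]: "s \<in> borel_measurable borel" "t \<in> borel_measurable borel"
    unfolding s_def[abs_def] t_def[abs_def] by measurable
  have st0: "s x \<ge> 0" "t x \<ge> 0" for x by (auto simp: s_def t_def)
  have i\<Lambda>: "integrable M \<Lambda>" if M: "M \<in> {\<mu>, \<nu>}" for M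
  proof (rule Bochner_Integration.integrable_bound[OF int[OF M]])
    show "\<Lambda> \<in> borel_measurable M" using meas(3) solM(3)[OF M] by (simp cong: measurable_cong_sets)
  qed (use \<Lambda> in \<open>auto simp: add_nonneg_nonneg\<close>)
  have iw: "integrable M (\<lambda>x. s x / (1 + (norm x)\<^sup>2) + t x / (1 + norm x))" if M: "M \<in> {\<mu>, \<nu>}" for M
  proof -
    have "integrable M (\<lambda>x. ((norm (\<Sigma> x))\<^sup>2 / (1 + (norm x)\<^sup>2) + norm (b x) / (1 + norm x) + \<Lambda> x) - \<Lambda> x)"
      by (rule Bochner_Integration.integrable_diff[OF int[OF M] i\<Lambda>[OF M]])
    then show ?thesis by (simp add: s_def t_def)
  qed
  \<comment> \<open>The weights are bounded below on a ball, so the growth hypothesis gives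
    integrability of |\<Sigma>|^2 + |b| there.\<close>
  have iQ: "integrable M (\<lambda>x. Q x * indicator (cball 0 r) x)" if M: "M \<in> {\<mu>, \<nu>}" and r: "r \<ge> 0" for M r
  proof (rule Bochner_Integration.integrable_bound)
    show "integrable M (\<lambda>x. ((1 + r\<^sup>2) + (1 + r)) * (s x / (1 + (norm x)\<^sup>2) + t x / (1 + norm x)))"
      by (intro integrable_mult_right iw[OF M])
    have "(\<lambda>x. Q x * indicator (cball 0 r) x) \<in> borel_measurable borel" by measurable
    then show "(\<lambda>x. Q x * indicator (cball 0 r) x) \<in> borel_measurable M"
      using solM(3)[OF M] by (simp cong: measurable_cong_sets)
    have "\<bar>Q x * indicator (cball 0 r) x\<bar> \<le> \<bar>((1 + r\<^sup>2) + (1 + r)) * (s x / (1 + (norm x)\<^sup>2) + t x / (1 + norm x))\<bar>" for x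
    proof (cases "norm x \<le> r")
      case True
      define u where "u = s x / (1 + (norm x)\<^sup>2)"
      define v where "v = t x / (1 + norm x)"
      have uv: "u \<ge> 0" "v \<ge> 0" using st0 by (auto simp: u_def v_def)
      have p: "1 + (norm x)\<^sup>2 \<noteq> 0" "1 + norm x \<noteq> 0"
        using zero_le_power2[of "norm x"] norm_ge_zero[of x] by linarith+
      have "s x = (1 + (norm x)\<^sup>2) * u" unfolding u_def using p by simp
      also have "\<dots> \<le> (1 + r\<^sup>2) * u" using uv True by (intro mult_right_mono add_left_mono power_mono) auto
      finally have 1: "s x \<le> (1 + r\<^sup>2) * u" .
      have "t x = (1 + norm x) * v" unfolding v_def using p by simp
      also have "\<dots> \<le> (1 + r) * v" using uv True by (intro mult_right_mono) auto
      finally have 2: "t x \<le> (1 + r) * v" .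
      have "0 \<le> (1 + r) * u + (1 + r\<^sup>2) * v" using uv r by auto
      then have "Q x \<le> ((1 + r\<^sup>2) + (1 + r)) * (u + v)"
        using 1 2 by (simp add: QS s_def t_def algebra_simps)
      then show ?thesis using Q0[of x] True by (simp add: u_def v_def)
    qed simp
    then show "AE x in M. norm (Q x * indicator (cball 0 r) x) \<le> norm (((1 + r\<^sup>2) + (1 + r)) * (s x / (1 + (norm x)\<^sup>2) + t x / (1 + norm x)))"
      by simp
  qed

  \<comment> \<open>Separation of the two measures and the gain away from the diagonal\<close>
  obtain f :: "real^'n \<Rightarrow> real" and Lf where f: "Lf \<ge> 0" "\<And>x. \<bar>f x\<bar> \<le> 1" "\<And>x y. \<bar>f x - f y\<bar> \<le> Lf * dist x y"
    "f \<in> borel_measurable borel" "integral\<^sup>L \<nu> f < integral\<^sup>L \<mu> f"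
    using separating_lipschitz[OF mu.finite_measure_axioms nu.finite_measure_axioms sb ne] by metis
  note [measurable] = f(4)
  define g where "g = integral\<^sup>L \<mu> f - integral\<^sup>L \<nu> f"
  have g: "g > 0" using f(5) by (simp add: g_def)
  have Fm: "(\<lambda>x. (\<Sigma> x, b x)) \<in> borel_measurable borel" by measurable
  \<comment> \<open>The two exceptional masses together may consume g/8 in the final balance of the
    certificates.\<close>
  have g16: "g / 16 > 0" using g by simp
  obtain K1 where K1: "compact K1" "continuous_on K1 (\<lambda>x. (\<Sigma> x, b x))" "measure \<mu> (- K1) \<le> g / 16"
    by (rule lusin_compact[OF sb(1) mu.finite_measure_axioms Fm g16])
  obtain K2 where K2: "compact K2" "continuous_on K2 (\<lambda>x. (\<Sigma> x, b x))" "measure \<nu> (- K2) \<le> g / 16"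
    by (rule lusin_compact[OF sb(2) nu.finite_measure_axioms Fm g16])
  have Kb [measurable]: "K1 \<in> sets borel" "K2 \<in> sets borel" using K1(1) K2(1) by (auto simp: borel_compact)
  have cc: "continuous_on K \<Sigma>" "continuous_on K b" "\<And>k. continuous_on K (\<lambda>x. \<sigma> x k)"
    if "continuous_on K (\<lambda>x. (\<Sigma> x, b x))" for K
  proof -
    show 1: "continuous_on K \<Sigma>" using continuous_on_fst[OF that] by simp
    show "continuous_on K b" using continuous_on_snd[OF that] by simp
    show "continuous_on K (\<lambda>x. \<sigma> x k)" for k
      unfolding \<sigma>_def by (rule continuous_on_compose2[OF continuous_column 1 subset_UNIV])
  qed
  \<comment> \<open>Between points closer than d0 the function f varies by at most g/4; Lf + 1
    avoids a zero denominator.\<close>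
  define d0 where "d0 = g / (4 * (Lf + 1))"
  have d0: "d0 > 0" "Lf * d0 \<le> g / 4"
  proof -
    show "d0 > 0" using g f(1) by (simp add: d0_def)
    then have "Lf * d0 \<le> (Lf + 1) * d0" by (intro mult_right_mono) auto
    also have "\<dots> = g / 4" using f(1) by (simp add: d0_def field_simps)
    finally show "Lf * d0 \<le> g / 4" .
  qed
  have q_eq: "q_fun \<Sigma> b x y = (x - y) \<bullet> (b x - b y) + (\<Sum>k\<in>UNIV. (norm (\<sigma> x k - \<sigma> y k))\<^sup>2)" for x y
    by (simp add: q_fun_columns \<sigma>_def)
  have strict: "((x - y) \<bullet> (b x - b y) + (\<Sum>k\<in>UNIV. (norm (\<sigma> x k - \<sigma> y k))\<^sup>2)) * (norm (x - y))\<^sup>2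
        < 2 * (\<Sum>k\<in>UNIV. ((\<sigma> x k - \<sigma> y k) \<bullet> (x - y))\<^sup>2)" if "x \<noteq> y" for x y
  proof -
    have "q_fun \<Sigma> b x y * (norm (x - y))\<^sup>2 < 2 * r_fun \<Sigma> x y * (norm (x - y))\<^sup>2"
      using qr[OF that] that by (intro mult_strict_right_mono) auto
    also have "\<dots> = 2 * (\<Sum>k\<in>UNIV. ((\<sigma> x k - \<sigma> y k) \<bullet> (x - y))\<^sup>2)"
      using r_fun_columns[OF that, of \<Sigma>] by (simp add: \<sigma>_def)
    finally show ?thesis unfolding q_eq .
  qed
  obtain m e where m: "m > 0" and e: "e > 0" and me: "\<And>a x y. 0 < a \<Longrightarrow> a \<le> e \<Longrightarrow> x \<in> K1 \<Longrightarrow> y \<in> K2 \<Longrightarrow> d0 \<le> norm (x - y) \<Longrightarrow>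
      gen_log a (\<lambda>k. \<sigma> x k - \<sigma> y k) (b x - b y) (x - y) \<le> - m"
    using uniform_gain_on_compacts[of K1 K2 \<sigma> b d0, OF K1(1) K2(1) cc(3)[OF K1(2)] cc(3)[OF K2(2)] cc(2)[OF K1(2)] cc(2)[OF K2(2)] d0(1) strict]
    by blast
  define good where "good X Y = (if X \<in> K1 \<and> Y \<in> K2 \<and> d0 \<le> norm (X - Y) then m else 0)" for X Y
  \<comment> \<open>The certificates \<open>a1\<close> and \<open>a2\<close> below have integrals
    with sum at most -g/8, and each unit is worth the gain m.\<close>
  define \<epsilon> where "\<epsilon> = m * g / 8"
  have \<epsilon>: "\<epsilon> > 0" using m g by (simp add: \<epsilon>_def)

  \<comment> \<open>The number of scales\<close>
  define I where "I = integral\<^sup>L \<mu> \<Lambda> + integral\<^sup>L \<nu> \<Lambda>"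
  obtain n :: nat where n: "32 * I / \<epsilon> < real n" using reals_Archimedean2 by blast
  define N where "N = Suc n"
  have N: "N > 0" "4 * I / N \<le> \<epsilon> / 8"
  proof -
    show "N > 0" by (simp add: N_def)
    have "32 * I \<le> \<epsilon> * real N" using n \<epsilon> by (simp add: N_def field_simps)
    then show "4 * I / N \<le> \<epsilon> / 8" by (simp add: N_def field_simps)
  qed
  define L where "L X = 4 * \<Lambda> X / N" for X
  have L0: "L X \<ge> 0" for X using \<Lambda>[of X] by (simp add: L_def)
  have gain: "(\<Sum>i<N. gen_log (e / 2 ^ i) (\<lambda>k. \<sigma> X k - \<sigma> Y k) (b X - b Y) (X - Y)) / N \<le> L X + L Y - good X Y" for X Y
  proof (cases "X \<in> K1 \<and> Y \<in> K2 \<and> d0 \<le> norm (X - Y)")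
    case True
    let ?\<Delta> = "\<lambda>k. \<sigma> X k - \<sigma> Y k"
    \<comment> \<open>All scales are at most e, so each of the N terms is at most -m and their mean
      keeps the full gain.\<close>
    have "e / 2 ^ i \<le> e" for i :: nat using e by (simp add: divide_le_eq mult_le_cancel_left1)
    then have "(\<Sum>i<N. gen_log (e / 2 ^ i) ?\<Delta> (b X - b Y) (X - Y)) \<le> (\<Sum>i<N. - m)"
      using True e by (intro sum_mono me) auto
    then have "(\<Sum>i<N. gen_log (e / 2 ^ i) ?\<Delta> (b X - b Y) (X - Y)) / N \<le> (\<Sum>i<N. - m) / N"
      by (intro divide_right_mono) auto
    also have "\<dots> = - m" using N by simp
    also have "\<dots> \<le> L X + L Y - good X Y" using True L0[of X] L0[of Y] by (simp add: good_def)
    finally show ?thesis .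
  next
    case False
    let ?\<Delta> = "\<lambda>k. \<sigma> X k - \<sigma> Y k"
    have "(\<Sum>i<N. gen_log (e / 2 ^ i) ?\<Delta> (b X - b Y) (X - Y)) / N \<le> 4 * (\<Lambda> X + \<Lambda> Y) / N"
      using \<Lambda>[of X] \<Lambda>[of Y] q\<Lambda>[of X Y] strict[of X Y] by (intro averaged_gain e) (auto simp: q_eq)
    also have "\<dots> = L X + L Y" by (simp add: L_def add_divide_distrib)
    also have "\<dots> = L X + L Y - good X Y" unfolding good_def if_not_P[OF False] by simp
    finally show ?thesis .
  qed

  have "\<forall>\<^sub>F R in at_top. (\<integral>x. (2 * s x + 2 * norm x * t x) / (R\<^sup>2 + (norm x)\<^sup>2) \<partial>M) < \<epsilon> / 16" if M: "M \<in> {\<mu>, \<nu>}" for M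
  proof (rule order_tendstoD(2)[OF confining_drift_tendsto_0[OF iw[OF M] st0]])
    show "s \<in> borel_measurable M" "t \<in> borel_measurable M" "norm \<in> borel_measurable M"
      using solM(3)[OF M] by (simp_all cong: measurable_cong_sets)
  qed (use \<epsilon> in auto)
  then have "\<forall>\<^sub>F R in at_top. (\<forall>M\<in>{\<mu>, \<nu>}. (\<integral>x. (2 * s x + 2 * norm x * t x) / (R\<^sup>2 + (norm x)\<^sup>2) \<partial>M) < \<epsilon> / 16) \<and> R \<ge> 1"
    by (intro eventually_conj eventually_ge_at_top eventually_ball_finite) auto
  then obtain R :: real where R: "R \<ge> 1"
    "\<And>M. M \<in> {\<mu>, \<nu>} \<Longrightarrow> (\<integral>x. (2 * s x + 2 * norm x * t x) / (R\<^sup>2 + (norm x)\<^sup>2) \<partial>M) < \<epsilon> / 16"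
    by (auto simp: eventually_at_top_linorder)
  have R0: "R > 0" using R(1) by simp
  \<comment> \<open>Bounds the generator of the confining term, by Cauchy-Schwarz and omission of
    its nonpositive part. By the choice of R its integral against either measure is below
    \<epsilon>/16.\<close>
  define W where "W x = (2 * s x + 2 * norm x * t x) / (R\<^sup>2 + (norm x)\<^sup>2)" for x
  have W0: "W x \<ge> 0" for x unfolding W_def using st0[of x] by (intro divide_nonneg_nonneg add_nonneg_nonneg mult_nonneg_nonneg) auto
  have Wg: "gen_log (R\<^sup>2) (\<sigma> X) (b X) X \<le> W X" for X
  proof -
    have p: "0 < (norm X)\<^sup>2 + R\<^sup>2" using R0 by (intro add_nonneg_pos) auto
    have "gen_log (R\<^sup>2) (\<sigma> X) (b X) X \<le> (2 * s X + 2 * (X \<bullet> b X)) / ((norm X)\<^sup>2 + R\<^sup>2)"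
      unfolding gen_log_def by (simp add: s_def \<sigma>_def sum_norm_column sum_nonneg)
    also have "\<dots> \<le> W X"
      unfolding W_def t_def using p norm_cauchy_schwarz[of X "b X"]
      by (simp add: add.commute[of "(norm X)\<^sup>2"] divide_right_mono)
    finally show ?thesis .
  qed
  have iW: "integrable M W" if M: "M \<in> {\<mu>, \<nu>}" for M
  proof (rule Bochner_Integration.integrable_bound)
    show "integrable M (\<lambda>x. 4 * (s x / (1 + (norm x)\<^sup>2) + t x / (1 + norm x)))"
      by (intro integrable_mult_right iw[OF M])
    have "W \<in> borel_measurable borel" unfolding W_def[abs_def] by measurable
    then show "W \<in> borel_measurable M" using solM(3)[OF M] by (simp cong: measurable_cong_sets)
    show "AE x in M. norm (W x) \<le> norm (4 * (s x / (1 + (norm x)\<^sup>2) + t x / (1 + norm x)))"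
    proof (intro AE_I2)
      fix x
      show "norm (W x) \<le> norm (4 * (s x / (1 + (norm x)\<^sup>2) + t x / (1 + norm x)))"
        using order_trans[OF confining_weight_le[of R s t x, OF R(1) st0] abs_ge_self]
        by (simp only: W_def real_norm_def)
    qed
  qed

  \<comment> \<open>Cutoff level, support radius and mollification\<close>
  have "bounded (K1 \<union> K2)" using K1(1) K2(1) by (simp add: compact_imp_bounded)
  then obtain B where B: "B > 0" "\<And>x. x \<in> K1 \<union> K2 \<Longrightarrow> norm x \<le> B" unfolding bounded_pos by blast
  have "bounded ((\<lambda>z. cost e N R (fst z) (snd z)) ` (cball (0 :: real^'n) (B + 1) \<times> cball (0 :: real^'n) (B + 1)))"
    by (intro compact_imp_bounded compact_continuous_image continuous_cost e R0 compact_Times compact_cball)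
  \<comment> \<open>The radius B + 1 leaves room for displacements \<delta> < 1, so the mollified
    positions of a good pair still have cost below K.\<close>
  then obtain K where K: "K > 0"
    "\<And>x y :: real^'n. norm x \<le> B + 1 \<Longrightarrow> norm y \<le> B + 1 \<Longrightarrow> cost e N R x y < K"
  proof -
    assume "bounded ((\<lambda>z. cost e N R (fst z) (snd z)) ` (cball (0 :: real^'n) (B + 1) \<times> cball (0 :: real^'n) (B + 1)))"
    then obtain c where c: "c > 0" "\<And>x y :: real^'n. norm x \<le> B + 1 \<Longrightarrow> norm y \<le> B + 1 \<Longrightarrow> \<bar>cost e N R x y\<bar> \<le> c"
      unfolding bounded_pos by force
    have "cost e N R x y < c + 1" if "norm x \<le> B + 1" "norm y \<le> B + 1" for x y :: "real^'n"
      using c(2)[OF that] by linarith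
    then show ?thesis using c(1) by (intro that[of "c + 1"]) auto
  qed
  \<comment> \<open>For |z| \<ge> R exp(K) the confining term is at least ln(1 + exp(2 K)), which
    exceeds K.\<close>
  define P where "P = R * exp K"
  have P0: "P > 0" using R0 by (simp add: P_def)
  have costP: "K < cost e N R x y" if "P \<le> norm x \<or> P \<le> norm y" for x y :: "real^'n"
  proof -
    have conf: "K < ln (1 + (norm z)\<^sup>2 / R\<^sup>2)" if z: "P \<le> norm z" for z :: "real^'n"
    proof -
      have "(exp K)\<^sup>2 = P\<^sup>2 / R\<^sup>2" using R0 by (simp add: P_def power_mult_distrib)
      also have "\<dots> \<le> (norm z)\<^sup>2 / R\<^sup>2" using z P0 by (intro divide_right_mono power_mono) auto
      finally have "(exp K)\<^sup>2 < 1 + (norm z)\<^sup>2 / R\<^sup>2" by linarith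
      moreover have "exp K \<le> (exp K)\<^sup>2" using K(1) by (intro self_le_power) auto
      ultimately have "exp K < 1 + (norm z)\<^sup>2 / R\<^sup>2" by linarith
      then have "ln (exp K) < ln (1 + (norm z)\<^sup>2 / R\<^sup>2)" by (subst ln_less_cancel_iff) (auto intro: order_less_trans[OF exp_gt_zero])
      then show ?thesis by simp
    qed
    then show ?thesis using that cost_ge_confining(1)[OF e R0, of x N y] cost_ge_confining(2)[OF e R0, of y N x] by (meson order_less_le_trans)
  qed
  \<comment> \<open>P + 1 accommodates the bumps centred in the ball of radius P, and B accommodates
    \<open>K1\<close> and \<open>K2\<close>.\<close>
  define P' where "P' = max (P + 1) B"
  have P'0: "P' \<ge> 0" using P0 by (simp add: P'_def)
  define J where "J = (\<integral>x. Q x * indicator (cball 0 P') x \<partial>\<mu>) + (\<integral>x. Q x * indicator (cball 0 P') x \<partial>\<nu>)"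
  have J0: "J \<ge> 0" unfolding J_def using Q0 by (intro add_nonneg_nonneg integral_nonneg) auto
  \<comment> \<open>Solves 4 \<eta> J + 2 \<eta> = \<epsilon>/8, where the left side is the total of
    the \<eta>-terms of \<open>A\<close> over both measures.\<close>
  define \<eta> where "\<eta> = \<epsilon> / (8 * (4 * J + 2))"
  have \<eta>: "\<eta> > 0" "4 * \<eta> * J + 2 * \<eta> \<le> \<epsilon> / 8"
  proof -
    show "\<eta> > 0" using \<epsilon> J0 by (simp add: \<eta>_def)
    have "4 * \<eta> * J + 2 * \<eta> = \<eta> * (4 * J + 2)" by (simp add: algebra_simps)
    also have "\<dots> = \<epsilon> / 8"
    proof -
      have "\<epsilon> / (8 * r) * r = \<epsilon> / 8" if "r > 0" for r using that by simp
      from this[of "4 * J + 2"] J0 show ?thesis unfolding \<eta>_def by linarith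
    qed
    finally show "4 * \<eta> * J + 2 * \<eta> \<le> \<epsilon> / 8" by simp
  qed
  define E where "E = insert (R\<^sup>2) ((\<lambda>i. e / 2 ^ i) ` {..<N})"
  have E: "finite E" "\<And>a. a \<in> E \<Longrightarrow> a > 0" using e R0 by (auto simp: E_def)
  have "\<forall>\<^sub>F \<delta> in at_right 0. \<forall>a\<in>E. \<forall>(w :: 'm \<Rightarrow> real^'n) \<beta> z z'. norm (z - z') \<le> 2 * \<delta> \<longrightarrow>
    gen_log a w \<beta> z \<le> gen_log a w \<beta> z' + \<eta> * coef_norm w \<beta>"
    by (rule eventually_ball_finite[OF E(1) ballI]) (rule gen_log_uniform[OF E(2) \<eta>(1)])
  moreover have "\<forall>\<^sub>F \<delta> in at_right (0::real). \<delta> < 1"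
    unfolding eventually_at_right_field by (intro exI[of _ 1]) auto
  moreover have "\<forall>\<^sub>F \<delta> in at_right (0::real). 0 < \<delta>" by (rule eventually_at_right_less)
  ultimately have "\<forall>\<^sub>F \<delta> in at_right 0. (\<forall>a\<in>E. \<forall>(w :: 'm \<Rightarrow> real^'n) \<beta> z z'. norm (z - z') \<le> 2 * \<delta> \<longrightarrow>
    gen_log a w \<beta> z \<le> gen_log a w \<beta> z' + \<eta> * coef_norm w \<beta>) \<and> \<delta> < 1 \<and> 0 < \<delta>"
    by eventually_elim (intro conjI)
  from eventually_happens'[OF trivial_limit_at_right_real this]
  obtain \<delta> where \<delta>': "\<forall>a\<in>E. \<forall>(w :: 'm \<Rightarrow> real^'n) \<beta> z z'. norm (z - z') \<le> 2 * \<delta> \<longrightarrow>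
    gen_log a w \<beta> z \<le> gen_log a w \<beta> z' + \<eta> * coef_norm w \<beta>" and \<delta>: "\<delta> < 1" "0 < \<delta>"
    by (elim exE conjE)
  define C where "C = (\<Sum>a\<in>E. 2 * (1 / a + 1))"
  have C0: "C \<ge> 0" unfolding C_def using E(2) by (intro sum_nonneg) (auto simp: less_imp_le)
  have Cg: "gen_log a w \<beta> z \<le> C * coef_norm w \<beta>" if "a \<in> E" for a and w :: "'m \<Rightarrow> real^'n" and \<beta> z
  proof -
    have "2 * (1 / a + 1) \<le> C" unfolding C_def using E that by (intro member_le_sum) (auto simp: less_imp_le)
    then have "2 * (1 / a + 1) * coef_norm w \<beta> \<le> C * coef_norm w \<beta>"
      by (intro mult_right_mono coef_norm_nonneg)
    then show ?thesis using gen_log_le[OF E(2)[OF that], of w \<beta> z] by (simp add: coef_norm_def)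
  qed
  \<comment> \<open>The bump with parameter d lies in the ball of radius \<open>CARD('n)\<close>
    times d, which is made equal to \<delta>.\<close>
  define d where "d = \<delta> / real CARD('n)"
  have d: "d > 0" "real CARD('n) * d = \<delta>" using \<delta>(2) by (auto simp: d_def)
  define c0 where "c0 = bump_mass d TYPE('n)"
  have c0: "c0 > 0" unfolding c0_def by (rule bump_mass_pos[OF d(1)])
  define V where "V = measure lborel (cball 0 P :: (real^'n) set)"
  have V: "V \<ge> 0" by (simp add: V_def)
  \<comment> \<open>Makes the defect bounds of the two marginals together at most \<epsilon>/8,
    before the common factor h^2.\<close>
  define e1 where "e1 = \<epsilon> * c0 / (16 * (K * V + 1))"
  have KV: "K * V \<ge> 0" using K(1) V by simp
  have e1: "e1 > 0" "2 * (K * V * e1 / c0) \<le> \<epsilon> / 8"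
  proof -
    show "e1 > 0" using \<epsilon> c0 KV by (simp add: e1_def)
    have "2 * (K * V * e1 / c0) = \<epsilon> / 8 * (K * V / (K * V + 1))"
    proof -
      have "2 * (r * (\<epsilon> * c0 / (16 * r')) / c0) = \<epsilon> / 8 * (r / r')" if "r' > 0" for r r'
        using c0 that by (simp add: field_simps)
      from this[of "K * V + 1" "K * V"] KV show ?thesis unfolding e1_def by simp
    qed
    also have "\<dots> \<le> \<epsilon> / 8 * 1" using \<epsilon> KV by (intro mult_left_mono) auto
    finally show "2 * (K * V * e1 / c0) \<le> \<epsilon> / 8" by simp
  qed

  \<comment> \<open>Truncation of the coefficients and the step length\<close>
  define S where "S M = {x. norm x \<le> P' \<and> Q x \<le> M}" for M
  define small where "small M h \<tau> \<longleftrightarrow> (\<forall>z. norm z \<le> P \<longrightarrow>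
    \<bar>\<integral>x. kernel_defect \<Sigma> b d (S M) h z x \<partial>\<tau>\<bar> \<le> e1 * h\<^sup>2)" for M h \<tau>
  have evk: "\<forall>\<^sub>F M in at_top. \<forall>\<^sub>F h in at_right 0. small M h \<tau>" if "\<tau> \<in> {\<mu>, \<nu>}" for \<tau>
    unfolding small_def S_def Qc
  proof (rule kernel_moves_small[OF solM(1)[OF that] meas(1,2)])
    show "integrable \<tau> (\<lambda>x. coef_size \<Sigma> b x * indicat_real (cball 0 P') x)"
      using iQ[OF that P'0] by (simp add: Qc)
    show "P + real CARD('n) * d \<le> P'" using d(2) \<delta>(1) by (simp add: P'_def)
    show "e1 > 0" by (rule e1)
  qed
  have evt: "\<forall>\<^sub>F M in at_top. 2 * C * (\<integral>x. (Q x * indicator (cball 0 P') x) * indicator {x. Q x > M} x \<partial>\<tau>) < \<epsilon> / 16" if "\<tau> \<in> {\<mu>, \<nu>}" for \<tau>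
  proof -
    have "Q \<in> borel_measurable \<tau>" using solM(3)[OF that] by (simp cong: measurable_cong_sets)
    then have "((\<lambda>M. 2 * C * (\<integral>x. (Q x * indicator (cball 0 P') x) * indicator {x. Q x > M} x \<partial>\<tau>)) \<longlongrightarrow> 2 * C * 0) at_top"
      by (intro tendsto_mult_left tail_integral_tendsto_0[OF iQ[OF that P'0]])
    then show ?thesis using \<epsilon> by (intro order_tendstoD(2)) auto
  qed
  \<comment> \<open>By continuity Q is bounded on \<open>K1\<close> and on \<open>K2\<close>; taking
    M above this bound ensures that good pairs are not frozen.\<close>
  have cQ: "continuous_on G Q" if "continuous_on G (\<lambda>x. (\<Sigma> x, b x))" for G
    unfolding QS by (intro continuous_intros cc[OF that])
  have "bounded (Q ` K1 \<union> Q ` K2)"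
    using cQ[OF K1(2)] cQ[OF K2(2)] K1(1) K2(1) by (simp add: compact_imp_bounded compact_continuous_image)
  then obtain BQ where BQ': "\<forall>y\<in>Q ` K1 \<union> Q ` K2. norm y \<le> BQ" unfolding bounded_iff ..
  have BQ: "Q x \<le> BQ" if "x \<in> K1 \<union> K2" for x
  proof -
    have "norm (Q x) \<le> BQ" using BQ' that by blast
    then show ?thesis by simp
  qed
  have "\<forall>\<^sub>F M in at_top. \<forall>\<tau>\<in>{\<mu>, \<nu>}. \<forall>\<^sub>F h in at_right 0. small M h \<tau>"
    by (rule eventually_ball_finite[OF _ ballI[OF evk]]) auto
  moreover have "\<forall>\<^sub>F M in at_top. \<forall>\<tau>\<in>{\<mu>, \<nu>}. 2 * C * (\<integral>x. (Q x * indicator (cball 0 P') x) * indicator {x. Q x > M} x \<partial>\<tau>) < \<epsilon> / 16"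
    by (rule eventually_ball_finite[OF _ ballI[OF evt]]) auto
  ultimately have "\<forall>\<^sub>F M in at_top. (\<forall>\<tau>\<in>{\<mu>, \<nu>}. \<forall>\<^sub>F h in at_right 0. small M h \<tau>)
     \<and> (\<forall>\<tau>\<in>{\<mu>, \<nu>}. 2 * C * (\<integral>x. (Q x * indicator (cball 0 P') x) * indicator {x. Q x > M} x \<partial>\<tau>) < \<epsilon> / 16) \<and> max 0 BQ \<le> M"
    using eventually_ge_at_top[of "max 0 BQ"] by eventually_elim (intro conjI)
  from eventually_happens'[OF trivial_limit_at_top_linorder this]
  obtain M where M: "\<forall>\<tau>\<in>{\<mu>, \<nu>}. \<forall>\<^sub>F h in at_right 0. small M h \<tau>"
    "\<forall>\<tau>\<in>{\<mu>, \<nu>}. 2 * C * (\<integral>x. (Q x * indicator (cball 0 P') x) * indicator {x. Q x > M} x \<partial>\<tau>) < \<epsilon> / 16" "max 0 BQ \<le> M"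
    by (elim exE conjE)
  have M0: "M \<ge> 0" using M(3) by simp
  have KS: "K1 \<subseteq> S M" "K2 \<subseteq> S M"
    using B(2) BQ M(3) by (force simp: S_def P'_def)+
  have [measurable]: "S M \<in> sets borel" unfolding S_def by measurable
  have "\<forall>\<^sub>F h in at_right 0. \<forall>\<tau>\<in>{\<mu>, \<nu>}. small M h \<tau>"
    by (rule eventually_ball_finite[OF _ M(1)]) auto
  then have "\<forall>\<^sub>F h in at_right 0. (\<forall>\<tau>\<in>{\<mu>, \<nu>}. small M h \<tau>)
    \<and> (\<forall>(w :: 'm \<Rightarrow> real^'n) w' \<beta> \<beta>'. coef_norm w \<beta> \<le> M \<longrightarrow> coef_norm w' \<beta>' \<le> M \<longrightarrow>
    h\<^sup>2 * fourth_order_cost e N R w w' \<beta> \<beta>' \<le> \<eta>) \<and> 0 < h"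
    using fourth_order_cost_small[OF e R0 N(1) \<eta>(1) M0, where 'm = 'm and 'a = "real^'n"] eventually_at_right_less[of 0]
    by eventually_elim (intro conjI)
  from eventually_happens'[OF trivial_limit_at_right_real this]
  obtain h where h: "\<forall>\<tau>\<in>{\<mu>, \<nu>}. small M h \<tau>"
    and four: "\<forall>(w :: 'm \<Rightarrow> real^'n) w' \<beta> \<beta>'. coef_norm w \<beta> \<le> M \<longrightarrow> coef_norm w' \<beta>' \<le> M \<longrightarrow>
    h\<^sup>2 * fourth_order_cost e N R w w' \<beta> \<beta>' \<le> \<eta>" and h0: "0 < h"
    by (elim exE conjE)

  \<comment> \<open>Error functions and one-variable certificates\<close>
  define A where "A X = L X + W X + 4 * \<eta> * (Q X * indicator (cball 0 P') X)
      + 2 * C * ((Q X * indicator (cball 0 P') X) * indicator {X. Q X > M} X) + \<eta>" for X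
  have A0: "0 \<le> A X" for X
    using L0[of X] W0[of X] Q0[of X] \<eta>(1) C0 by (auto simp: A_def indicator_def)
  \<comment> \<open>A pair that is not good either has a point outside its compact set, where the
    indicator outweighs the terms in f because |f| \<le> 1, or it is close, and then (f X - f Y)/2
    \<le> g/8 is outweighed by the two constants g/8. On good pairs the sum
    \<open>a1 X + a2 Y\<close> is at least -1. The integrals add up to at most g/8 + g/4 - g/2 =
    -g/8, where -g/2 comes from the separation by f.\<close>
  define a1 where "a1 X = indicator (- K1) X + g / 8 - f X / 2" for X
  define a2 where "a2 X = indicator (- K2) X + g / 8 + f X / 2" for X
  have cert: "- good X Y \<le> m * (a1 X + a2 Y)" for X Y
  proof (cases "X \<in> K1 \<and> Y \<in> K2 \<and> d0 \<le> norm (X - Y)")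
    case True
    have "- 1 \<le> a1 X + a2 Y" using f(2)[of X] f(2)[of Y] g True by (auto simp: a1_def a2_def abs_le_iff)
    then have "m * (- 1) \<le> m * (a1 X + a2 Y)" using m by (intro mult_left_mono) auto
    then show ?thesis using True by (simp add: good_def)
  next
    case False
    have "0 \<le> a1 X + a2 Y"
    proof (cases "X \<in> K1 \<and> Y \<in> K2")
      case True
      then have "norm (X - Y) \<le> d0" using False by simp
      then have "Lf * dist X Y \<le> Lf * d0" using f(1) by (intro mult_left_mono) (auto simp: dist_norm)
      then have "f X - f Y \<le> g / 4" using f(3)[of X Y] d0(2) by linarith
      moreover have "a1 X + a2 Y = g / 4 + f Y / 2 - f X / 2"
        using True by (simp add: a1_def a2_def)
      ultimately show ?thesis using g by linarith
    next
      case False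
      then show ?thesis using f(2)[of X] f(2)[of Y] g by (auto simp: a1_def a2_def abs_le_iff indicator_def)
    qed
    then show ?thesis using m unfolding good_def if_not_P[OF False] by simp
  qed
  have iA: "integrable \<tau> A \<and> integral\<^sup>L \<tau> A \<le> 4 * integral\<^sup>L \<tau> \<Lambda> / N + \<epsilon> / 16 + 4 * \<eta> * (\<integral>x. Q x * indicator (cball 0 P') x \<partial>\<tau>) + \<epsilon> / 16 + \<eta>"
    if \<tau>: "\<tau> \<in> {\<mu>, \<nu>}" for \<tau>
  proof -
    interpret tau: prob_space \<tau> using solM(2)[OF \<tau>] .
    have [measurable_cong]: "sets \<tau> = sets borel" by (rule solM(3)[OF \<tau>])
    have 1: "integrable \<tau> (\<lambda>X. (Q X * indicator (cball 0 P') X) * indicator {X. Q X > M} X)"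
      by (rule Bochner_Integration.integrable_bound[OF iQ[OF \<tau> P'0]]) (measurable, auto simp: indicator_def)
    have 2: "integrable \<tau> L" unfolding L_def[abs_def] using i\<Lambda>[OF \<tau>] by simp
    have 3: "integral\<^sup>L \<tau> L = 4 * integral\<^sup>L \<tau> \<Lambda> / N" unfolding L_def[abs_def] by simp
    have "integral\<^sup>L \<tau> A = integral\<^sup>L \<tau> L + integral\<^sup>L \<tau> W + 4 * \<eta> * (\<integral>x. Q x * indicator (cball 0 P') x \<partial>\<tau>)
      + 2 * C * (\<integral>X. (Q X * indicator (cball 0 P') X) * indicator {X. Q X > M} X \<partial>\<tau>) + \<eta>"
      unfolding A_def[abs_def] using 1 2 iW[OF \<tau>] iQ[OF \<tau> P'0] by (simp add: tau.prob_space)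
    moreover have "integrable \<tau> A"
      unfolding A_def[abs_def] using 1 2 iW[OF \<tau>] iQ[OF \<tau> P'0] by simp
    ultimately show ?thesis
      using R(2)[OF \<tau>] bspec[OF M(2) \<tau>] 3 by (simp add: W_def[abs_def])
  qed
  have ia1: "integrable \<mu> a1" "integral\<^sup>L \<mu> a1 = measure \<mu> (- K1) + g / 8 - integral\<^sup>L \<mu> f / 2"
  proof -
    have "integrable \<mu> f" by (rule mu.integrable_const_bound[of _ 1]) (use f(2) in auto)
    moreover have "integrable \<mu> (indicator (- K1) :: _ \<Rightarrow> real)" by (intro integrable_real_indicator) (auto simp: mu.emeasure_eq_measure)
    ultimately show "integrable \<mu> a1" "integral\<^sup>L \<mu> a1 = measure \<mu> (- K1) + g / 8 - integral\<^sup>L \<mu> f / 2"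
      unfolding a1_def[abs_def] using sets_eq_imp_space_eq[OF sb(1)] mu.prob_space by simp_all
  qed
  have ia2: "integrable \<nu> a2" "integral\<^sup>L \<nu> a2 = measure \<nu> (- K2) + g / 8 + integral\<^sup>L \<nu> f / 2"
  proof -
    have "integrable \<nu> f" by (rule nu.integrable_const_bound[of _ 1]) (use f(2) in auto)
    moreover have "integrable \<nu> (indicator (- K2) :: _ \<Rightarrow> real)" by (intro integrable_real_indicator) (auto simp: nu.emeasure_eq_measure)
    ultimately show "integrable \<nu> a2" "integral\<^sup>L \<nu> a2 = measure \<nu> (- K2) + g / 8 + integral\<^sup>L \<nu> f / 2"
      unfolding a2_def[abs_def] using sets_eq_imp_space_eq[OF sb(2)] nu.prob_space by simp_all
  qed
  show False
  proof (rule no_uniform_gain[where \<Sigma> = \<Sigma> and b = b and D = "profit K e N R" and K = K and P = P and d = d and \<delta> = \<delta>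
        and S = "S M" and h = h and e = "e1 * h\<^sup>2" and A = "\<lambda>X. h\<^sup>2 * (A X + m * a1 X)" and B = "\<lambda>Y. h\<^sup>2 * (A Y + m * a2 Y)"
        and c = "h\<^sup>2 * m", OF pr(1) sb(1) pr(2) sb(2) meas(1,2)])
    have cp: "continuous_on UNIV (\<lambda>z :: (real^'n) \<times> (real^'n). profit K e N R (fst z) (snd z))"
      unfolding profit_def by (intro continuous_intros continuous_cost e R0)
    show "continuous_on UNIV (\<lambda>x. profit K e N R x y)" for y :: "real^'n"
      using continuous_on_compose2[OF cp, of UNIV "\<lambda>x. (x, y)"] by (simp add: continuous_intros)
    show "continuous_on UNIV (profit K e N R x)" for x :: "real^'n"
      using continuous_on_compose2[OF cp, of UNIV "\<lambda>y. (x, y)"] by (simp add: continuous_intros)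
    show "0 \<le> profit K e N R x y" for x y :: "real^'n" by (simp add: profit_def)
    show "profit K e N R x y \<le> K" for x y :: "real^'n"
      using cost_nonneg[OF e R0, of N x y] K(1) by (simp add: profit_def)
    show "profit K e N R x y = 0" if "P \<le> norm x \<or> P \<le> norm y" for x y :: "real^'n"
      using costP[OF that] by (simp add: profit_def)
    show "d > 0" by (rule d)
    show "real CARD('n) * d \<le> \<delta>" using d(2) by simp
    show "S M \<in> sets borel" by measurable
    show "\<bar>\<integral>x. kernel_defect \<Sigma> b d (S M) h z x \<partial>\<tau>\<bar> \<le> e1 * h\<^sup>2" if "\<tau> \<in> {\<mu>, \<nu>}" "norm z \<le> P" for \<tau> z
      using h that unfolding small_def by blast
    show "integrable \<mu> (\<lambda>X. h\<^sup>2 * (A X + m * a1 X))" using iA[of \<mu>] ia1 by simp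
    show "integrable \<nu> (\<lambda>Y. h\<^sup>2 * (A Y + m * a2 Y))" using iA[of \<nu>] ia2 by simp
    show "- (h\<^sup>2 * m) \<le> h\<^sup>2 * (A Y + m * a2 Y)" for Y
    proof -
      have "- 1 \<le> a2 Y" using f(2)[of Y] g by (auto simp: a2_def abs_le_iff indicator_def)
      then have "m * (- 1) \<le> m * a2 Y" using m by (intro mult_left_mono) auto
      then have "- m \<le> A Y + m * a2 Y" using A0[of Y] by linarith
      then have "h\<^sup>2 * (- m) \<le> h\<^sup>2 * (A Y + m * a2 Y)" by (intro mult_left_mono) auto
      then show ?thesis by simp
    qed
    show "real (2 * CARD('m) + 1) * profit K e N R x y - (h\<^sup>2 * (A X + m * a1 X) + h\<^sup>2 * (A Y + m * a2 Y))
      \<le> moves h (\<lambda>k. (freeze (S M) (\<lambda>x. column k (\<Sigma> x)) X, freeze (S M) (\<lambda>x. column k (\<Sigma> x)) Y)) (freeze (S M) b X, freeze (S M) b Y)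
          (\<lambda>v. profit K e N R (x + fst v) (y + snd v))"
      if xy: "norm (x - X) \<le> \<delta>" "norm (y - Y) \<le> \<delta>" for X x Y y
    proof -
      have nb: "norm x' \<le> B + 1" if "norm (x' - X') \<le> \<delta>" "X' \<in> K1 \<union> K2" for x' X'
        using B(2)[OF that(2)] that(1) \<delta>(1) norm_triangle_sub[of x' X'] by linarith
      have "real (2 * CARD('m) + 1) * profit K e N R x y - h\<^sup>2 * (A X + A Y - good X Y)
        \<le> moves h (\<lambda>k. (freeze (S M) (\<lambda>x. \<sigma> x k) X, freeze (S M) (\<lambda>x. \<sigma> x k) Y)) (freeze (S M) b X, freeze (S M) b Y)
          (\<lambda>v. profit K e N R (x + fst v) (y + snd v))"
      proof (rule coupled_increment[OF e R0 N(1) M0 C0 less_imp_le[OF \<eta>(1)] Q_def S_def, where P = P and W = W and L = L])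
        show "cost e N R x y < K \<Longrightarrow> norm x \<le> P \<and> norm y \<le> P" for x y :: "real^'n"
          using costP[of x y] by (meson less_imp_le not_less order.asym)
        show "P + \<delta> \<le> P'" using \<delta>(1) by (simp add: P'_def)
        show "gen_log a w \<beta> z \<le> gen_log a w \<beta> z' + \<eta> * coef_norm w \<beta>"
          if "a \<in> insert (R\<^sup>2) ((\<lambda>i. e / 2 ^ i) ` {..<N})" "norm (z - z') \<le> 2 * \<delta>" for a and w :: "'m \<Rightarrow> real^'n" and \<beta> z z'
          using \<delta>' that unfolding E_def by blast
        show "gen_log a w \<beta> z \<le> C * coef_norm w \<beta>"
          if "a \<in> insert (R\<^sup>2) ((\<lambda>i. e / 2 ^ i) ` {..<N})" for a and w :: "'m \<Rightarrow> real^'n" and \<beta> z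
          using Cg that unfolding E_def by blast
        show "good X Y \<noteq> 0 \<Longrightarrow> X \<in> S M \<and> Y \<in> S M" for X Y
          using KS by (auto simp: good_def split: if_splits)
        show "cost e N R x y < K" if "good X Y \<noteq> 0" "norm (x - X) \<le> \<delta>" "norm (y - Y) \<le> \<delta>" for X Y x y
          using that by (intro K(2) nb[of x X] nb[of y Y]) (auto simp: good_def split: if_splits)
      qed (use four gain L0 Wg W0 A_def xy in auto)
      moreover have "h\<^sup>2 * (A X + A Y - good X Y) \<le> h\<^sup>2 * (A X + m * a1 X) + h\<^sup>2 * (A Y + m * a2 Y)"
      proof -
        have "h\<^sup>2 * (A X + A Y - good X Y) \<le> h\<^sup>2 * (A X + A Y + m * (a1 X + a2 Y))"
          using cert[of X Y] by (intro mult_left_mono) auto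
        then show ?thesis by (simp add: algebra_simps)
      qed
      ultimately show ?thesis unfolding \<sigma>_def by linarith
    qed
    have "integral\<^sup>L \<mu> A + integral\<^sup>L \<nu> A \<le> 4 * I / N + \<epsilon> / 4 + (4 * \<eta> * J + 2 * \<eta>)"
      using iA[of \<mu>] iA[of \<nu>] by (simp add: I_def J_def algebra_simps add_divide_distrib)
    then have Ab: "integral\<^sup>L \<mu> A + integral\<^sup>L \<nu> A \<le> \<epsilon> / 2" using N(2) \<eta>(2) by linarith
    have "integral\<^sup>L \<mu> a1 + integral\<^sup>L \<nu> a2 \<le> - g / 8"
      using ia1(2) ia2(2) K1(3) K2(3) g_def by linarith
    then have "m * (integral\<^sup>L \<mu> a1 + integral\<^sup>L \<nu> a2) \<le> m * (- g / 8)" using m by (intro mult_left_mono) auto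
    then have ab: "m * (integral\<^sup>L \<mu> a1 + integral\<^sup>L \<nu> a2) \<le> - \<epsilon>" by (simp add: \<epsilon>_def)
    have "2 * (K * V * (e1 * h\<^sup>2) / c0) + integral\<^sup>L \<mu> (\<lambda>X. h\<^sup>2 * (A X + m * a1 X)) + integral\<^sup>L \<nu> (\<lambda>Y. h\<^sup>2 * (A Y + m * a2 Y))
      = h\<^sup>2 * (2 * (K * V * e1 / c0) + (integral\<^sup>L \<mu> A + integral\<^sup>L \<nu> A) + m * (integral\<^sup>L \<mu> a1 + integral\<^sup>L \<nu> a2))"
      using iA[of \<mu>] iA[of \<nu>] ia1 ia2 by (simp add: algebra_simps)
    \<comment> \<open>The bracket is at most \<epsilon>/8 + \<epsilon>/2 - \<epsilon>. Every
      contribution carries the same factor h^2, so the sign does not depend on h.\<close>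
    also have "\<dots> < 0"
      using e1(2) Ab ab \<epsilon> h0 by (intro mult_pos_neg) auto
    finally show "2 * (K * measure lborel (cball 0 P :: (real^'n) set) * (e1 * h\<^sup>2) / bump_mass d TYPE('n))
      + integral\<^sup>L \<mu> (\<lambda>X. h\<^sup>2 * (A X + m * a1 X)) + integral\<^sup>L \<nu> (\<lambda>Y. h\<^sup>2 * (A Y + m * a2 Y)) < 0"
      by (simp add: V_def c0_def)
  qed
qed

theorem theorem2:
  fixes \<Sigma> :: "real^'n::finite \<Rightarrow> real^'m::finite^'n"
    and b :: "real^'n \<Rightarrow> real^'n"
    and \<Lambda> :: "real^'n \<Rightarrow> real"
  assumes "\<Sigma> \<in> borel_measurable borel"
    and "b \<in> borel_measurable borel"
    and "\<Lambda> \<in> borel_measurable borel"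
    and "\<And>x. \<Lambda> x \<ge> 0"
    and "\<And>x y. q_fun \<Sigma> b x y \<le> (\<Lambda> x + \<Lambda> y) * (norm (x - y))\<^sup>2"
    and "\<And>x y. x \<noteq> y \<Longrightarrow> q_fun \<Sigma> b x y < 2 * r_fun \<Sigma> x y"
  shows "\<forall>\<mu> \<nu>.
     (prob_solution \<Sigma> b \<mu> \<and>
      (\<integral>\<^sup>+ x. ennreal ((norm (\<Sigma> x))\<^sup>2 / (1 + (norm x)\<^sup>2) + norm (b x) / (1 + norm x) + \<Lambda> x) \<partial>\<mu>) < \<infinity>) \<and>
     (prob_solution \<Sigma> b \<nu> \<and>
      (\<integral>\<^sup>+ x. ennreal ((norm (\<Sigma> x))\<^sup>2 / (1 + (norm x)\<^sup>2) + norm (b x) / (1 + norm x) + \<Lambda> x) \<partial>\<nu>) < \<infinity>)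
     \<longrightarrow> \<mu> = \<nu>"
proof (intro allI impI)
  fix \<mu> \<nu> :: "(real^'n) measure"
  let ?w = "\<lambda>x. (norm (\<Sigma> x))\<^sup>2 / (1 + (norm x)\<^sup>2) + norm (b x) / (1 + norm x) + \<Lambda> x"
  assume *: "(prob_solution \<Sigma> b \<mu> \<and> (\<integral>\<^sup>+ x. ennreal (?w x) \<partial>\<mu>) < \<infinity>) \<and>
     (prob_solution \<Sigma> b \<nu> \<and> (\<integral>\<^sup>+ x. ennreal (?w x) \<partial>\<nu>) < \<infinity>)"
  have int: "integrable M ?w" if "prob_solution \<Sigma> b M" "(\<integral>\<^sup>+ x. ennreal (?w x) \<partial>M) < \<infinity>" for M
  proof (rule integrableI_nonneg)
    have "?w \<in> borel_measurable borel" using assms(1-3) by measurable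
    then show "?w \<in> borel_measurable M"
      using that(1) by (simp add: prob_solution_def cong: measurable_cong_sets)
    show "AE x in M. 0 \<le> ?w x" using assms(4) by (auto intro!: AE_I2 add_nonneg_nonneg)
  qed (rule that)
  show "\<mu> = \<nu>"
    by (rule prob_solutions_eq[OF assms]) (use * int in auto)
qed

end
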